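(* Let $n\ge2$, $g\in L^1(\mathbb{S}^{n-1})$ and $\omega\in\mathbb{S}^{n-1}$. For $f\in L^1(\mathbb{S}^{n-1})$ put $$Sf(\omega)=\left(\int_{-1}^1(A_tf(\omega))^2\,dt\right)^{1/2}.$$ Then for any $v\in\langle\omega\rangle^\perp$, $$X(|\widehat{gd\sigma}|^2)(\omega,v)=2\pi\int_{-1}^1|\widehat{gd\sigma}_{\omega,t}(v)|^2\,dt,$$ and $$\sup_{v\in\langle\omega\rangle^\perp}X(|\widehat{gd\sigma}|^2)(\omega,v)\le X_0(|\widehat{|g|d\sigma}|^2)(\omega)=2\pi\,S(|g|)(\omega)^2,$$ with equality (in the inequality) if $g$ is single-signed. (All quantities are understood in $[0,\infty]$.)
   Context: $d\sigma$ is surface measure on the unit sphere $\mathbb{S}^{n-1}\subset\mathbb{R}^n$, and $\widehat{gd\sigma}(x)=\int_{\mathbb{S}^{n-1}}e^{ix\cdot\xi}g(\xi)\,d\sigma(\xi)$. For $\omega\in\mathbb{S}^{n-1}$ and $t\in(-1,1)$, $d\sigma_{\omega,t}(x)=\delta(x\cdot\omega-t)\,d\sigma(x)$ is the measure on the slice $\{x\in\mathbb{S}^{n-1}:x\cdot\omega=t\}$ given by $(1-t^2)^{-1/2}$ times $(n-2)$-dimensional Hausdorff measure, so that $\int_{\mathbb{S}^{n-1}}f\,d\sigma=\int_{-1}^1\int f\,d\sigma_{\omega,t}\,dt$. For $f\in L^1(\mathbb{S}^{n-1})$, $A_tf(\omega)=\int_{\mathbb{S}^{n-1}}f\,d\sigma_{\omega,t}$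 and $\widehat{fd\sigma}_{\omega,t}(x)=\int e^{ix\cdot\xi}f(\xi)\,d\sigma_{\omega,t}(\xi)$, defined for a.e. $t$. The X-ray transform is $Xf(\omega,v)=\int_{\mathbb{R}}f(v+s\omega)\,ds$ for $v\in\langle\omega\rangle^\perp$, the hyperplane through the origin orthogonal to $\omega$, and $X_0f(\omega)=\int_{\mathbb{R}}f(s\omega)\,ds$. Single-signed means $g\ge0$ a.e. or $g\le0$ a.e. *)

theory Defs
  imports "HOL-Analysis.Analysis"
begin

text \<open>Normalised with the volume of the unit ball of $\mathbf{R}^k$, so that the
  $k$-dimensional Hausdorff measure agrees with Lebesgue measure on $\mathbf{R}^k$. Since
  \<open>0 ^ 0 = 1\<close>, the case \<open>k = 0\<close> is counting measure; the empty set has to be treated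
  separately for this reason. Sets are required to be \<open>bounded\<close> because \<open>diameter\<close> is
  unspecified on unbounded ones.\<close>

definition hausdorff_content :: "nat \<Rightarrow> real \<Rightarrow> 'a::metric_space set \<Rightarrow> ennreal" where
  "hausdorff_content k \<delta> A =
     (INF C \<in> {C :: nat \<Rightarrow> 'a set. A \<subseteq> (\<Union>i. C i) \<and> (\<forall>i. bounded (C i) \<and> diameter (C i) \<le> \<delta>)}.
        \<Sum>i. if C i = {} then 0
            else ennreal (unit_ball_vol (real k) * (diameter (C i) / 2) ^ k))"

definition hausdorff_outer :: "nat \<Rightarrow> 'a::metric_space set \<Rightarrow> ennreal" where
  "hausdorff_outer k A = (SUP \<delta>\<in>{0<..}. hausdorff_content k \<delta> A)"

text \<open>The outer measure is a metric outer measure, hence countably additive on the Borel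
  sets, so \<open>measure_of\<close> does not collapse to the zero measure here.\<close>

definition hausdorff_measure :: "nat \<Rightarrow> 'a::metric_space measure" where
  "hausdorff_measure k = measure_of UNIV (sets borel) (hausdorff_outer k)"

definition surface_measure :: "'a::euclidean_space measure" where
  "surface_measure = restrict_space (hausdorff_measure (DIM('a) - 1)) (sphere 0 1)"

definition slice_measure :: "'a::euclidean_space \<Rightarrow> real \<Rightarrow> 'a measure" where
  "slice_measure \<omega> t =
     scale_measure (ennreal ((1 - t\<^sup>2) powr (- 1 / 2)))
       (restrict_space (hausdorff_measure (DIM('a) - 2)) {x \<in> sphere 0 1. x \<bullet> \<omega> = t})"

text \<open>The Fourier transform of the measure \<open>g dM\<close>, with kernel $e^{i x \cdot \xi}$.\<close>

definition fourier_measure :: "'a::euclidean_space measure \<Rightarrow> ('a \<Rightarrow> complex) \<Rightarrow> 'a \<Rightarrow> complex" where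
  "fourier_measure M g x = (\<integral>\<xi>. exp (\<i> * complex_of_real (x \<bullet> \<xi>)) * g \<xi> \<partial>M)"

definition slice_mean :: "real \<Rightarrow> ('a::euclidean_space \<Rightarrow> real) \<Rightarrow> 'a \<Rightarrow> real" where
  "slice_mean t f \<omega> = (\<integral>\<xi>. f \<xi> \<partial>slice_measure \<omega> t)"

definition ennreal_sqrt :: "ennreal \<Rightarrow> ennreal" where
  "ennreal_sqrt x = (if x = \<infinity> then \<infinity> else ennreal (sqrt (enn2real x)))"

definition slice_square :: "('a::euclidean_space \<Rightarrow> real) \<Rightarrow> 'a \<Rightarrow> ennreal" where
  "slice_square f \<omega> =
     ennreal_sqrt (\<integral>\<^sup>+t\<in>{-1<..<1}. ennreal ((slice_mean t f \<omega>)\<^sup>2) \<partial>lborel)"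

definition xray :: "('a::euclidean_space \<Rightarrow> ennreal) \<Rightarrow> 'a \<Rightarrow> 'a \<Rightarrow> ennreal" where
  "xray f \<omega> v = (\<integral>\<^sup>+s. f (v + s *\<^sub>R \<omega>) \<partial>lborel)"

definition xray0 :: "('a::euclidean_space \<Rightarrow> ennreal) \<Rightarrow> 'a \<Rightarrow> ennreal" where
  "xray0 f \<omega> = (\<integral>\<^sup>+s. f (s *\<^sub>R \<omega>) \<partial>lborel)"

text \<open>For a complex-valued \<open>g\<close>, an inequality \<open>g \<ge> 0\<close> or \<open>g \<le> 0\<close> includes that \<open>g\<close> is real.\<close>

definition single_signed :: "('a::euclidean_space \<Rightarrow> complex) \<Rightarrow> bool" where
  "single_signed g \<longleftrightarrow>
     (AE x in surface_measure. g x \<in> \<real> \<and> Re (g x) \<ge> 0) \<or>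
     (AE x in surface_measure. g x \<in> \<real> \<and> Re (g x) \<le> 0)"

end

theory Submission imports Defs "HOL-Probability.Probability"
begin

text \<open>
  On the slice \<open>x \<bullet> \<omega> = t\<close> the character at \<open>v + s *\<^sub>R \<omega>\<close> factors as the character at \<open>v\<close>
  times \<open>exp (\<i> * (s * t))\<close>. If surface measure is the superposition of the slice measures, then
  along the line \<open>s \<mapsto> v + s *\<^sub>R \<omega>\<close> the Fourier transform of \<open>g\<close> is the one-dimensional Fourier
  transform of \<open>G t = fourier_measure (slice_measure \<omega> t) g v\<close>, extended by zero outside
  \<open>{-1<..<1}\<close>, and Plancherel's identity for \<open>G\<close> is the formula for the X-ray transform.
  The triangle inequality bounds \<open>cmod (G t)\<close> by the slice mean of \<open>cmod (g \<xi>)\<close>, which is the value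
  of the same expression for \<open>cmod (g \<xi>)\<close> at \<open>v = 0\<close>; this is the inequality. A single-signed \<open>g\<close>
  agrees with \<open>cmod (g \<xi>)\<close> up to a constant sign, so that \<open>v = 0\<close> attains the supremum.

  Two inputs carry the weight. The first is \<open>plancherel_L1\<close>: \<open>G\<close> is only known to be integrable,
  so Plancherel's identity is needed with both sides possibly infinite. A Gaussian weight makes all
  integrals converge absolutely. The inequality in one direction then comes from Schur's test,
  the other one from duality with continuous functions.

  The second is \<open>sphere_slicing\<close>, the disintegration of surface measure into slice measures. Both are
  restricted Hausdorff measures, of the different dimensions $n-1$ and $n-2$, so their normalising
  constants have to match. The common yardstick is Lebesgue measure on linear subspaces
  (\<open>hausdorff_outer_eq_span_lebesgue\<close>): Hausdorff measure is at least as large by the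
  isodiametric inequality, which follows from Steiner symmetrisation, and it is at most as large because
  open sets can be filled with small balls. Near any point of the sphere except the poles \<open>\<omega>\<close> and
  \<open>- \<omega>\<close>, some linear map is almost isometric on the sphere and takes the slices to parallel affine
  subspaces, whose distances it scales so as to absorb the density of the slice measures
  (\<open>sphere_slicing_local\<close>). Fubini's theorem in the image gives
  the slicing formula up to a factor arbitrarily close to 1; countably many such pieces
  cover the sphere without the poles.
\<close>

section \<open>Hausdorff measure is a Borel measure\<close>

text \<open>Caratheodory's criterion. The part of \<open>A\<close> at distance at least \<open>1 / (n + 1)\<close> from \<open>C\<close> is
  separated from \<open>A \<inter> C\<close>, so only the gain of these parts as \<open>n\<close> grows has to be controlled. It is
  cut into shells \<open>R\<close>. Shells whose indices have the same parity are separated from each other, so their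
  measures sum to at most \<open>\<mu> A\<close>; hence the sum over all shells converges and its tails vanish.\<close>

lemma metric_outer_measure_closed_caratheodory:
  fixes \<mu> :: "'a::metric_space set \<Rightarrow> ennreal"
  assumes emp: "\<mu> {} = 0"
    and mono: "\<And>A B. A \<subseteq> B \<Longrightarrow> \<mu> A \<le> \<mu> B"
    and subadd: "\<And>A. \<mu> (\<Union>i::nat. A i) \<le> (\<Sum>i. \<mu> (A i))"
    and sep: "\<And>A B e. e > 0 \<Longrightarrow> (\<And>x y. x \<in> A \<Longrightarrow> y \<in> B \<Longrightarrow> e \<le> dist x y) \<Longrightarrow> \<mu> A + \<mu> B \<le> \<mu> (A \<union> B)"
    and C: "closed C"
  shows "\<mu> (A \<inter> C) + \<mu> (A - C) \<le> \<mu> A"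
proof (cases "C = {} \<or> \<mu> A = \<infinity>")
  case True
  then show ?thesis using emp by auto
next
  case False
  then have Cne: "C \<noteq> {}" and fin: "\<mu> A < \<infinity>" by (auto simp: less_top)
  have un2: "\<mu> (X \<union> Y) \<le> \<mu> X + \<mu> Y" for X Y
  proof -
    have "\<mu> (X \<union> Y) \<le> \<mu> (\<Union>i::nat. if i = 0 then X else if i = 1 then Y else {})"
      by (intro mono) (auto split: if_splits intro: exI[of _ "0::nat"] exI[of _ "1::nat"])
    also have "\<dots> \<le> (\<Sum>i::nat. \<mu> (if i = 0 then X else if i = 1 then Y else {}))" by (rule subadd)
    also have "\<dots> = (\<Sum>i\<in>{0,1::nat}. \<mu> (if i = 0 then X else if i = 1 then Y else {}))"
      by (rule suminf_finite) (auto simp: emp)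
    finally show ?thesis by simp
  qed
  define a where "a n = A \<inter> {x. infdist x C \<ge> 1 / (real n + 1)}" for n
  define R where "R n = a (Suc n) - a n" for n
  have amono: "a n \<subseteq> a (Suc n)" for n
    unfolding a_def by (auto intro: order_trans[rotated] simp: frac_le)
  have aA: "a n \<subseteq> A" for n by (auto simp: a_def)
  have far: "\<mu> (A \<inter> C) + \<mu> (a n) \<le> \<mu> A" for n
  proof -
    have "\<mu> (A \<inter> C) + \<mu> (a n) \<le> \<mu> (A \<inter> C \<union> a n)"
    proof (rule sep)
      show "1 / (real n + 1) > 0" by simp
      fix x y assume "x \<in> A \<inter> C" "y \<in> a n"
      then have "1 / (real n + 1) \<le> infdist y C" "infdist y C \<le> dist y x" by (auto simp: a_def infdist_le)
      then show "1 / (real n + 1) \<le> dist x y" by (simp add: dist_commute)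
    qed
    also have "\<dots> \<le> \<mu> A" by (intro mono) (auto simp: a_def)
    finally show ?thesis .
  qed
  \<comment> \<open>The inner part \<open>a i\<close> and a shell starting beyond it are separated by the width of one shell.\<close>
  have gap: "\<mu> X + \<mu> (R j) \<le> \<mu> (X \<union> R j)" if "X \<subseteq> a i" "Suc i \<le> j" for X i j
  proof (rule sep)
    show "1 / (real i + 1) - 1 / (real i + 2) > 0" by (simp add: frac_less2)
    fix x y assume x: "x \<in> X" and y: "y \<in> R j"
    have "1 / (real i + 1) \<le> infdist x C" using x that by (auto simp: a_def)
    also have "\<dots> \<le> infdist y C + dist x y" by (rule infdist_triangle)
    finally have 1: "1 / (real i + 1) \<le> infdist y C + dist x y" .
    have "infdist y C \<le> 1 / (real j + 1)" using y by (auto simp: R_def a_def)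
    also have "\<dots> \<le> 1 / (real i + 2)" using that by (intro frac_le) auto
    finally show "1 / (real i + 1) - 1 / (real i + 2) \<le> dist x y" using 1 by linarith
  qed
  have aij: "a i \<subseteq> a j" if "i \<le> j" for i j using lift_Suc_mono_le[of a, OF amono that] .
  \<comment> \<open>Every second shell: each one is separated from the part of \<open>A\<close> that contains its predecessors.\<close>
  have sums: "(\<Sum>i<m. \<mu> (R (2 * i + p + 1))) \<le> \<mu> (a (2 * m + p))" for m p
  proof (induction m)
    case (Suc m)
    have "(\<Sum>i<Suc m. \<mu> (R (2 * i + p + 1))) \<le> \<mu> (a (2 * m + p)) + \<mu> (R (2 * m + p + 1))"
      using Suc by (simp add: add_right_mono)
    also have "\<dots> \<le> \<mu> (a (2 * m + p) \<union> R (2 * m + p + 1))"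
      by (rule gap) auto
    also have "\<dots> \<le> \<mu> (a (2 * Suc m + p))"
      using aij[of "2 * m + p" "2 * Suc m + p"] by (intro mono) (auto simp: R_def)
    finally show ?case .
  qed simp
  define S where "S = (\<Sum>i. \<mu> (R (i + 1)))"
  have part: "(\<Sum>i<m. \<mu> (R (i + 1))) \<le> 2 * \<mu> A" for m
  proof -
    have "(\<Sum>i<m. \<mu> (R (i + 1))) \<le> (\<Sum>i<2*m. \<mu> (R (i + 1)))"
      by (intro sum_mono2) auto
    also have "\<dots> = (\<Sum>i<m. \<mu> (R (2 * i + 0 + 1))) + (\<Sum>i<m. \<mu> (R (2 * i + 1 + 1)))"
      by (induction m) (simp_all add: algebra_simps)
    also have "\<dots> \<le> \<mu> A + \<mu> A"
      by (intro add_mono order_trans[OF sums] mono aA)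
    finally show ?thesis by (simp add: mult_2)
  qed
  have "S \<le> 2 * \<mu> A" unfolding S_def by (intro suminf_le_const part) auto
  then have Sfin: "S < \<infinity>" using fin by (auto simp: ennreal_mult_less_top intro: le_less_trans)
  have split: "\<mu> (A - C) + (\<Sum>i<n. \<mu> (R (i + 1))) \<le> \<mu> (a (Suc n)) + S" for n
  proof -
    \<comment> \<open>A point of \<open>A - C\<close> first enters the sets \<open>a k\<close> at some stage; after stage \<open>Suc n\<close> it lies in a shell.\<close>
    have "A - C \<subseteq> a (Suc n) \<union> (\<Union>i. R (i + n + 1))"
    proof
      fix x assume x: "x \<in> A - C"
      then have "infdist x C > 0"
        using in_closed_iff_infdist_zero[OF C Cne, of x] infdist_nonneg[of x C] by auto
      then obtain m where "1 / (real m + 1) < infdist x C"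
        by (metis nat_approx_posE of_nat_Suc add.commute)
      then have ex: "x \<in> a m" using x by (auto simp: a_def)
      define k where "k = (LEAST k. x \<in> a k)"
      have k: "x \<in> a k" "\<And>j. j < k \<Longrightarrow> x \<notin> a j" unfolding k_def using ex by (auto intro: LeastI dest: not_less_Least)
      show "x \<in> a (Suc n) \<union> (\<Union>i. R (i + n + 1))"
      proof (cases "k \<le> Suc n")
        case True
        then show ?thesis using aij k by auto
      next
        case False
        then have "k = Suc ((k - n - 2) + n + 1)" by simp
        then have "x \<in> R ((k - n - 2) + n + 1)" using k unfolding R_def by (metis Diff_iff lessI)
        then show ?thesis by blast
      qed
    qed
    then have "\<mu> (A - C) \<le> \<mu> (a (Suc n)) + \<mu> (\<Union>i. R (i + n + 1))"
      by (meson mono order_trans un2)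
    also have "\<dots> \<le> \<mu> (a (Suc n)) + (\<Sum>i. \<mu> (R (i + n + 1)))"
      by (intro add_left_mono subadd)
    finally have "\<mu> (A - C) + (\<Sum>i<n. \<mu> (R (i + 1))) \<le> \<mu> (a (Suc n)) + ((\<Sum>i. \<mu> (R (i + n + 1))) + (\<Sum>i<n. \<mu> (R (i + 1))))"
      by (metis add.assoc add_right_mono)
    also have "(\<Sum>i. \<mu> (R (i + n + 1))) + (\<Sum>i<n. \<mu> (R (i + 1))) = S"
      unfolding S_def using suminf_offset[of "\<lambda>i. \<mu> (R (i + 1))" n] by (simp add: add.commute)
    finally show ?thesis .
  qed
  have "\<mu> (A \<inter> C) + \<mu> (A - C) + (\<Sum>i<n. \<mu> (R (i + 1))) \<le> \<mu> A + S" for n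
  proof -
    have "\<mu> (A \<inter> C) + \<mu> (A - C) + (\<Sum>i<n. \<mu> (R (i + 1))) \<le> \<mu> (A \<inter> C) + (\<mu> (a (Suc n)) + S)"
      using split[of n] by (simp add: add.assoc add_left_mono)
    also have "\<dots> \<le> \<mu> A + S"
      using far[of "Suc n"] by (metis add.assoc add_right_mono)
    finally show ?thesis .
  qed
  moreover have "(\<lambda>n. \<mu> (A \<inter> C) + \<mu> (A - C) + (\<Sum>i<n. \<mu> (R (i + 1)))) \<longlonglongrightarrow> \<mu> (A \<inter> C) + \<mu> (A - C) + S"
    unfolding S_def by (intro tendsto_add tendsto_const summable_LIMSEQ) auto
  ultimately have "\<mu> (A \<inter> C) + \<mu> (A - C) + S \<le> \<mu> A + S"
    by (intro LIMSEQ_le_const2) auto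
  then show ?thesis using Sfin
    by (metis add.commute ennreal_add_left_cancel_le infinity_ennreal_def order_less_irrefl)
qed

text \<open>The summand in the definition of the Hausdorff content.\<close>

definition hausdorff_weight :: "nat \<Rightarrow> 'a::metric_space set \<Rightarrow> ennreal" where
  "hausdorff_weight k C = (if C = {} then 0 else ennreal (unit_ball_vol (real k) * (diameter C / 2) ^ k))"

lemma hausdorff_content_le:
  fixes C :: "nat \<Rightarrow> 'a::metric_space set"
  assumes "A \<subseteq> (\<Union>i. C i)" "\<And>i. bounded (C i)" "\<And>i. diameter (C i) \<le> \<delta>"
  shows "hausdorff_content k \<delta> A \<le> (\<Sum>i. hausdorff_weight k (C i))"
  unfolding hausdorff_content_def hausdorff_weight_def using assms by (intro INF_lower) auto

lemma hausdorff_content_geI: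
  fixes A :: "'a::metric_space set"
  assumes "\<And>C :: nat \<Rightarrow> 'a set. A \<subseteq> (\<Union>i. C i) \<Longrightarrow> (\<And>i. bounded (C i)) \<Longrightarrow> (\<And>i. diameter (C i) \<le> \<delta>)
     \<Longrightarrow> x \<le> (\<Sum>i. hausdorff_weight k (C i))"
  shows "x \<le> hausdorff_content k \<delta> A"
  unfolding hausdorff_content_def using assms unfolding hausdorff_weight_def by (intro INF_greatest) auto

lemma hausdorff_content_coverE:
  fixes A :: "'a::metric_space set"
  assumes "hausdorff_content k \<delta> A < x"
  obtains C :: "nat \<Rightarrow> 'a set" where "A \<subseteq> (\<Union>i. C i)" "\<And>i. bounded (C i)" "\<And>i. diameter (C i) \<le> \<delta>"
     "(\<Sum>i. hausdorff_weight k (C i)) < x"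
  using assms unfolding hausdorff_content_def INF_less_iff hausdorff_weight_def[symmetric] by blast

lemma hausdorff_weight_empty [simp]: "hausdorff_weight k {} = 0"
  by (simp add: hausdorff_weight_def)

lemma hausdorff_content_mono: "A \<subseteq> B \<Longrightarrow> hausdorff_content k \<delta> A \<le> hausdorff_content k \<delta> B"
  by (rule hausdorff_content_geI) (auto intro!: hausdorff_content_le)

lemma hausdorff_content_antimono: "\<delta> \<le> \<epsilon> \<Longrightarrow> hausdorff_content k \<epsilon> A \<le> hausdorff_content k \<delta> A"
  by (rule hausdorff_content_geI) (auto intro!: hausdorff_content_le order_trans[of _ \<delta> \<epsilon>])

lemma hausdorff_content_empty: "\<delta> \<ge> 0 \<Longrightarrow> hausdorff_content k \<delta> {} = 0"
  using hausdorff_content_le[of "{}" "\<lambda>_. {}" \<delta> k] by simp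

lemma hausdorff_content_bounded_le:
  assumes "bounded A" "diameter A \<le> \<delta>"
  shows "hausdorff_content k \<delta> A \<le> hausdorff_weight k A"
proof -
  have d: "0 \<le> \<delta>" using assms diameter_ge_0[of A] by linarith
  have "hausdorff_content k \<delta> A \<le> (\<Sum>i. hausdorff_weight k (if i = (0::nat) then A else {}))"
    using assms d by (intro hausdorff_content_le) (auto split: if_splits)
  also have "\<dots> = (\<Sum>i\<in>{0::nat}. hausdorff_weight k (if i = 0 then A else {}))"
    by (intro suminf_finite) auto
  finally show ?thesis by simp
qed

lemma hausdorff_content_countably_subadditive:
  "hausdorff_content k \<delta> (\<Union>i::nat. A i) \<le> (\<Sum>i. hausdorff_content k \<delta> (A i))"
proof (rule ennreal_le_epsilon)
  fix e :: real assume "0 < e" "(\<Sum>n. hausdorff_content k \<delta> (A n)) < top"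
  then have *: "hausdorff_content k \<delta> (A n) < hausdorff_content k \<delta> (A n) + e * (1/2)^Suc n" for n
    by (auto simp add: less_top dest!: ennreal_suminf_lessD)
  have "\<exists>C::nat \<Rightarrow> 'a set. A n \<subseteq> (\<Union>i. C i) \<and> (\<forall>i. bounded (C i) \<and> diameter (C i) \<le> \<delta>) \<and>
     (\<Sum>i. hausdorff_weight k (C i)) \<le> hausdorff_content k \<delta> (A n) + e * (1/2)^Suc n" for n
    using hausdorff_content_coverE[OF *[of n]] by (metis order_less_imp_le)
  then obtain B :: "nat \<Rightarrow> nat \<Rightarrow> 'a set" where B: "\<And>n. A n \<subseteq> (\<Union>i. B n i)" "\<And>n i. bounded (B n i)" "\<And>n i. diameter (B n i) \<le> \<delta>"
     "\<And>n. (\<Sum>i. hausdorff_weight k (B n i)) \<le> hausdorff_content k \<delta> (A n) + e * (1/2)^Suc n"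
    by metis
  define C where "C = case_prod B o prod_decode"
  have sub: "(\<Union>i. A i) \<subseteq> (\<Union>i. C i)"
    using B(1) by (auto simp add: C_def subset_eq) (metis prod.case prod_encode_inverse)
  have "hausdorff_content k \<delta> (\<Union>i. A i) \<le> (\<Sum>i. hausdorff_weight k (C i))"
    using sub B by (intro hausdorff_content_le) (auto simp: C_def split_def)
  also have "\<dots> = (\<Sum>n. \<Sum>i. hausdorff_weight k (B n i))"
    using suminf_ennreal_2dimen[of "\<lambda>n. \<Sum>i. hausdorff_weight k (B n i)" "\<lambda>(m,n). hausdorff_weight k (B m n)"]
    by (simp add: C_def split_def)
  also have "\<dots> \<le> (\<Sum>n. hausdorff_content k \<delta> (A n) + e * (1/2) ^ Suc n)"
    by (intro suminf_le allI B) auto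
  also have "\<dots> = (\<Sum>n. hausdorff_content k \<delta> (A n)) + (\<Sum>n. ennreal e * ennreal ((1/2) ^ Suc n))"
    using \<open>0 < e\<close> by (subst suminf_add[symmetric])
                     (auto simp del: ennreal_suminf_cmult simp add: ennreal_mult[symmetric])
  also have "\<dots> = (\<Sum>n. hausdorff_content k \<delta> (A n)) + e"
    unfolding ennreal_suminf_cmult
    by (subst suminf_ennreal_eq[OF zero_le_power power_half_series]) auto
  finally show "hausdorff_content k \<delta> (\<Union>i. A i) \<le> (\<Sum>n. hausdorff_content k \<delta> (A n)) + e" .
qed

lemma hausdorff_content_Un:
  assumes "\<delta> \<ge> 0"
  shows "hausdorff_content k \<delta> (X \<union> Y) \<le> hausdorff_content k \<delta> X + hausdorff_content k \<delta> Y"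
proof -
  let ?A = "\<lambda>i::nat. if i = 0 then X else if i = 1 then Y else {}"
  have "hausdorff_content k \<delta> (X \<union> Y) \<le> hausdorff_content k \<delta> (\<Union>i. ?A i)"
    by (intro hausdorff_content_mono) (auto split: if_splits intro: exI[of _ "0::nat"] exI[of _ "1::nat"])
  also have "\<dots> \<le> (\<Sum>i. hausdorff_content k \<delta> (?A i))" by (rule hausdorff_content_countably_subadditive)
  also have "\<dots> = (\<Sum>i\<in>{0,1}. hausdorff_content k \<delta> (?A i))"
    using assms by (intro suminf_finite) (auto simp: hausdorff_content_empty)
  finally show ?thesis by simp
qed

lemma hausdorff_content_le_outer: "\<delta> > 0 \<Longrightarrow> hausdorff_content k \<delta> A \<le> hausdorff_outer k A"
  unfolding hausdorff_outer_def by (intro SUP_upper) auto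

lemma hausdorff_outer_leI:
  "(\<And>\<delta>. \<delta> > 0 \<Longrightarrow> hausdorff_content k \<delta> A \<le> x) \<Longrightarrow> hausdorff_outer k A \<le> x"
  unfolding hausdorff_outer_def by (intro SUP_least) auto

lemma hausdorff_outer_empty: "hausdorff_outer k {} = 0"
  using hausdorff_outer_leI[of k "{}" 0] by (simp add: hausdorff_content_empty)

lemma hausdorff_outer_mono: "A \<subseteq> B \<Longrightarrow> hausdorff_outer k A \<le> hausdorff_outer k B"
  by (meson hausdorff_content_le_outer hausdorff_content_mono hausdorff_outer_leI order_trans)

lemma hausdorff_outer_countably_subadditive:
  "hausdorff_outer k (\<Union>i::nat. A i) \<le> (\<Sum>i. hausdorff_outer k (A i))"
proof (rule hausdorff_outer_leI)
  fix \<delta> :: real assume "\<delta> > 0"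
  then have "(\<Sum>i. hausdorff_content k \<delta> (A i)) \<le> (\<Sum>i. hausdorff_outer k (A i))"
    by (intro suminf_le hausdorff_content_le_outer) auto
  then show "hausdorff_content k \<delta> (\<Union>i. A i) \<le> (\<Sum>i. hausdorff_outer k (A i))"
    using hausdorff_content_countably_subadditive order_trans by blast
qed

text \<open>A covering set of diameter at most \<open>\<delta>\<close> cannot meet both sets, so any cover of the union
  splits into a cover of \<open>A\<close> and a cover of \<open>B\<close>.\<close>

lemma hausdorff_content_separated:
  assumes d: "0 \<le> \<delta>" "\<delta> < e" and AB: "\<And>x y. x \<in> A \<Longrightarrow> y \<in> B \<Longrightarrow> e \<le> dist x y"
  shows "hausdorff_content k \<delta> A + hausdorff_content k \<delta> B \<le> hausdorff_content k \<delta> (A \<union> B)"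
proof (rule hausdorff_content_geI)
  fix C :: "nat \<Rightarrow> 'a set" assume C: "A \<union> B \<subseteq> (\<Union>i. C i)" "\<And>i. bounded (C i)" "\<And>i. diameter (C i) \<le> \<delta>"
  define P where "P i = (C i \<inter> A \<noteq> {})" for i
  have nB: "C i \<inter> B = {}" if "P i" for i
  proof (rule ccontr)
    assume "C i \<inter> B \<noteq> {}"
    moreover have "C i \<inter> A \<noteq> {}" using that by (simp add: P_def)
    ultimately obtain x y where "x \<in> C i" "x \<in> A" "y \<in> C i" "y \<in> B" by blast
    then have "dist x y \<le> \<delta>" "e \<le> dist x y"
      using diameter_bounded_bound[OF C(2)] C(3) AB order_trans by blast+
    then show False using d by linarith
  qed
  have "hausdorff_content k \<delta> A \<le> (\<Sum>i. hausdorff_weight k (if P i then C i else {}))"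
    using C d by (intro hausdorff_content_le) (auto simp: P_def split: if_splits, blast)
  moreover have "hausdorff_content k \<delta> B \<le> (\<Sum>i. hausdorff_weight k (if P i then {} else C i))"
  proof (rule hausdorff_content_le)
    show "B \<subseteq> (\<Union>i. if P i then {} else C i)"
    proof
      fix x assume "x \<in> B"
      then obtain i where "x \<in> C i" using C(1) by blast
      then have "x \<in> (if P i then {} else C i)" using nB[of i] \<open>x \<in> B\<close> by auto
      then show "x \<in> (\<Union>i. if P i then {} else C i)" by blast
    qed
  qed (use C d in auto)
  ultimately have "hausdorff_content k \<delta> A + hausdorff_content k \<delta> B \<le>
     (\<Sum>i. hausdorff_weight k (if P i then C i else {})) + (\<Sum>i. hausdorff_weight k (if P i then {} else C i))"
    by (rule add_mono)
  also have "\<dots> = (\<Sum>i. hausdorff_weight k (if P i then C i else {}) + hausdorff_weight k (if P i then {} else C i))"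
    by (rule suminf_add) auto
  also have "\<dots> = (\<Sum>i. hausdorff_weight k (C i))" by (rule suminf_cong) auto
  finally show "hausdorff_content k \<delta> A + hausdorff_content k \<delta> B \<le> (\<Sum>i. hausdorff_weight k (C i))" .
qed

lemma hausdorff_outer_tendsto:
  "(\<lambda>n. hausdorff_content k (inverse (real (Suc n))) A) \<longlonglongrightarrow> hausdorff_outer k A"
proof -
  have "hausdorff_outer k A = (SUP n. hausdorff_content k (inverse (real (Suc n))) A)"
    unfolding hausdorff_outer_def
  proof (intro antisym SUP_least)
    fix \<delta> :: real assume "\<delta> \<in> {0<..}"
    then obtain n where "inverse (real (Suc n)) < \<delta>" using reals_Archimedean by auto
    then show "hausdorff_content k \<delta> A \<le> (SUP n. hausdorff_content k (inverse (real (Suc n))) A)"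
      by (intro SUP_upper2[of n]) (auto intro: hausdorff_content_antimono)
  qed (auto intro!: SUP_upper)
  moreover have "incseq (\<lambda>n. hausdorff_content k (inverse (real (Suc n))) A)"
    by (intro incseq_SucI hausdorff_content_antimono) (simp add: field_simps)
  ultimately show ?thesis using LIMSEQ_SUP by auto
qed

lemma hausdorff_outer_separated:
  assumes e: "e > 0" and AB: "\<And>x y. x \<in> A \<Longrightarrow> y \<in> B \<Longrightarrow> e \<le> dist x y"
  shows "hausdorff_outer k A + hausdorff_outer k B \<le> hausdorff_outer k (A \<union> B)"
proof (rule LIMSEQ_le)
  show "(\<lambda>n. hausdorff_content k (inverse (real (Suc n))) A + hausdorff_content k (inverse (real (Suc n))) B) \<longlonglongrightarrow> hausdorff_outer k A + hausdorff_outer k B"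
    by (intro tendsto_add hausdorff_outer_tendsto)
  show "(\<lambda>n. hausdorff_content k (inverse (real (Suc n))) (A \<union> B)) \<longlonglongrightarrow> hausdorff_outer k (A \<union> B)"
    by (rule hausdorff_outer_tendsto)
  obtain N where N: "inverse (real (Suc N)) < e" using reals_Archimedean e by auto
  have "hausdorff_content k (inverse (real (Suc n))) A + hausdorff_content k (inverse (real (Suc n))) B
     \<le> hausdorff_content k (inverse (real (Suc n))) (A \<union> B)" if "n \<ge> N" for n
  proof (rule hausdorff_content_separated[OF _ _ AB])
    have "inverse (real (Suc n)) \<le> inverse (real (Suc N))" using that by (simp add: field_simps)
    then show "inverse (real (Suc n)) < e" using N by linarith
  qed auto
  then show "\<exists>N. \<forall>n\<ge>N. hausdorff_content k (inverse (real (Suc n))) A + hausdorff_content k (inverse (real (Suc n))) B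
     \<le> hausdorff_content k (inverse (real (Suc n))) (A \<union> B)" by blast
qed

lemma hausdorff_outer_singleton: "k > 0 \<Longrightarrow> hausdorff_outer k {x} = 0"
proof -
  assume k: "k > 0"
  have "hausdorff_outer k {x} \<le> 0"
  proof (rule hausdorff_outer_leI)
    fix \<delta> :: real assume "\<delta> > 0"
    then have "hausdorff_content k \<delta> {x} \<le> hausdorff_weight k {x}" by (intro hausdorff_content_bounded_le) auto
    also have "\<dots> = 0" using k by (simp add: hausdorff_weight_def)
    finally show "hausdorff_content k \<delta> {x} \<le> 0" .
  qed
  then show ?thesis by simp
qed

text \<open>Hausdorff outer measure is a metric outer measure, so closed sets satisfy Caratheodory's criterion
  and hence all Borel sets do. This identifies the measure produced by \<open>measure_of\<close> with the outer
  measure.\<close>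

lemma measure_space_hausdorff_outer:
  "measure_space UNIV (sets (borel :: 'a::metric_space measure)) (hausdorff_outer k)"
proof -
  interpret P: sigma_algebra "UNIV :: 'a set" "Pow UNIV" by (rule sigma_algebra_Pow)
  have oms: "outer_measure_space (Pow UNIV) (hausdorff_outer k :: 'a set \<Rightarrow> _)"
    unfolding outer_measure_space_def
    by (auto simp: positive_def increasing_def countably_subadditive_def hausdorff_outer_empty
        intro: hausdorff_outer_mono hausdorff_outer_countably_subadditive)
  let ?L = "lambda_system UNIV (Pow UNIV) (hausdorff_outer k :: 'a set \<Rightarrow> _)"
  have ms: "measure_space UNIV ?L (hausdorff_outer k)" by (rule P.caratheodory_lemma[OF oms])
  have un2: "hausdorff_outer k (X \<union> Y) \<le> hausdorff_outer k X + hausdorff_outer k Y" for X Y :: "'a set"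
  proof -
    have "hausdorff_outer k (X \<union> (Y - X)) \<le> hausdorff_outer k X + hausdorff_outer k (Y - X)"
      using P.countably_subadditive_subadditive[of "hausdorff_outer k"] oms
      unfolding outer_measure_space_def by (intro subadditiveD) auto
    also have "\<dots> \<le> hausdorff_outer k X + hausdorff_outer k Y"
      by (intro add_left_mono hausdorff_outer_mono) auto
    finally show ?thesis by simp
  qed
  have closed: "C \<in> ?L" if "closed C" for C
  proof -
    have "hausdorff_outer k (A \<inter> C) + hausdorff_outer k (A - C) = hausdorff_outer k A" for A
    proof (rule antisym)
      show "hausdorff_outer k (A \<inter> C) + hausdorff_outer k (A - C) \<le> hausdorff_outer k A"
        using that by (intro metric_outer_measure_closed_caratheodory hausdorff_outer_empty hausdorff_outer_mono
          hausdorff_outer_countably_subadditive hausdorff_outer_separated)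
      show "hausdorff_outer k A \<le> hausdorff_outer k (A \<inter> C) + hausdorff_outer k (A - C)"
        using un2[of "A \<inter> C" "A - C"] by (simp add: Int_Diff_Un)
    qed
    then show ?thesis unfolding P.lambda_system_eq by simp
  qed
  interpret L: sigma_algebra UNIV ?L using ms by (simp add: measure_space_def)
  have "sets borel = sigma_sets UNIV (Collect closed :: 'a set set)"
    unfolding borel_eq_closed by (rule sets_measure_of) simp
  also have "\<dots> \<subseteq> ?L" by (rule L.sigma_sets_subset) (use closed in auto)
  finally have "sets (borel :: 'a measure) \<subseteq> ?L" .
  then show ?thesis using ms measure_down sets.sigma_algebra_axioms[of borel] by fastforce
qed

lemma sets_hausdorff_measure [simp, measurable_cong]: "sets (hausdorff_measure k) = sets borel"
  unfolding hausdorff_measure_def by (metis sets.sigma_sets_eq sets_measure_of_conv space_borel sets.space_closed)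

lemma space_hausdorff_measure [simp]: "space (hausdorff_measure k) = UNIV"
  unfolding hausdorff_measure_def by (simp add: space_measure_of_conv)

lemma emeasure_hausdorff_measure:
  "A \<in> sets borel \<Longrightarrow> emeasure (hausdorff_measure k) A = hausdorff_outer k A"
  using measure_space_hausdorff_outer[of k] unfolding hausdorff_measure_def
  by (intro emeasure_measure_of_sigma) (auto simp: measure_space_def)

text \<open>The image of a cover of scale \<open>\<delta> / L\<close> is a cover of scale \<open>\<delta>\<close>, and each weight grows by a factor
  of at most \<open>L ^ k\<close>.\<close>

lemma hausdorff_outer_Lipschitz_image:
  fixes f :: "'a::metric_space \<Rightarrow> 'b::metric_space"
  assumes L: "L > 0" and f: "\<And>x y. x \<in> A \<Longrightarrow> y \<in> A \<Longrightarrow> dist (f x) (f y) \<le> L * dist x y"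
  shows "hausdorff_outer k (f ` A) \<le> ennreal (L ^ k) * hausdorff_outer k A"
proof (rule hausdorff_outer_leI)
  fix \<delta> :: real assume d: "\<delta> > 0"
  have "hausdorff_content k \<delta> (f ` A) \<le> ennreal (L ^ k) * (\<Sum>i. hausdorff_weight k (C i))"
    if C: "A \<subseteq> (\<Union>i. C i)" "\<And>i. bounded (C i)" "\<And>i. diameter (C i) \<le> \<delta> / L" for C :: "nat \<Rightarrow> 'a set"
  proof -
    have dm: "bounded (f ` (C i \<inter> A)) \<and> diameter (f ` (C i \<inter> A)) \<le> L * diameter (C i)" for i
    proof (cases "C i \<inter> A = {}")
      case True
      then show ?thesis using L C(2) by (simp add: diameter_ge_0)
    next
      case False
      have dd: "dist (f x) (f y) \<le> L * diameter (C i)" if "x \<in> C i \<inter> A" "y \<in> C i \<inter> A" for x y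
        using that f[of x y] diameter_bounded_bound[OF C(2), of x i y] L
        by (meson IntD1 IntD2 mult_left_mono less_imp_le order_trans)
      have "bounded (f ` (C i \<inter> A))"
        using dd False unfolding bounded_two_points by fastforce
      moreover have "diameter (f ` (C i \<inter> A)) \<le> L * diameter (C i)"
      proof -
        have "(SUP (x, y)\<in>f ` (C i \<inter> A) \<times> f ` (C i \<inter> A). dist x y) \<le> L * diameter (C i)"
          using dd False by (intro cSUP_least) auto
        then show ?thesis using False by (simp add: diameter_def[of "f ` (C i \<inter> A)"])
      qed
      ultimately show ?thesis by blast
    qed
    have "hausdorff_content k \<delta> (f ` A) \<le> (\<Sum>i. hausdorff_weight k (f ` (C i \<inter> A)))"
    proof (rule hausdorff_content_le)
      fix i
      have "L * diameter (C i) \<le> \<delta>" using C(3)[of i] L by (simp add: field_simps)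
      then show "diameter (f ` (C i \<inter> A)) \<le> \<delta>" using dm[of i] by linarith
      show "f ` A \<subseteq> (\<Union>i. f ` (C i \<inter> A))" using C(1) by blast
    qed (use dm in auto)
    also have "\<dots> \<le> (\<Sum>i. ennreal (L ^ k) * hausdorff_weight k (C i))"
    proof (intro suminf_le allI)
      fix i
      have "diameter (f ` (C i \<inter> A)) ^ k \<le> (L * diameter (C i)) ^ k"
        using dm by (intro power_mono) (auto simp: diameter_ge_0)
      then have "unit_ball_vol (real k) * (diameter (f ` (C i \<inter> A)) / 2) ^ k \<le> L ^ k * (unit_ball_vol (real k) * (diameter (C i) / 2) ^ k)"
        by (simp add: power_divide power_mult_distrib divide_right_mono mult_left_mono mult.left_commute)
      then show "hausdorff_weight k (f ` (C i \<inter> A)) \<le> ennreal (L ^ k) * hausdorff_weight k (C i)"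
        using L by (auto simp: hausdorff_weight_def ennreal_mult'[symmetric] intro!: ennreal_leI)
    qed auto
    finally show ?thesis by simp
  qed
  note cover = this
  have inv: "ennreal (1 / L ^ k) * (ennreal (L ^ k) * z) = z" "ennreal (L ^ k) * (ennreal (1 / L ^ k) * z) = z" for z
    using L by (simp_all add: mult.assoc[symmetric] ennreal_mult'[symmetric])
  have "ennreal (1 / L ^ k) * hausdorff_content k \<delta> (f ` A) \<le> hausdorff_content k (\<delta> / L) A"
  proof (rule hausdorff_content_geI)
    fix C :: "nat \<Rightarrow> 'a set"
    assume "A \<subseteq> (\<Union>i. C i)" "\<And>i. bounded (C i)" "\<And>i. diameter (C i) \<le> \<delta> / L"
    from mult_left_mono[OF cover[OF this], of "ennreal (1 / L ^ k)"]
    show "ennreal (1 / L ^ k) * hausdorff_content k \<delta> (f ` A) \<le> (\<Sum>i. hausdorff_weight k (C i))"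
      by (simp add: inv)
  qed
  from mult_left_mono[OF this, of "ennreal (L ^ k)"]
  have "hausdorff_content k \<delta> (f ` A) \<le> ennreal (L ^ k) * hausdorff_content k (\<delta> / L) A"
    by (simp add: inv)
  also have "\<dots> \<le> ennreal (L ^ k) * hausdorff_outer k A"
    using d L by (intro mult_left_mono hausdorff_content_le_outer) auto
  finally show "hausdorff_content k \<delta> (f ` A) \<le> ennreal (L ^ k) * hausdorff_outer k A" .
qed

lemma hausdorff_outer_bilipschitz_image:
  fixes f :: "'a::metric_space \<Rightarrow> 'b::metric_space"
  assumes L: "L > 0" and f: "\<And>x y. x \<in> A \<Longrightarrow> y \<in> A \<Longrightarrow> dist (f x) (f y) \<le> L * dist x y"
    and f': "\<And>x y. x \<in> A \<Longrightarrow> y \<in> A \<Longrightarrow> dist x y \<le> L * dist (f x) (f y)"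
  shows "hausdorff_outer k (f ` A) \<le> ennreal (L ^ k) * hausdorff_outer k A"
    and "hausdorff_outer k A \<le> ennreal (L ^ k) * hausdorff_outer k (f ` A)"
proof -
  show "hausdorff_outer k (f ` A) \<le> ennreal (L ^ k) * hausdorff_outer k A"
    by (rule hausdorff_outer_Lipschitz_image[OF L f])
  have inj: "inj_on f A"
  proof (rule inj_onI)
    fix x y assume "x \<in> A" "y \<in> A" "f x = f y"
    then show "x = y" using f'[of x y] by simp
  qed
  have "hausdorff_outer k (the_inv_into A f ` (f ` A)) \<le> ennreal (L ^ k) * hausdorff_outer k (f ` A)"
  proof (rule hausdorff_outer_Lipschitz_image[OF L])
    fix x y assume "x \<in> f ` A" "y \<in> f ` A"
    then show "dist (the_inv_into A f x) (the_inv_into A f y) \<le> L * dist x y"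
      using f' by (auto simp: the_inv_into_f_f[OF inj])
  qed
  moreover have "the_inv_into A f ` (f ` A) = A"
    using the_inv_into_f_f[OF inj] by (auto simp: image_image)
  ultimately show "hausdorff_outer k A \<le> ennreal (L ^ k) * hausdorff_outer k (f ` A)" by simp
qed

section \<open>The isodiametric inequality\<close>

text \<open>The one-dimensional fact behind Steiner symmetrisation. Both \<open>Sup S - Inf T\<close> and \<open>Sup T - Inf S\<close> are at most
  \<open>e\<close>, and their sum is the total length of the least intervals that contain \<open>S\<close> and \<open>T\<close>.\<close>

lemma emeasure_add_le_of_mutual_distance:
  fixes S T :: "real set"
  assumes ne: "S \<noteq> {}" "T \<noteq> {}" and d: "\<And>s t. s \<in> S \<Longrightarrow> t \<in> T \<Longrightarrow> \<bar>s - t\<bar> \<le> e"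
  shows "emeasure lborel S + emeasure lborel T \<le> ennreal (2 * e)"
proof -
  obtain s0 t0 where st: "s0 \<in> S" "t0 \<in> T" using ne by auto
  have bS: "bdd_above S" "bdd_below S"
    using d[OF _ st(2)] by (auto intro!: bdd_aboveI[of _ "t0 + e"] bdd_belowI[of _ "t0 - e"] simp: abs_le_iff) 
       (smt (verit) d st)+
  have bT: "bdd_above T" "bdd_below T"
    using d[OF st(1)] by (auto intro!: bdd_aboveI[of _ "s0 + e"] bdd_belowI[of _ "s0 - e"] simp: abs_le_iff)
       (smt (verit) d st)+
  have 1: "Sup S \<le> Inf T + e"
  proof (rule cSup_least[OF ne(1)])
    fix s assume s: "s \<in> S"
    have "s - e \<le> Inf T" using d[OF s] by (intro cInf_greatest[OF ne(2)]) (smt (verit))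
    then show "s \<le> Inf T + e" by simp
  qed
  have 2: "Sup T \<le> Inf S + e"
  proof (rule cSup_least[OF ne(2)])
    fix t assume t: "t \<in> T"
    have "t - e \<le> Inf S" using d[OF _ t] by (intro cInf_greatest[OF ne(1)]) (smt (verit))
    then show "t \<le> Inf S + e" by simp
  qed
  have le: "Inf S \<le> Sup S" "Inf T \<le> Sup T"
    using bS bT st by (meson cInf_lower cSup_upper order_trans)+
  have "emeasure lborel S \<le> emeasure lborel {Inf S..Sup S}"
    using bS by (intro emeasure_mono) (auto intro: cInf_lower cSup_upper)
  moreover have "emeasure lborel T \<le> emeasure lborel {Inf T..Sup T}"
    using bT by (intro emeasure_mono) (auto intro: cInf_lower cSup_upper)
  ultimately have "emeasure lborel S + emeasure lborel T \<le> ennreal (Sup S - Inf S) + ennreal (Sup T - Inf T)"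
    using le by (intro add_mono) auto
  also have "\<dots> = ennreal ((Sup S - Inf S) + (Sup T - Inf T))" using le by simp
  also have "\<dots> \<le> ennreal (2 * e)" using 1 2 by (intro ennreal_leI) linarith
  finally show ?thesis .
qed

lemma emeasure_lborel_centered_interval: "emeasure lborel {y::real. 2 * ennreal \<bar>y\<bar> < c} = c"
proof (cases c)
  case (real r)
  have "{y::real. 2 * ennreal \<bar>y\<bar> < c} = {-(r/2)<..<r/2}"
    using real by (auto simp: ennreal_less_iff abs_less_iff
      simp flip: ennreal_numeral ennreal_mult' ennreal_mult'' )
  then show ?thesis using real by simp
next
  case top
  then have "{y::real. 2 * ennreal \<bar>y\<bar> < c} = UNIV" by (auto simp: ennreal_mult_less_top)
  then show ?thesis using top by simp
qed

text \<open>Each line in direction \<open>i\<close> meets \<open>A\<close> in a set of some length \<open>m f\<close>; the set is replaced by the open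
  interval of length \<open>m f\<close> centred at 0. Fubini preserves the measure. The diameter does not grow,
  because among pairs of sets of given lengths the centred intervals have the least maximal distance between
  their points. Symmetries already gained in other coordinates survive since \<open>m\<close> inherits them.\<close>

lemma steiner_symmetrisation:
  fixes A :: "('i \<Rightarrow> real) set"
  assumes I: "finite I" "i \<in> I" "i \<notin> J" and A: "A \<in> sets (Pi\<^sub>M I (\<lambda>_. lborel))"
    and diam: "\<And>f g. f \<in> A \<Longrightarrow> g \<in> A \<Longrightarrow> (\<Sum>b\<in>I. (f b - g b)\<^sup>2) \<le> d\<^sup>2"
    and sym: "\<And>j f. j \<in> J \<Longrightarrow> f \<in> A \<Longrightarrow> f(j := - f j) \<in> A"
    and J: "J \<subseteq> I"
  obtains A' where "A' \<in> sets (Pi\<^sub>M I (\<lambda>_. lborel))"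
    "emeasure (Pi\<^sub>M I (\<lambda>_. lborel)) A' = emeasure (Pi\<^sub>M I (\<lambda>_. lborel)) A"
    "\<And>f g. f \<in> A' \<Longrightarrow> g \<in> A' \<Longrightarrow> (\<Sum>b\<in>I. (f b - g b)\<^sup>2) \<le> d\<^sup>2"
    "\<And>j f. j \<in> insert i J \<Longrightarrow> f \<in> A' \<Longrightarrow> f(j := - f j) \<in> A'"
proof
  interpret product_sigma_finite "\<lambda>_. lborel :: real measure" by standard
  let ?P = "Pi\<^sub>M I (\<lambda>_. lborel :: real measure)"
  define K where "K = I - {i}"
  have K: "I = insert i K" "i \<notin> K" "finite K" using I by (auto simp: K_def)
  define m where "m f = (\<integral>\<^sup>+s. indicator A (f(i := s)) \<partial>lborel)" for f :: "'i \<Rightarrow> real"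
  \<comment> \<open>Because the inequality is strict, a line that meets \<open>A\<close> in a null set contributes no points.\<close>
  define A' where "A' = {f \<in> space ?P. 2 * ennreal \<bar>f i\<bar> < m f}"
  have upd: "(\<lambda>(f, s). f(i := s)) \<in> ?P \<Otimes>\<^sub>M lborel \<rightarrow>\<^sub>M ?P"
    using measurable_add_dim[of i I "\<lambda>_. lborel :: real measure"] I by (simp add: insert_absorb)
  have updK: "(\<lambda>(f, s). f(i := s)) \<in> Pi\<^sub>M K (\<lambda>_. lborel) \<Otimes>\<^sub>M lborel \<rightarrow>\<^sub>M ?P"
    using measurable_add_dim[of i K "\<lambda>_. lborel :: real measure"] K by simp
  have indA: "(indicator A :: _ \<Rightarrow> ennreal) \<in> borel_measurable ?P" using A by simp
  have mm[measurable]: "m \<in> borel_measurable ?P"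
    unfolding m_def using measurable_compose[OF upd indA]
    by (intro lborel.borel_measurable_nn_integral) (simp add: split_beta')
  have [measurable]: "(\<lambda>f. f i) \<in> borel_measurable ?P" using I by simp
  show A'm: "A' \<in> sets ?P" unfolding A'_def by measurable
  have memeas: "m f = emeasure lborel {s. f(i := s) \<in> A}" if f: "f \<in> extensional K" for f
  proof -
    have fs: "f \<in> space (Pi\<^sub>M K (\<lambda>_. lborel))" using f by (auto simp: space_PiM PiE_def)
    have "(\<lambda>s. f(i := s)) \<in> lborel \<rightarrow>\<^sub>M ?P"
      using measurable_compose[OF measurable_Pair1'[OF fs] updK] by simp
    from measurable_sets[OF this A] have "{s. f(i := s) \<in> A} \<in> sets borel"
      by (simp add: vimage_def)
    moreover have "m f = (\<integral>\<^sup>+s. indicator {s. f(i := s) \<in> A} s \<partial>lborel)"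
      unfolding m_def by (intro nn_integral_cong) (simp add: indicator_def)
    ultimately show ?thesis by simp
  qed
  have mI: "m f = emeasure lborel {s. f(i := s) \<in> A}" if f: "f \<in> space ?P" for f
  proof -
    have "m (restrict f K) = emeasure lborel {s. (restrict f K)(i := s) \<in> A}"
      by (rule memeas) auto
    moreover have "(restrict f K)(i := s) = f(i := s)" for s
      using f K by (auto simp: space_PiM fun_eq_iff PiE_def extensional_def restrict_def)
    ultimately show ?thesis unfolding m_def by simp
  qed
  have "emeasure ?P A = (\<integral>\<^sup>+f. indicator A f \<partial>?P)" using A by simp
  also have "\<dots> = (\<integral>\<^sup>+x. m x \<partial>Pi\<^sub>M K (\<lambda>_. lborel))"
    unfolding K(1) m_def using A K by (intro product_nn_integral_insert) auto
  finally have eA: "emeasure ?P A = (\<integral>\<^sup>+x. m x \<partial>Pi\<^sub>M K (\<lambda>_. lborel))" .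
  have "emeasure ?P A' = (\<integral>\<^sup>+f. indicator A' f \<partial>?P)" using A'm by simp
  also have "\<dots> = (\<integral>\<^sup>+x. (\<integral>\<^sup>+y. indicator A' (x(i := y)) \<partial>lborel) \<partial>Pi\<^sub>M K (\<lambda>_. lborel))"
    unfolding K(1) using A'm K by (intro product_nn_integral_insert) auto
  also have "\<dots> = (\<integral>\<^sup>+x. m x \<partial>Pi\<^sub>M K (\<lambda>_. lborel))"
  proof (rule nn_integral_cong)
    fix x :: "'i \<Rightarrow> real" assume x: "x \<in> space (Pi\<^sub>M K (\<lambda>_. lborel))"
    have "indicator A' (x(i := y)) = (indicator {y. 2 * ennreal \<bar>y\<bar> < m x} y :: ennreal)" for y
    proof -
      have "x(i := y) \<in> space ?P" using x K by (auto simp: space_PiM PiE_def extensional_def)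
      then show ?thesis unfolding A'_def m_def by (simp add: indicator_def)
    qed
    then have "(\<integral>\<^sup>+y. indicator A' (x(i := y)) \<partial>lborel) = emeasure lborel {y. 2 * ennreal \<bar>y\<bar> < m x}"
      by simp
    then show "(\<integral>\<^sup>+y. indicator A' (x(i := y)) \<partial>lborel) = m x"
      by (simp add: emeasure_lborel_centered_interval)
  qed
  finally show "emeasure ?P A' = emeasure ?P A" using eA by simp
  show "(\<Sum>b\<in>I. (f b - g b)\<^sup>2) \<le> d\<^sup>2" if f: "f \<in> A'" and g: "g \<in> A'" for f g
  proof -
    \<comment> \<open>The two slices and the distance that the remaining coordinates leave for the \<open>i\<close>-th one.\<close>
    define S where "S = {s. f(i := s) \<in> A}"
    define T where "T = {s. g(i := s) \<in> A}"
    define R where "R = (\<Sum>b\<in>K. (f b - g b)\<^sup>2)"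
    define e where "e = sqrt (d\<^sup>2 - R)"
    have mf: "2 * ennreal \<bar>f i\<bar> < emeasure lborel S" and mg: "2 * ennreal \<bar>g i\<bar> < emeasure lborel T"
      using f g mI unfolding A'_def S_def T_def by auto
    have ne: "S \<noteq> {}" "T \<noteq> {}" using mf mg by auto
    have st: "(s - t)\<^sup>2 + R \<le> d\<^sup>2" if "s \<in> S" "t \<in> T" for s t
    proof -
      have "f(i := s) \<in> A" "g(i := t) \<in> A" using that unfolding S_def T_def by blast+
      from diam[OF this] have "(\<Sum>b\<in>I. ((f(i := s)) b - (g(i := t)) b)\<^sup>2) \<le> d\<^sup>2" .
      moreover have "(\<Sum>b\<in>I. ((f(i := s)) b - (g(i := t)) b)\<^sup>2) = (s - t)\<^sup>2 + R"
        unfolding K(1) R_def using K by (auto intro!: sum.cong)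
      ultimately show ?thesis by simp
    qed
    have R: "R \<le> d\<^sup>2" using ne st by (metis ex_in_conv add_increasing zero_le_power2 order_trans le_add_same_cancel2)
    have "\<bar>s - t\<bar> \<le> e" if "s \<in> S" "t \<in> T" for s t
      unfolding e_def using st[OF that] by (intro real_le_rsqrt) (simp add: algebra_simps)
    then have "emeasure lborel S + emeasure lborel T \<le> ennreal (2 * e)"
      by (rule emeasure_add_le_of_mutual_distance[OF ne])
    moreover have "2 * ennreal \<bar>f i\<bar> + 2 * ennreal \<bar>g i\<bar> \<le> emeasure lborel S + emeasure lborel T"
      using mf mg by (intro add_mono) auto
    ultimately have "2 * ennreal \<bar>f i\<bar> + 2 * ennreal \<bar>g i\<bar> \<le> ennreal (2 * e)" by order
    moreover have "2 * ennreal \<bar>f i\<bar> + 2 * ennreal \<bar>g i\<bar> = ennreal (2 * \<bar>f i\<bar> + 2 * \<bar>g i\<bar>)"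
      by (simp add: ennreal_plus ennreal_mult)
    ultimately have "ennreal (2 * \<bar>f i\<bar> + 2 * \<bar>g i\<bar>) \<le> ennreal (2 * e)" by simp
    then have "2 * \<bar>f i\<bar> + 2 * \<bar>g i\<bar> \<le> 2 * e" using R by (subst (asm) ennreal_le_iff) (auto simp: e_def)
    then have "\<bar>f i\<bar> + \<bar>g i\<bar> \<le> e" by simp
    then have "(f i - g i)\<^sup>2 \<le> e\<^sup>2" by (intro power2_le_iff_abs_le[THEN iffD2]) (auto simp: e_def R)
    also have "e\<^sup>2 = d\<^sup>2 - R" using R by (simp add: e_def)
    finally show ?thesis unfolding K(1) using K by (simp add: R_def)
  qed
  show "f(j := - f j) \<in> A'" if j: "j \<in> insert i J" and f: "f \<in> A'" for j f
  proof (cases "j = i")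
    case True
    then show ?thesis using f I by (auto simp: A'_def m_def space_PiM PiE_def extensional_def)
  next
    case False
    then have jJ: "j \<in> J" using j by simp
    have "(f(j := - f j))(i := s) \<in> A \<longleftrightarrow> f(i := s) \<in> A" for s
    proof -
      have e: "(f(j := - f j))(i := s) = (f(i := s))(j := - (f(i := s)) j)"
        using False by (auto simp: fun_eq_iff)
      have e': "f(i := s) = ((f(j := - f j))(i := s))(j := - ((f(j := - f j))(i := s)) j)"
        using False by (auto simp: fun_eq_iff)
      show ?thesis using sym[OF jJ, of "f(i := s)"] sym[OF jJ, of "(f(j := - f j))(i := s)"] e e' by metis
    qed
    then have "m (f(j := - f j)) = m f" unfolding m_def by (intro nn_integral_cong) (auto simp: indicator_def)
    then show ?thesis using f False jJ J by (auto simp: A'_def space_PiM PiE_def extensional_def)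
  qed
qed

text \<open>After symmetrising in every coordinate the set is symmetric about the origin, so each of its points has
  norm at most half the diameter \<open>d\<close> and the set lies in a ball of radius \<open>d / 2\<close>.\<close>

lemma isodiametric_PiM:
  fixes A :: "('i \<Rightarrow> real) set"
  assumes I: "finite I" and A: "A \<in> sets (Pi\<^sub>M I (\<lambda>_. lborel))" and d: "d \<ge> 0"
    and diam: "\<And>f g. f \<in> A \<Longrightarrow> g \<in> A \<Longrightarrow> (\<Sum>b\<in>I. (f b - g b)\<^sup>2) \<le> d\<^sup>2"
  shows "emeasure (Pi\<^sub>M I (\<lambda>_. lborel)) A \<le> ennreal (unit_ball_vol (real (card I)) * (d / 2) ^ card I)"
proof -
  let ?P = "Pi\<^sub>M I (\<lambda>_. lborel :: real measure)"
  have "\<exists>A'\<in>sets ?P. emeasure ?P A' = emeasure ?P A \<and>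
     (\<forall>f\<in>A'. \<forall>g\<in>A'. (\<Sum>b\<in>I. (f b - g b)\<^sup>2) \<le> d\<^sup>2) \<and> (\<forall>j\<in>J. \<forall>f\<in>A'. f(j := - f j) \<in> A')"
    if "finite J" "J \<subseteq> I" for J using that
  proof (induction J)
    case empty
    then show ?case using A diam by auto
  next
    case (insert i J)
    then have "J \<subseteq> I" by auto
    from insert.IH[OF this] obtain A' where A': "A'\<in>sets ?P" "emeasure ?P A' = emeasure ?P A"
     "\<And>f g. f \<in> A' \<Longrightarrow> g \<in> A' \<Longrightarrow> (\<Sum>b\<in>I. (f b - g b)\<^sup>2) \<le> d\<^sup>2" "\<And>j f. j \<in> J \<Longrightarrow> f\<in>A' \<Longrightarrow> f(j := - f j) \<in> A'"
      by blast
    from insert have i: "i \<in> I" "i \<notin> J" "J \<subseteq> I" by auto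
    show ?case
    proof (rule steiner_symmetrisation[OF I i(1,2) A'(1) A'(3,4) i(3)])
      fix A'' assume "A'' \<in> sets ?P" "emeasure ?P A'' = emeasure ?P A'"
        "\<And>f g. f \<in> A'' \<Longrightarrow> g \<in> A'' \<Longrightarrow> (\<Sum>b\<in>I. (f b - g b)\<^sup>2) \<le> d\<^sup>2"
        "\<And>j f. j \<in> insert i J \<Longrightarrow> f \<in> A'' \<Longrightarrow> f(j := - f j) \<in> A''"
      moreover from this(2) A'(2) have "emeasure ?P A'' = emeasure ?P A" by simp
      ultimately show ?thesis by blast
    qed
  qed
  from this[OF I order_refl] obtain A' where A': "A'\<in>sets ?P" "emeasure ?P A' = emeasure ?P A"
     "\<And>f g. f \<in> A' \<Longrightarrow> g \<in> A' \<Longrightarrow> (\<Sum>b\<in>I. (f b - g b)\<^sup>2) \<le> d\<^sup>2" "\<And>j f. j \<in> I \<Longrightarrow> f\<in>A' \<Longrightarrow> f(j := - f j) \<in> A'"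
    by blast
  have flip: "(\<lambda>i. if i \<in> J then - f i else f i) \<in> A'" if "finite J" "J \<subseteq> I" "f \<in> A'" for J f
    using that
  proof (induction J)
    case (insert j J)
    then have "(\<lambda>i. if i \<in> J then - f i else f i)(j := - (if j \<in> J then - f j else f j)) \<in> A'"
      using A'(4)[of j "\<lambda>i. if i \<in> J then - f i else f i"] by auto
    moreover have "(\<lambda>i. if i \<in> J then - f i else f i)(j := - (if j \<in> J then - f j else f j)) = (\<lambda>i. if i \<in> insert j J then - f i else f i)"
      using insert by (auto simp: fun_eq_iff)
    ultimately show ?case by simp
  qed simp
  have half: "sqrt (\<Sum>b\<in>I. (f b)\<^sup>2) \<le> d / 2" if f: "f \<in> A'" for f
  proof -
    have "(\<Sum>b\<in>I. (f b - (if b \<in> I then - f b else f b))\<^sup>2) \<le> d\<^sup>2"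
      using A'(3)[OF f flip[OF I order_refl f]] .
    also have "(\<Sum>b\<in>I. (f b - (if b \<in> I then - f b else f b))\<^sup>2) = 4 * (\<Sum>b\<in>I. (f b)\<^sup>2)"
      unfolding sum_distrib_left by (intro sum.cong) (auto simp: power2_eq_square)
    finally show ?thesis using d by (intro real_le_lsqrt) (auto simp: power_divide sum_nonneg)
  qed
  \<comment> \<open>The formula for the volume of a ball needs a positive radius, hence the detour over \<open>r\<close> to include \<open>d = 0\<close>.\<close>
  have bd: "emeasure ?P A \<le> ennreal (unit_ball_vol (real (card I)) * (r / 2) ^ card I)" if r: "r > 0" "d \<le> r" for r
  proof -
    have "emeasure ?P A = emeasure ?P A'" using A' by simp
    also have "\<dots> \<le> emeasure ?P ({f. sqrt (\<Sum>i\<in>I. (f i)\<^sup>2) \<le> r / 2} \<inter> space ?P)"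
      using half r sets.sets_into_space[OF A'(1)] by (intro emeasure_mono) (auto, fastforce)
    also have "\<dots> = ennreal (unit_ball_vol (real (card I)) * (r / 2) ^ card I)"
      using I r by (intro emeasure_cball_aux) auto
    finally show ?thesis .
  qed
  show ?thesis
  proof (rule LIMSEQ_le_const)
    show "(\<lambda>n. ennreal (unit_ball_vol (real (card I)) * ((d + inverse (real (Suc n))) / 2) ^ card I)) \<longlonglongrightarrow>
        ennreal (unit_ball_vol (real (card I)) * (d / 2) ^ card I)"
    proof (intro tendsto_ennrealI tendsto_mult_left tendsto_power tendsto_divide tendsto_const)
      show "(\<lambda>n. d + inverse (real (Suc n))) \<longlonglongrightarrow> d"
        using tendsto_add[OF tendsto_const LIMSEQ_inverse_real_of_nat, of d] by simp
    qed simp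
    show "\<exists>N. \<forall>n\<ge>N. emeasure ?P A \<le> ennreal (unit_ball_vol (real (card I)) * ((d + inverse (real (Suc n))) / 2) ^ card I)"
      using d by (intro exI allI impI bd) (auto intro: add_nonneg_pos)
  qed
qed

section \<open>Lebesgue measure on the span of an orthonormal set\<close>

lemma distr_PiM_lborel_translate:
  fixes c :: "'i \<Rightarrow> real"
  assumes I: "finite I"
  shows "distr (Pi\<^sub>M I (\<lambda>_. lborel)) (Pi\<^sub>M I (\<lambda>_. lborel)) (\<lambda>f. \<lambda>i\<in>I. f i + c i) = Pi\<^sub>M I (\<lambda>_. lborel)"
proof -
  interpret product_sigma_finite "\<lambda>_. lborel :: real measure" by standard
  show ?thesis
  proof (rule PiM_eqI[OF I])
    fix A :: "'i \<Rightarrow> real set" assume A: "\<And>i. i \<in> I \<Longrightarrow> A i \<in> sets lborel"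
    have m: "(\<lambda>f. \<lambda>i\<in>I. f i + c i) \<in> Pi\<^sub>M I (\<lambda>_. lborel) \<rightarrow>\<^sub>M Pi\<^sub>M I (\<lambda>_. lborel :: real measure)"
      by measurable
    have tr: "emeasure lborel ((\<lambda>x. x + d) -` X) = emeasure lborel X" if "X \<in> sets lborel" for d :: real and X
    proof -
      have "emeasure lborel X = emeasure (distr lborel borel ((+) d)) X" by (simp add: lborel_distr_plus)
      also have "\<dots> = emeasure lborel ((+) d -` X)" using that by (subst emeasure_distr) auto
      also have "(+) d -` X = (\<lambda>x. x + d) -` X" by (auto simp: add.commute)
      finally show ?thesis by simp
    qed
    have "emeasure (distr (Pi\<^sub>M I (\<lambda>_. lborel)) (Pi\<^sub>M I (\<lambda>_. lborel)) (\<lambda>f. \<lambda>i\<in>I. f i + c i)) (Pi\<^sub>E I A)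
       = emeasure (Pi\<^sub>M I (\<lambda>_. lborel)) ((\<lambda>f. \<lambda>i\<in>I. f i + c i) -` Pi\<^sub>E I A \<inter> space (Pi\<^sub>M I (\<lambda>_. lborel)))"
      using A I by (intro emeasure_distr[OF m] sets_PiM_I_finite) auto
    also have "(\<lambda>f. \<lambda>i\<in>I. f i + c i) -` Pi\<^sub>E I A \<inter> space (Pi\<^sub>M I (\<lambda>_. lborel)) = Pi\<^sub>E I (\<lambda>i. (\<lambda>x. x + c i) -` A i)"
      by (auto simp: space_PiM PiE_iff)
    also have "emeasure (Pi\<^sub>M I (\<lambda>_. lborel)) \<dots> = (\<Prod>i\<in>I. emeasure lborel ((\<lambda>x. x + c i) -` A i))"
    proof (rule emeasure_PiM[OF I])
      fix i assume "i \<in> I"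
      then show "(\<lambda>x. x + c i) -` A i \<in> sets lborel" using A[of i] by (auto intro: measurable_sets_borel[rotated])
    qed
    also have "\<dots> = (\<Prod>i\<in>I. emeasure lborel (A i))" using A tr by (intro prod.cong) auto
    finally show "emeasure (distr (Pi\<^sub>M I (\<lambda>_. lborel)) (Pi\<^sub>M I (\<lambda>_. lborel)) (\<lambda>f. \<lambda>i\<in>I. f i + c i)) (Pi\<^sub>E I A)
      = (\<Prod>i\<in>I. emeasure lborel (A i))" .
  qed simp
qed

text \<open>Subspaces of different dimensions have to be compared, so Lebesgue measure on a subspace is kept as a measure
  on the ambient type, carried by the span of \<open>B\<close>. With an orthonormal \<open>B\<close> the coordinates are isometric.\<close>

definition span_lebesgue :: "'a::euclidean_space set \<Rightarrow> 'a measure" where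
  "span_lebesgue B = distr (Pi\<^sub>M B (\<lambda>_. lborel)) borel (\<lambda>f. \<Sum>b\<in>B. f b *\<^sub>R b)"

locale orthonormal_set =
  fixes B :: "'a::euclidean_space set"
  assumes orth: "pairwise orthogonal B" and unit: "b \<in> B \<Longrightarrow> norm b = 1"
begin

abbreviation "comb f \<equiv> (\<Sum>b\<in>B. f b *\<^sub>R b)"
abbreviation "coord_space \<equiv> Pi\<^sub>M B (\<lambda>_. lborel :: real measure)"

lemma finite_B: "finite B" using orth by (rule pairwise_orthogonal_imp_finite)

lemma inner_B: "b \<in> B \<Longrightarrow> c \<in> B \<Longrightarrow> b \<bullet> c = (if b = c then 1 else 0)"
  using orth unit[of b] by (auto simp: pairwise_def orthogonal_def norm_eq_1)

lemma comb_inner: "b \<in> B \<Longrightarrow> comb f \<bullet> b = f b"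
proof -
  assume b: "b \<in> B"
  have "comb f \<bullet> b = (\<Sum>c\<in>B. if c = b then f b else 0)"
    unfolding inner_sum_left using b by (intro sum.cong) (auto simp: inner_B)
  then show ?thesis using b finite_B by simp
qed

lemma comb_in_span: "comb f \<in> span B"
  by (intro span_sum span_scale span_base)

lemma norm_comb_sq: "(norm (comb f))\<^sup>2 = (\<Sum>b\<in>B. (f b)\<^sup>2)"
proof -
  have "(norm (comb f))\<^sup>2 = (\<Sum>b\<in>B. f b * (comb f \<bullet> b))"
    unfolding power2_norm_eq_inner by (simp add: inner_sum_right inner_commute[of _ "comb f"])
  also have "\<dots> = (\<Sum>b\<in>B. (f b)\<^sup>2)" by (intro sum.cong) (auto simp: comb_inner power2_eq_square)
  finally show ?thesis .
qed

lemma norm_comb_diff_sq: "(norm (comb f - comb g))\<^sup>2 = (\<Sum>b\<in>B. (f b - g b)\<^sup>2)"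
  using norm_comb_sq[of "\<lambda>b. f b - g b"] by (simp add: sum_subtractf scaleR_left_diff_distrib)

lemma comb_coords: "x \<in> span B \<Longrightarrow> comb (\<lambda>b. x \<bullet> b) = x"
proof (induction rule: span_induct_alt)
  case base
  show ?case by simp
next
  case (step c b y)
  have "(\<Sum>d\<in>B. (b \<bullet> d) *\<^sub>R d) = (\<Sum>d\<in>B. if d = b then b else 0)"
    using step by (intro sum.cong) (auto simp: inner_B)
  also have "\<dots> = b" using step finite_B by simp
  finally show ?case using step
    by (simp add: inner_add_left scaleR_left_distrib sum.distrib flip: scaleR_scaleR scaleR_sum_right)
qed

lemma comb_measurable [measurable]: "comb \<in> coord_space \<rightarrow>\<^sub>M borel"
  by measurable

lemma sets_span_lebesgue [simp, measurable_cong]: "sets (span_lebesgue B) = sets borel"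
  by (simp add: span_lebesgue_def)

lemma emeasure_span_lebesgue:
  "E \<in> sets borel \<Longrightarrow> emeasure (span_lebesgue B) E = emeasure coord_space {f \<in> space coord_space. comb f \<in> E}"
  unfolding span_lebesgue_def by (subst emeasure_distr) (auto intro!: arg_cong[of _ _ "emeasure coord_space"])

lemma emeasure_span_lebesgue_Int_span:
  "E \<in> sets borel \<Longrightarrow> emeasure (span_lebesgue B) (E \<inter> span B) = emeasure (span_lebesgue B) E"
  using comb_in_span by (simp add: emeasure_span_lebesgue closed_span borel_closed)

lemma span_lebesgue_isodiametric:
  assumes E: "E \<in> sets borel" "bounded E"
  shows "emeasure (span_lebesgue B) E \<le> hausdorff_weight (card B) E"
proof (cases "E = {}")
  case False
  have "emeasure (span_lebesgue B) E = emeasure coord_space {f \<in> space coord_space. comb f \<in> E}"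
    using E by (simp add: emeasure_span_lebesgue)
  also have "\<dots> \<le> ennreal (unit_ball_vol (real (card B)) * (diameter E / 2) ^ card B)"
  proof (rule isodiametric_PiM[OF finite_B])
    show "{f \<in> space coord_space. comb f \<in> E} \<in> sets coord_space"
      using E measurable_sets[OF comb_measurable E(1)] by (simp add: vimage_def Int_def conj_commute)
    show "0 \<le> diameter E" using E by (simp add: diameter_ge_0)
    fix f g assume "f \<in> {f \<in> space coord_space. comb f \<in> E}" "g \<in> {f \<in> space coord_space. comb f \<in> E}"
    then have "norm (comb f - comb g) \<le> diameter E"
      using diameter_bounded_bound[OF E(2)] by (auto simp: dist_norm)
    then show "(\<Sum>b\<in>B. (f b - g b)\<^sup>2) \<le> (diameter E)\<^sup>2"
      unfolding norm_comb_diff_sq[symmetric] by (intro power_mono) auto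
  qed
  finally show ?thesis using False by (simp add: hausdorff_weight_def)
qed simp

lemma emeasure_span_lebesgue_bounded: "E \<in> sets borel \<Longrightarrow> bounded E \<Longrightarrow> emeasure (span_lebesgue B) E < \<infinity>"
  by (rule le_less_trans[OF span_lebesgue_isodiametric]) (auto simp: hausdorff_weight_def)

text \<open>Covers may be made closed without changing diameters, and by the isodiametric inequality each covering
  set has Lebesgue measure at most its Hausdorff weight.\<close>

lemma span_lebesgue_le_hausdorff_outer:
  assumes E: "E \<in> sets borel"
  shows "emeasure (span_lebesgue B) E \<le> hausdorff_outer (card B) E"
proof -
  have "emeasure (span_lebesgue B) E \<le> hausdorff_content (card B) 1 E"
  proof (rule hausdorff_content_geI)
    fix C :: "nat \<Rightarrow> 'a set" assume C: "E \<subseteq> (\<Union>i. C i)" "\<And>i. bounded (C i)"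
    have "emeasure (span_lebesgue B) E \<le> emeasure (span_lebesgue B) (\<Union>i. closure (C i))"
      using C closure_subset by (intro emeasure_mono) (auto, blast)
    also have "\<dots> \<le> (\<Sum>i. emeasure (span_lebesgue B) (closure (C i)))"
      by (intro emeasure_subadditive_countably) auto
    also have "\<dots> \<le> (\<Sum>i. hausdorff_weight (card B) (closure (C i)))"
      using C by (intro suminf_le span_lebesgue_isodiametric allI) auto
    also have "\<dots> = (\<Sum>i. hausdorff_weight (card B) (C i))"
      using C by (intro suminf_cong) (simp add: hausdorff_weight_def diameter_closure)
    finally show "emeasure (span_lebesgue B) E \<le> (\<Sum>i. hausdorff_weight (card B) (C i))" .
  qed
  also have "\<dots> \<le> hausdorff_outer (card B) E" by (rule hausdorff_content_le_outer) simp
  finally show ?thesis .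
qed

lemma emeasure_span_lebesgue_cball:
  assumes x: "x \<in> span B" and r: "r > 0"
  shows "emeasure (span_lebesgue B) (cball x r) = ennreal (unit_ball_vol (real (card B)) * r ^ card B)"
proof -
  let ?T = "\<lambda>f. \<lambda>b\<in>B. f b + - (x \<bullet> b)"
  let ?D = "{f. sqrt (\<Sum>i\<in>B. (f i)\<^sup>2) \<le> r} \<inter> space coord_space"
  have D: "?D \<in> sets coord_space" by measurable
  have T: "?T \<in> coord_space \<rightarrow>\<^sub>M coord_space" by measurable
  have "ennreal (unit_ball_vol (real (card B)) * r ^ card B) = emeasure coord_space ?D"
    using emeasure_cball_aux[OF finite_B r] by simp
  also have "\<dots> = emeasure (distr coord_space coord_space ?T) ?D"
    by (simp only: distr_PiM_lborel_translate[OF finite_B])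
  also have "\<dots> = emeasure coord_space (?T -` ?D \<inter> space coord_space)"
    by (rule emeasure_distr[OF T D])
  also have "?T -` ?D \<inter> space coord_space = {f \<in> space coord_space. comb f \<in> cball x r}"
  proof -
    have "f \<in> ?T -` ?D \<longleftrightarrow> comb f \<in> cball x r" for f
    proof -
      have "norm (x - comb f) = sqrt ((norm (comb f - comb (\<lambda>b. x \<bullet> b)))\<^sup>2)"
        using comb_coords[OF x] by (simp add: norm_minus_commute)
      also have "\<dots> = sqrt (\<Sum>b\<in>B. (f b - x \<bullet> b)\<^sup>2)" by (simp only: norm_comb_diff_sq)
      finally show ?thesis by (simp add: dist_norm space_PiM)
    qed
    then show ?thesis by blast
  qed
  also have "emeasure coord_space \<dots> = emeasure (span_lebesgue B) (cball x r)"
    by (simp add: emeasure_span_lebesgue)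
  finally show ?thesis by simp
qed

end

section \<open>Hausdorff measure of a subspace is Lebesgue measure\<close>

text \<open>A greedy choice, one point of \<open>T\<close> after the other.\<close>

lemma finite_separated_subset:
  fixes T :: "'a::metric_space set"
  assumes "finite T"
  obtains F where "F \<subseteq> T" "\<And>x y. x \<in> F \<Longrightarrow> y \<in> F \<Longrightarrow> x \<noteq> y \<Longrightarrow> s < dist x y" "\<And>x. x \<in> T \<Longrightarrow> \<exists>y\<in>F. x = y \<or> dist x y \<le> s"
proof -
  have "\<exists>F\<subseteq>T. (\<forall>x\<in>F. \<forall>y\<in>F. x \<noteq> y \<longrightarrow> s < dist x y) \<and> (\<forall>x\<in>T. \<exists>y\<in>F. x = y \<or> dist x y \<le> s)"
    using assms
  proof (induction T)
    case (insert t T)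
    then obtain F where F: "F \<subseteq> T" "\<forall>x\<in>F. \<forall>y\<in>F. x \<noteq> y \<longrightarrow> s < dist x y" "\<forall>x\<in>T. \<exists>y\<in>F. x = y \<or> dist x y \<le> s" by auto
    show ?case
    proof (cases "\<exists>y\<in>F. dist t y \<le> s")
      case True
      then show ?thesis using F by (intro exI[of _ F]) auto
    next
      case False
      then show ?thesis using F by (intro exI[of _ "insert t F"]) (auto simp: dist_commute not_le)
    qed
  qed auto
  then obtain F where "F \<subseteq> T" "\<forall>x\<in>F. \<forall>y\<in>F. x \<noteq> y \<longrightarrow> s < dist x y" "\<forall>x\<in>T. \<exists>y\<in>F. x = y \<or> dist x y \<le> s" by blast
  then show ?thesis by (intro that[of F]) simp_all
qed

lemma hausdorff_content_UN_cball:
  fixes F :: "'a::euclidean_space set"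
  assumes "finite F" "r > 0" "2 * r \<le> \<delta>"
  shows "hausdorff_content k \<delta> (\<Union>x\<in>F. cball x r) \<le> ennreal (real (card F) * (unit_ball_vol (real k) * r ^ k))"
  using assms(1)
proof (induction F)
  case empty
  then show ?case using assms by (simp add: hausdorff_content_empty)
next
  case (insert x F)
  have w: "hausdorff_content k \<delta> (cball x r) \<le> ennreal (unit_ball_vol (real k) * r ^ k)"
  proof -
    have "hausdorff_content k \<delta> (cball x r) \<le> hausdorff_weight k (cball x r)"
      using assms by (intro hausdorff_content_bounded_le) auto
    also have "\<dots> = ennreal (unit_ball_vol (real k) * r ^ k)" using assms by (simp add: hausdorff_weight_def)
    finally show ?thesis .
  qed
  have "hausdorff_content k \<delta> (\<Union>x\<in>insert x F. cball x r) \<le> hausdorff_content k \<delta> (cball x r) + hausdorff_content k \<delta> (\<Union>x\<in>F. cball x r)"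
    using assms hausdorff_content_Un[of \<delta> k "cball x r" "\<Union>x\<in>F. cball x r"] by simp
  also have "\<dots> \<le> ennreal (unit_ball_vol (real k) * r ^ k) + ennreal (real (card F) * (unit_ball_vol (real k) * r ^ k))"
    by (rule add_mono[OF w insert.IH])
  also have "\<dots> = ennreal (real (card (insert x F)) * (unit_ball_vol (real k) * r ^ k))"
    using insert.hyps assms by (simp add: algebra_simps flip: ennreal_plus)
  finally show ?case .
qed

context orthonormal_set begin

text \<open>Points of \<open>K\<close> that are more than \<open>2 * r\<close> apart carry disjoint balls of radius \<open>r\<close>. Choosing them maximal
  inside a finite net of \<open>K\<close> makes the balls of radius \<open>3 * r\<close> cover \<open>K\<close>, so the packing occupies a
  definite proportion of \<open>K\<close>.\<close>

lemma ball_packing: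
  assumes K: "compact K" "K \<subseteq> G" and G: "open G" and d: "\<delta> > 0"
  obtains F r where "finite F" "F \<subseteq> K" "r > 0" "6 * r \<le> \<delta>"
    "\<And>x. x \<in> F \<Longrightarrow> cball x r \<subseteq> G" "disjoint_family_on (\<lambda>x. cball x r) F" "K \<subseteq> (\<Union>x\<in>F. cball x (3 * r))"
proof -
  obtain e where e: "e > 0" "\<And>x. x \<in> K \<Longrightarrow> cball x e \<subseteq> G"
  proof (cases "K = {}")
    case False
    obtain e where e: "e > 0" "(\<Union>x\<in>K. cball x e) \<subseteq> G"
      using compact_subset_open_imp_cball_epsilon_subset[OF K(1) G K(2)] by blast
    then show ?thesis using that[of e] by blast
  qed (use that[of 1] in auto)
  define r where "r = min e (\<delta> / 6)"
  have r: "r > 0" "6 * r \<le> \<delta>" "r \<le> e" using e d by (auto simp: r_def)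
  obtain T where T: "T \<subseteq> K" "finite T" "K \<subseteq> (\<Union>x\<in>T. ball x r)"
  proof (rule compactE_image[OF K(1), of K "\<lambda>x. ball x r"])
    show "K \<subseteq> (\<Union>x\<in>K. ball x r)" using r by auto
  qed auto
  obtain F where F: "F \<subseteq> T" "\<And>x y. x \<in> F \<Longrightarrow> y \<in> F \<Longrightarrow> x \<noteq> y \<Longrightarrow> 2 * r < dist x y" "\<And>x. x \<in> T \<Longrightarrow> \<exists>y\<in>F. x = y \<or> dist x y \<le> 2 * r"
    using finite_separated_subset[OF T(2)] by metis
  show ?thesis
  proof
    show "finite F" using F(1) T(2) finite_subset by blast
    show "F \<subseteq> K" using F T by blast
    show "r > 0" "6 * r \<le> \<delta>" by fact+
    show "cball x r \<subseteq> G" if "x \<in> F" for x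
      using e(2)[of x] F(1) T(1) that r(3) by (meson order_trans subset_cball subsetD)
    show "disjoint_family_on (\<lambda>x. cball x r) F"
    proof -
      have "cball x r \<inter> cball y r = {}" if "x \<in> F" "y \<in> F" "x \<noteq> y" for x y
      proof (rule ccontr)
        assume "cball x r \<inter> cball y r \<noteq> {}"
        then obtain z where "dist x z \<le> r" "dist y z \<le> r" by auto
        then show False using F(2)[OF that] dist_triangle2[of x y z] by linarith
      qed
      then show ?thesis by (auto simp: disjoint_family_on_def)
    qed
    show "K \<subseteq> (\<Union>x\<in>F. cball x (3 * r))"
    proof
      fix z assume "z \<in> K"
      then obtain t where t: "t \<in> T" "dist t z < r" using T(3) by auto
      obtain y where y: "y \<in> F" "dist t y \<le> 2 * r" using F(3)[OF t(1)] r by auto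
      have "dist y z \<le> 3 * r" using dist_triangle3[of y z t] t y by linarith
      then show "z \<in> (\<Union>x\<in>F. cball x (3 * r))" using y by auto
    qed
  qed
qed

lemma compact_exhaustion:
  assumes G: "open G" "bounded G"
  obtains K :: "nat \<Rightarrow> 'a set" where "incseq K" "\<And>n. compact (K n)" "\<And>n. K n \<subseteq> G \<inter> span B" "(\<Union>n. K n) = G \<inter> span B"
proof
  have ne: "- G \<noteq> {}" using G not_bounded_UNIV by (metis Compl_UNIV_eq double_complement)
  define K where "K n = G \<inter> (span B \<inter> {x. infdist x (- G) \<ge> 1 / (real n + 1)})" for n
  have K: "K n = span B \<inter> {x. infdist x (- G) \<ge> 1 / (real n + 1)}" for n
  proof -
    have "x \<in> G" if "infdist x (- G) \<ge> 1 / (real n + 1)" for x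
    proof (rule ccontr)
      assume "x \<notin> G"
      then have "infdist x (- G) = 0" by (intro infdist_zero) auto
      then show False using that by simp
    qed
    then show ?thesis by (auto simp: K_def)
  qed
  show "K n \<subseteq> G \<inter> span B" for n by (auto simp: K_def)
  show "compact (K n)" for n
  proof -
    have "closed {x. infdist x (- G) \<ge> 1 / (real n + 1)}"
      by (intro closed_Collect_le continuous_on_const continuous_on_infdist continuous_on_id)
    then have "closed (K n)" unfolding K by (intro closed_Int closed_span)
    moreover have "bounded (K n)" using G(2) by (rule bounded_subset) (auto simp: K_def)
    ultimately show ?thesis by (simp add: compact_eq_bounded_closed)
  qed
  show "incseq K" unfolding K
    by (intro incseq_SucI) (auto intro: order_trans[rotated] simp: frac_le)
  show "(\<Union>n. K n) = G \<inter> span B"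
  proof
    show "G \<inter> span B \<subseteq> (\<Union>n. K n)"
    proof
      fix x assume x: "x \<in> G \<inter> span B"
      then have "infdist x (- G) > 0"
        using in_closed_iff_infdist_zero[of "- G" x] ne G infdist_nonneg[of x "- G"] by (auto simp: closed_def)
      then obtain m where "1 / (real m + 1) < infdist x (- G)"
        by (metis nat_approx_posE of_nat_Suc add.commute)
      then show "x \<in> (\<Union>n. K n)" using x by (auto simp: K intro!: exI[of _ m])
    qed
  qed (auto simp: K_def)
qed

lemma emeasure_packing:
  assumes "finite F" "F \<subseteq> span B" "r > 0" "disjoint_family_on (\<lambda>x. cball x r) F"
  shows "emeasure (span_lebesgue B) (\<Union>x\<in>F. cball x r) = ennreal (real (card F) * (unit_ball_vol (real (card B)) * r ^ card B))"
proof -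
  have "emeasure (span_lebesgue B) (\<Union>x\<in>F. cball x r) = (\<Sum>x\<in>F. emeasure (span_lebesgue B) (cball x r))"
    using assms by (intro sum_emeasure[symmetric]) auto
  also have "\<dots> = (\<Sum>x\<in>F. ennreal (unit_ball_vol (real (card B)) * r ^ card B))"
    using assms by (intro sum.cong emeasure_span_lebesgue_cball) auto
  finally show ?thesis using assms by (simp add: ennreal_mult ennreal_of_nat_eq_real_of_nat)
qed

text \<open>A first crude bound: in a packing of a compact subset, enlarging the balls threefold gives a cover,
  while the original balls are disjoint and lie in \<open>G\<close>.\<close>

lemma hausdorff_outer_le_three_power:
  assumes G: "open G" "bounded G"
  shows "hausdorff_outer (card B) (G \<inter> span B) \<le> ennreal (3 ^ card B) * emeasure (span_lebesgue B) G"
proof -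
  let ?k = "card B"
  obtain K where K: "incseq K" "\<And>n. compact (K n)" "\<And>n. K n \<subseteq> G \<inter> span B" "(\<Union>n. K n) = G \<inter> span B"
    using compact_exhaustion[OF G] by metis
  have Kn: "hausdorff_outer ?k (K n) \<le> ennreal (3 ^ ?k) * emeasure (span_lebesgue B) G" for n
  proof (rule hausdorff_outer_leI)
    fix \<delta> :: real assume d: "\<delta> > 0"
    have sub: "K n \<subseteq> span B" "K n \<subseteq> G" using K(3) by auto
    obtain F r where F: "finite F" "F \<subseteq> K n" "r > 0" "6 * r \<le> \<delta>"
      "\<And>x. x \<in> F \<Longrightarrow> cball x r \<subseteq> G" "disjoint_family_on (\<lambda>x. cball x r) F" "K n \<subseteq> (\<Union>x\<in>F. cball x (3 * r))"
      using ball_packing[OF K(2) sub(2) G(1) d] by metis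
    have "hausdorff_content ?k \<delta> (K n) \<le> hausdorff_content ?k \<delta> (\<Union>x\<in>F. cball x (3 * r))"
      using F by (intro hausdorff_content_mono)
    also have "\<dots> \<le> ennreal (real (card F) * (unit_ball_vol (real ?k) * (3 * r) ^ ?k))"
      using F by (intro hausdorff_content_UN_cball) auto
    also have "\<dots> = ennreal (3 ^ ?k) * ennreal (real (card F) * (unit_ball_vol (real ?k) * r ^ ?k))"
      by (simp add: power_mult_distrib mult_ac flip: ennreal_mult')
    also have "ennreal (real (card F) * (unit_ball_vol (real ?k) * r ^ ?k)) = emeasure (span_lebesgue B) (\<Union>x\<in>F. cball x r)"
      using F sub by (intro emeasure_packing[symmetric]) auto
    also have "ennreal (3 ^ ?k) * \<dots> \<le> ennreal (3 ^ ?k) * emeasure (span_lebesgue B) G"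
      using F(5) G by (intro mult_left_mono emeasure_mono) auto
    finally show "hausdorff_content ?k \<delta> (K n) \<le> ennreal (3 ^ ?k) * emeasure (span_lebesgue B) G" .
  qed
  have Kb: "K n \<in> sets borel" for n using K(2) by (simp add: compact_imp_closed)
  have GV: "G \<inter> span B \<in> sets borel" using G(1) by (simp add: closed_span borel_closed borel_open)
  have "hausdorff_outer ?k (G \<inter> span B) = emeasure (hausdorff_measure ?k) (\<Union>n. K n)"
    using GV by (simp add: K(4) emeasure_hausdorff_measure)
  also have "\<dots> = (SUP n. emeasure (hausdorff_measure ?k) (K n))"
    using K(1) Kb by (intro SUP_emeasure_incseq[symmetric]) auto
  also have "\<dots> \<le> ennreal (3 ^ ?k) * emeasure (span_lebesgue B) G"
    using Kn Kb by (intro SUP_least) (simp add: emeasure_hausdorff_measure)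
  finally show ?thesis .
qed

text \<open>Disjoint balls fill at least the fraction \<open>1 / (2 * 3 ^ card B)\<close> of \<open>G\<close>, and on them the content is at most
  Lebesgue measure because the weight of a ball is its volume. The old constant \<open>M\<close> is only needed
  on the open remainder, so the excess of the constant over 1 shrinks by a fixed factor.\<close>

lemma hausdorff_content_improve:
  assumes M: "M \<ge> 1" and bound: "\<And>G. open G \<Longrightarrow> bounded G \<Longrightarrow>
      hausdorff_content (card B) \<delta> (G \<inter> span B) \<le> ennreal M * emeasure (span_lebesgue B) G"
    and d: "\<delta> > 0" and G: "open G" "bounded G"
  shows "hausdorff_content (card B) \<delta> (G \<inter> span B) \<le>
    ennreal (1 + (1 - 1 / (2 * 3 ^ card B)) * (M - 1)) * emeasure (span_lebesgue B) G"
proof -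
  let ?k = "card B" and ?m = "emeasure (span_lebesgue B)"
  obtain K where K: "incseq K" "\<And>n. compact (K n)" "\<And>n. K n \<subseteq> G \<inter> span B" "(\<Union>n. K n) = G \<inter> span B"
    using compact_exhaustion[OF G] by metis
  have Kb: "K n \<in> sets borel" for n using K(2) by (simp add: compact_imp_closed)
  have Gb: "G \<in> sets borel" using G by simp
  obtain l where l: "l \<ge> 0" "?m G = ennreal l"
    using emeasure_span_lebesgue_bounded[OF Gb G(2)] by (cases "?m G") auto
  \<comment> \<open>Half of the measure of \<open>G\<close> is already carried by a compact subset of the span.\<close>
  have "\<exists>n. ennreal (l / 2) \<le> ?m (K n)"
  proof (cases "l = 0")
    case False
    have "?m G = ?m (\<Union>n. K n)" using emeasure_span_lebesgue_Int_span[OF Gb] K(4) by simp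
    also have "\<dots> = (SUP n. ?m (K n))" using K(1) Kb by (intro SUP_emeasure_incseq[symmetric]) auto
    finally have SUP: "(SUP n. ?m (K n)) = ennreal l" using l by simp
    have "ennreal (l / 2) < (SUP n. ?m (K n))" unfolding SUP using l(1) False by (simp add: ennreal_less_iff)
    then show ?thesis by (auto simp: less_SUP_iff intro: less_imp_le)
  qed simp
  then obtain n where n: "ennreal (l / 2) \<le> ?m (K n)" by blast
  have sub: "K n \<subseteq> span B" "K n \<subseteq> G" using K(3) by auto
  obtain F r where F: "finite F" "F \<subseteq> K n" "r > 0" "6 * r \<le> \<delta>"
      "\<And>x. x \<in> F \<Longrightarrow> cball x r \<subseteq> G" "disjoint_family_on (\<lambda>x. cball x r) F" "K n \<subseteq> (\<Union>x\<in>F. cball x (3 * r))"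
    using ball_packing[OF K(2) sub(2) G(1) d] by metis
  define a where "a = real (card F) * (unit_ball_vol (real ?k) * r ^ ?k)"
  define U where "U = (\<Union>x\<in>F. cball x r)"
  have U: "?m U = ennreal a" "closed U" "U \<subseteq> G"
    using F sub unfolding U_def a_def by (auto intro!: emeasure_packing closed_UN)
  have a0: "a \<ge> 0" using F by (simp add: a_def)
  have al: "a \<le> l"
  proof -
    have "?m U \<le> ?m G" using U Gb by (intro emeasure_mono) auto
    then show ?thesis using U l by (simp add: ennreal_le_iff)
  qed
  have "ennreal (l / 2) \<le> ?m (\<Union>x\<in>F. cball x (3 * r))"
    using n F(1,7) by (intro order_trans[OF n] emeasure_mono) auto
  also have "\<dots> \<le> (\<Sum>x\<in>F. ?m (cball x (3 * r)))"
    using F by (intro emeasure_subadditive_finite) auto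
  also have "\<dots> = (\<Sum>x\<in>F. ennreal (unit_ball_vol (real ?k) * (3 * r) ^ ?k))"
    using F sub by (intro sum.cong emeasure_span_lebesgue_cball) auto
  also have "\<dots> = ennreal (3 ^ ?k * a)"
    using F by (simp add: a_def power_mult_distrib mult_ac ennreal_of_nat_eq_real_of_nat flip: ennreal_mult')
  finally have "l / 2 \<le> 3 ^ ?k * a" using a0 by (simp add: ennreal_le_iff)
  then have big: "l / (2 * 3 ^ ?k) \<le> a" by (simp add: field_simps)
  have rest: "?m (G - U) = ennreal (l - a)"
    using U Gb l a0 by (subst emeasure_Diff) (auto simp: ennreal_minus)
  have "hausdorff_content ?k \<delta> (G \<inter> span B) \<le> hausdorff_content ?k \<delta> (U \<union> ((G - U) \<inter> span B))"
    by (intro hausdorff_content_mono) auto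
  also have "\<dots> \<le> hausdorff_content ?k \<delta> U + hausdorff_content ?k \<delta> ((G - U) \<inter> span B)"
    using d by (intro hausdorff_content_Un) auto
  also have "\<dots> \<le> ennreal a + ennreal M * ?m (G - U)"
  proof (rule add_mono)
    show "hausdorff_content ?k \<delta> U \<le> ennreal a"
      unfolding U_def a_def using F by (intro hausdorff_content_UN_cball) auto
    show "hausdorff_content ?k \<delta> ((G - U) \<inter> span B) \<le> ennreal M * ?m (G - U)"
      using G U by (intro bound open_Diff bounded_subset[OF G(2)]) auto
  qed
  also have "\<dots> = ennreal (a + M * (l - a))"
    unfolding rest using M al a0 by (simp flip: ennreal_mult')
  also have "\<dots> \<le> ennreal ((1 + (1 - 1 / (2 * 3 ^ ?k)) * (M - 1)) * l)"
  proof (rule ennreal_leI)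
    have "(M - 1) * (l / (2 * 3 ^ ?k)) \<le> (M - 1) * a" using big M by (intro mult_left_mono) auto
    then show "a + M * (l - a) \<le> (1 + (1 - 1 / (2 * 3 ^ ?k)) * (M - 1)) * l"
      by (simp add: algebra_simps)
  qed
  also have "\<dots> = ennreal (1 + (1 - 1 / (2 * 3 ^ ?k)) * (M - 1)) * ?m G"
    using l by (simp add: ennreal_mult'')
  finally show ?thesis .
qed

text \<open>Iterating the improvement from the crude bound drives the constant to 1.\<close>

lemma hausdorff_content_open_le:
  assumes d: "\<delta> > 0" and G: "open G" "bounded G"
  shows "hausdorff_content (card B) \<delta> (G \<inter> span B) \<le> emeasure (span_lebesgue B) G"
proof -
  let ?k = "card B" and ?m = "emeasure (span_lebesgue B)"
  define \<rho> where "\<rho> = 1 - 1 / (2 * 3 ^ ?k :: real)"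
  have one: "(1::real) \<le> 3 ^ ?k" by simp
  have r: "0 \<le> \<rho>" "\<rho> < 1" unfolding \<rho>_def using one by (simp_all add: field_simps del: one_le_power)
  define M where "M j = 1 + \<rho> ^ j * (3 ^ ?k - 1 :: real)" for j :: nat
  have M1: "M j \<ge> 1" for j using r one by (simp add: M_def)
  have main: "hausdorff_content ?k \<delta> (G \<inter> span B) \<le> ennreal (M j) * ?m G" if "open G" "bounded G" for j G
    using that
  proof (induction j arbitrary: G)
    case 0
    have "hausdorff_content ?k \<delta> (G \<inter> span B) \<le> hausdorff_outer ?k (G \<inter> span B)"
      by (rule hausdorff_content_le_outer[OF d])
    also have "\<dots> \<le> ennreal (3 ^ ?k) * ?m G" by (rule hausdorff_outer_le_three_power[OF 0])
    finally show ?case by (simp add: M_def)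
  next
    case (Suc j)
    from hausdorff_content_improve[OF M1 Suc.IH d Suc.prems]
    have "hausdorff_content ?k \<delta> (G \<inter> span B) \<le> ennreal (1 + \<rho> * (M j - 1)) * ?m G"
      by (simp add: \<rho>_def)
    then show ?case by (simp add: M_def mult.assoc)
  qed
  obtain l where l: "l \<ge> 0" "?m G = ennreal l"
    using emeasure_span_lebesgue_bounded[of G] G by (cases "?m G") auto
  have "(\<lambda>j. ennreal (M j * l)) \<longlonglongrightarrow> ennreal ((1 + 0 * (3 ^ ?k - 1)) * l)"
    unfolding M_def by (intro tendsto_ennrealI tendsto_mult tendsto_add tendsto_const LIMSEQ_power_zero) (use r in auto)
  then have "(\<lambda>j. ennreal (M j) * ?m G) \<longlonglongrightarrow> ?m G"
    using l by (simp add: ennreal_mult'')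
  then show ?thesis by (rule LIMSEQ_le_const) (use main[OF G] in auto)
qed

lemma hausdorff_outer_eq_span_lebesgue_bounded:
  assumes E: "E \<in> sets borel" "E \<subseteq> span B" "bounded E"
  shows "hausdorff_outer (card B) E = emeasure (span_lebesgue B) E"
proof (rule antisym[OF _ span_lebesgue_le_hausdorff_outer[OF E(1)]])
  let ?m = "emeasure (span_lebesgue B)"
  \<comment> \<open>Restricting to a ball makes the measure finite, as outer regularity requires.\<close>
  obtain R where R: "E \<subseteq> ball 0 R" using bounded_subset_ballD[OF E(3)] by blast
  define N where "N = density (span_lebesgue B) (indicator (ball 0 R))"
  have sN: "sets N = sets borel" by (simp add: N_def)
  have ind: "(indicator (ball 0 R) :: 'a \<Rightarrow> ennreal) \<in> borel_measurable (span_lebesgue B)" by (rule borel_measurable_indicator) simp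
  have eN: "emeasure N X = ?m (X \<inter> ball 0 R)" if "X \<in> sets borel" for X
    unfolding N_def using that by (subst emeasure_density[OF ind]) (auto simp: indicator_inter_arith[symmetric] mult.commute)
  have fin: "emeasure N (space N) \<noteq> \<infinity>"
    using emeasure_span_lebesgue_bounded[of "ball 0 R"] sets_eq_imp_space_eq[OF sN] by (simp add: eN)
  have "?m E = emeasure N E" using E R by (simp add: eN Int_absorb2)
  also have "\<dots> = (INF U \<in> {U. E \<subseteq> U \<and> open U}. emeasure N U)" by (rule outer_regular[OF sN fin E(1)])
  finally have mE: "?m E = (INF U \<in> {U. E \<subseteq> U \<and> open U}. emeasure N U)" .
  show "hausdorff_outer (card B) E \<le> ?m E"
    unfolding mE
  proof (rule INF_greatest)
    fix U assume "U \<in> {U. E \<subseteq> U \<and> open U}"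
    then have U: "E \<subseteq> U" "open U" by auto
    have "hausdorff_outer (card B) E \<le> hausdorff_outer (card B) ((U \<inter> ball 0 R) \<inter> span B)"
      using U R E by (intro hausdorff_outer_mono) auto
    also have "\<dots> \<le> ?m (U \<inter> ball 0 R)"
      using U by (intro hausdorff_outer_leI hausdorff_content_open_le open_Int open_ball bounded_Int) auto
    also have "\<dots> = emeasure N U" using U by (simp add: eN)
    finally show "hausdorff_outer (card B) E \<le> emeasure N U" .
  qed
qed

text \<open>This fixes the normalisation of Hausdorff measure in every dimension at once; it includes
  \<open>B = {}\<close>, where both sides are counting measure on the origin.\<close>

theorem hausdorff_outer_eq_span_lebesgue:
  assumes E: "E \<in> sets borel" "E \<subseteq> span B"
  shows "hausdorff_outer (card B) E = emeasure (span_lebesgue B) E"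
proof -
  let ?A = "\<lambda>n::nat. E \<inter> ball 0 (real n)"
  have A: "incseq ?A" "\<And>n. ?A n \<in> sets borel" "(\<Union>n. ?A n) = E"
    using E reals_Archimedean2 by (auto simp: incseq_def)
  have "hausdorff_outer (card B) E = emeasure (hausdorff_measure (card B)) (\<Union>n. ?A n)"
    using E A by (simp add: emeasure_hausdorff_measure)
  also have "\<dots> = (SUP n. emeasure (hausdorff_measure (card B)) (?A n))"
    using A by (intro SUP_emeasure_incseq[symmetric]) auto
  also have "\<dots> = (SUP n. emeasure (span_lebesgue B) (?A n))"
    using A E by (intro SUP_cong refl) (auto simp: emeasure_hausdorff_measure bounded_Int intro!: hausdorff_outer_eq_span_lebesgue_bounded)
  also have "\<dots> = emeasure (span_lebesgue B) (\<Union>n. ?A n)"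
    using A by (intro SUP_emeasure_incseq) auto
  finally show ?thesis using A by simp
qed

end

section \<open>Local comparison of the sphere with its slices\<close>

text \<open>A continuous injection on a compact set has a continuous inverse, under which the image of \<open>E\<close> is a
  preimage of \<open>E\<close>.\<close>

lemma borel_image_of_compact_homeomorphism:
  fixes f :: "'a::t2_space \<Rightarrow> 'b::t2_space"
  assumes K: "compact K" and f: "continuous_on K f" "inj_on f K" and E: "E \<subseteq> K" "E \<in> sets borel"
  shows "f ` E \<in> sets borel"
proof -
  obtain g where g: "homeomorphism K (f ` K) f g" using homeomorphism_compact[OF K f(1) refl f(2)] by blast
  have cK: "f ` K \<in> sets borel"
    using compact_continuous_image[OF f(1) K] by (intro borel_closed compact_imp_closed)
  have "g \<in> restrict_space borel (f ` K) \<rightarrow>\<^sub>M borel"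
    using homeomorphism_cont2[OF g] by (rule borel_measurable_continuous_on_restrict)
  from measurable_sets[OF this E(2)] have "g -` E \<inter> f ` K \<in> sets (restrict_space borel (f ` K))"
    by (simp add: space_restrict_space)
  then have "g -` E \<inter> f ` K \<in> sets borel" using cK by (auto simp: sets_restrict_space_iff)
  moreover have "g -` E \<inter> f ` K = f ` E"
    using homeomorphism_apply1[OF g] homeomorphism_apply2[OF g] E(1) by (auto simp: image_iff)
  ultimately show ?thesis by simp
qed

text \<open>Fubini's theorem for the hyperplanes orthogonal to a further unit vector \<open>\<tau>\<close>.\<close>

lemma (in orthonormal_set) span_lebesgue_slices:
  assumes \<tau>: "\<tau> \<notin> B" and o: "orthonormal_set (insert \<tau> B)" and F: "F \<in> sets borel"
  shows "(\<lambda>s. emeasure (span_lebesgue B) {w. w + s *\<^sub>R \<tau> \<in> F}) \<in> borel_measurable borel"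
    and "emeasure (span_lebesgue (insert \<tau> B)) F = (\<integral>\<^sup>+s. emeasure (span_lebesgue B) {w. w + s *\<^sub>R \<tau> \<in> F} \<partial>lborel)"
proof -
  interpret product_sigma_finite "\<lambda>_. lborel :: real measure" by standard
  interpret I: orthonormal_set "insert \<tau> B" by (rule o)
  interpret C: sigma_finite_measure coord_space using finite_B by (rule sigma_finite)
  have sec: "{w. w + s *\<^sub>R \<tau> \<in> F} \<in> sets borel" for s :: real
  proof -
    have "(\<lambda>w. w + s *\<^sub>R \<tau>) \<in> borel \<rightarrow>\<^sub>M borel" by measurable
    from measurable_sets[OF this F] show ?thesis by (simp add: vimage_def)
  qed
  have e: "emeasure (span_lebesgue B) {w. w + s *\<^sub>R \<tau> \<in> F} = (\<integral>\<^sup>+f. indicator F (comb f + s *\<^sub>R \<tau>) \<partial>coord_space)" for s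
  proof -
    have "emeasure (span_lebesgue B) {w. w + s *\<^sub>R \<tau> \<in> F} = (\<integral>\<^sup>+w. indicator {w. w + s *\<^sub>R \<tau> \<in> F} w \<partial>span_lebesgue B)"
      using sec by simp
    also have "\<dots> = (\<integral>\<^sup>+f. indicator {w. w + s *\<^sub>R \<tau> \<in> F} (comb f) \<partial>coord_space)"
      unfolding span_lebesgue_def using sec by (subst nn_integral_distr) auto
    finally show ?thesis by (simp add: indicator_def)
  qed
  have "(\<lambda>x. comb (snd x) + fst x *\<^sub>R \<tau>) \<in> borel \<Otimes>\<^sub>M coord_space \<rightarrow>\<^sub>M borel"
    by (intro borel_measurable_add measurable_compose[OF measurable_snd comb_measurable]) measurable
  then have "(\<lambda>x. indicator F (comb (snd x) + fst x *\<^sub>R \<tau>) :: ennreal) \<in> borel_measurable (borel \<Otimes>\<^sub>M coord_space)"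
    using F by (intro measurable_compose[OF _ borel_measurable_indicator]) auto
  then show "(\<lambda>s. emeasure (span_lebesgue B) {w. w + s *\<^sub>R \<tau> \<in> F}) \<in> borel_measurable borel"
    unfolding e by (intro C.borel_measurable_nn_integral) (simp add: split_beta')
  have "emeasure (span_lebesgue (insert \<tau> B)) F = (\<integral>\<^sup>+f. indicator F (\<Sum>b\<in>insert \<tau> B. f b *\<^sub>R b) \<partial>Pi\<^sub>M (insert \<tau> B) (\<lambda>_. lborel))"
  proof -
    have "emeasure (span_lebesgue (insert \<tau> B)) F = (\<integral>\<^sup>+w. indicator F w \<partial>span_lebesgue (insert \<tau> B))"
      using F by simp
    also have "\<dots> = (\<integral>\<^sup>+f. indicator F (\<Sum>b\<in>insert \<tau> B. f b *\<^sub>R b) \<partial>Pi\<^sub>M (insert \<tau> B) (\<lambda>_. lborel))"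
      unfolding span_lebesgue_def using F I.comb_measurable by (subst nn_integral_distr) auto
    finally show ?thesis .
  qed
  also have "\<dots> = (\<integral>\<^sup>+s. \<integral>\<^sup>+f. indicator F (\<Sum>b\<in>insert \<tau> B. (f(\<tau> := s)) b *\<^sub>R b) \<partial>coord_space \<partial>lborel)"
    using F finite_B \<tau> I.comb_measurable
    by (intro product_nn_integral_insert_rev measurable_compose[OF _ borel_measurable_indicator]) auto
  also have "\<dots> = (\<integral>\<^sup>+s. emeasure (span_lebesgue B) {w. w + s *\<^sub>R \<tau> \<in> F} \<partial>lborel)"
  proof -
    have "(\<Sum>b\<in>insert \<tau> B. (f(\<tau> := s)) b *\<^sub>R b) = comb f + s *\<^sub>R \<tau>" for f s
    proof -
      have "(\<Sum>b\<in>B. (f(\<tau> := s)) b *\<^sub>R b) = comb f" using \<tau> by (intro sum.cong) auto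
      then show ?thesis using finite_B \<tau> by simp
    qed
    then show ?thesis unfolding e by simp
  qed
  finally show "emeasure (span_lebesgue (insert \<tau> B)) F = (\<integral>\<^sup>+s. emeasure (span_lebesgue B) {w. w + s *\<^sub>R \<tau> \<in> F} \<partial>lborel)" .
qed

lemma orthonormal_frame:
  fixes x0 \<tau> :: "'a::euclidean_space"
  assumes x0: "norm x0 = 1" and \<tau>: "norm \<tau> = 1" "x0 \<bullet> \<tau> = 0"
  obtains B where "orthonormal_set B" "orthonormal_set (insert \<tau> B)" "\<tau> \<notin> B" "card B = DIM('a) - 2"
    "\<forall>b\<in>B. b \<bullet> x0 = 0 \<and> b \<bullet> \<tau> = 0"
    "\<forall>d. d = (d \<bullet> x0) *\<^sub>R x0 + (d \<bullet> \<tau>) *\<^sub>R \<tau> + (\<Sum>b\<in>B. (d \<bullet> b) *\<^sub>R b)"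
proof -
  define S where "S = {x. x \<bullet> x0 = 0 \<and> x \<bullet> \<tau> = 0}"
  have S: "subspace S" by (auto simp: S_def subspace_def inner_add_left)
  obtain B where B: "B \<subseteq> S" "pairwise orthogonal B" "\<And>x. x \<in> B \<Longrightarrow> norm x = 1" "independent B" "span B = S"
    using orthonormal_basis_subspace[OF S] by metis
  have perp: "b \<bullet> x0 = 0 \<and> b \<bullet> \<tau> = 0" if "b \<in> B" for b using B(1) that by (auto simp: S_def)
  have 1: "orthonormal_set B" by standard (use B in auto)
  have \<tau>B: "\<tau> \<notin> B" using perp[of \<tau>] \<tau> by (auto simp: norm_eq_1)
  have x0B: "x0 \<notin> insert \<tau> B" using perp[of x0] x0 \<tau> by (auto simp: norm_eq_1)
  have 2: "orthonormal_set (insert \<tau> B)"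
    by standard (use B perp \<tau> in \<open>auto simp: pairwise_insert orthogonal_def inner_commute\<close>)
  have 3: "pairwise orthogonal (insert x0 (insert \<tau> B))"
    using B perp \<tau> by (auto simp: pairwise_insert orthogonal_def inner_commute)
  have dec: "d = (d \<bullet> x0) *\<^sub>R x0 + (d \<bullet> \<tau>) *\<^sub>R \<tau> + (\<Sum>b\<in>B. (d \<bullet> b) *\<^sub>R b)" for d
  proof -
    define e where "e = d - (d \<bullet> x0) *\<^sub>R x0 - (d \<bullet> \<tau>) *\<^sub>R \<tau>"
    have "e \<in> span B" unfolding B(5) S_def e_def
      using x0 \<tau> by (auto simp: inner_diff_left norm_eq_1 inner_commute[of \<tau> x0])
    then have "e = (\<Sum>b\<in>B. (e \<bullet> b) *\<^sub>R b)" using orthonormal_set.comb_coords[OF 1] by simp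
    also have "\<dots> = (\<Sum>b\<in>B. (d \<bullet> b) *\<^sub>R b)"
    proof (rule sum.cong)
      fix b assume "b \<in> B"
      then show "(e \<bullet> b) *\<^sub>R b = (d \<bullet> b) *\<^sub>R b" using perp[of b] by (simp add: e_def inner_diff_left inner_commute[of x0 b] inner_commute[of \<tau> b])
    qed simp
    finally show ?thesis by (simp add: e_def algebra_simps)
  qed
  have "independent (insert x0 (insert \<tau> B))"
    using 3 x0 \<tau> B(3) by (intro pairwise_orthogonal_independent) fastforce+
  moreover have "span (insert x0 (insert \<tau> B)) = UNIV"
  proof -
    have "d \<in> span (insert x0 (insert \<tau> B))" for d
    proof -
      have "(d \<bullet> x0) *\<^sub>R x0 + (d \<bullet> \<tau>) *\<^sub>R \<tau> + (\<Sum>b\<in>B. (d \<bullet> b) *\<^sub>R b) \<in> span (insert x0 (insert \<tau> B))"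
        by (intro span_add span_sum span_scale) (auto intro: span_base)
      moreover note arg_cong[OF dec[of d], of "\<lambda>z. z \<in> span (insert x0 (insert \<tau> B))"]
      ultimately show ?thesis by blast
    qed
    then show ?thesis by auto
  qed
  ultimately have "card (insert x0 (insert \<tau> B)) = DIM('a)"
    by (metis dim_UNIV dim_span dim_eq_card_independent)
  then have "card B = DIM('a) - 2"
    using orthonormal_set.finite_B[OF 1] \<tau>B x0B by simp
  then show ?thesis using that[of B] 1 2 \<tau>B perp dec by blast
qed

abbreviation slice_weight :: "real \<Rightarrow> real" where
  "slice_weight t \<equiv> (1 - t\<^sup>2) powr (-1/2)"

text \<open>The slicing formula up to a factor \<open>c\<close>. Measurability of the slice measures \<open>t \<mapsto> H {x \<in> E. x \<bullet> \<omega> = t}\<close> is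
  not known beforehand; \<open>h\<close> is a measurable function that stands in for them and lies within a factor
  of \<open>c\<close>. Letting \<open>c\<close> tend to 1 yields measurability together with the formula.\<close>

definition slicing_witness :: "real \<Rightarrow> 'a::euclidean_space \<Rightarrow> 'a set \<Rightarrow> (real \<Rightarrow> ennreal) \<Rightarrow> bool" where
  "slicing_witness c \<omega> E h \<longleftrightarrow> h \<in> borel_measurable borel \<and>
    (\<forall>t. h t \<le> ennreal c * hausdorff_outer (DIM('a) - 2) {x\<in>E. x \<bullet> \<omega> = t} \<and>
         hausdorff_outer (DIM('a) - 2) {x\<in>E. x \<bullet> \<omega> = t} \<le> ennreal c * h t) \<and>
    hausdorff_outer (DIM('a) - 1) E \<le> ennreal c * (\<integral>\<^sup>+t\<in>{-1<..<1}. ennreal (slice_weight t) * h t \<partial>lborel) \<and>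
    (\<integral>\<^sup>+t\<in>{-1<..<1}. ennreal (slice_weight t) * h t \<partial>lborel) \<le> ennreal c * hausdorff_outer (DIM('a) - 1) E"

text \<open>Let \<open>\<tau>\<close> be the unit vector tangent to the sphere at \<open>x0\<close> that points towards \<open>\<omega>\<close>, and let \<open>B\<close> be an
  orthonormal basis of the orthogonal complement of \<open>x0\<close> and \<open>\<tau>\<close>. The linear map
  \<open>\<Phi>\<close> keeps the coordinates in \<open>B\<close> and uses \<open>(d \<bullet> \<omega>) / r0\<close> as the coordinate along \<open>\<tau>\<close>. It differs from
  the identity by a multiple of \<open>d \<bullet> x0\<close>, and for differences \<open>d\<close> of nearby points of the sphere this is
  small compared with the norm of \<open>d\<close>. Hence \<open>\<Phi>\<close> distorts distances on the sphere near \<open>x0\<close>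
  by a factor close to 1. It maps the slice at height \<open>t\<close> into the affine subspace at height \<open>t / r0\<close>, and
  \<open>1 / r0\<close> is the weight of the slice measure at the height of \<open>x0\<close>. Thus Fubini's theorem in the image
  produces the weighted integral of the slice measures up to the distortion.\<close>

lemma sphere_slicing_local:
  fixes \<omega> x0 :: "'a::euclidean_space"
  assumes n: "DIM('a) \<ge> 2" and \<omega>: "norm \<omega> = 1" and x0: "norm x0 = 1" and t0: "\<bar>x0 \<bullet> \<omega>\<bar> < 1" and c: "c > 1"
  obtains \<delta> where "\<delta> > 0" "\<And>E. E \<in> sets borel \<Longrightarrow> E \<subseteq> sphere 0 1 \<inter> cball x0 \<delta> \<Longrightarrow>
    \<exists>h. slicing_witness c \<omega> E h"
proof -
  define t0 where "t0 = x0 \<bullet> \<omega>"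
  define r0 where "r0 = sqrt (1 - t0\<^sup>2)"
  define \<tau> where "\<tau> = (1 / r0) *\<^sub>R (\<omega> - t0 *\<^sub>R x0)"
  define \<kappa> where "\<kappa> = t0 / r0"
  have t01: "t0\<^sup>2 < 1" using t0 by (simp add: t0_def abs_square_less_1)
  then have r0: "r0 > 0" "r0\<^sup>2 = 1 - t0\<^sup>2" by (auto simp: r0_def)
  have xx: "x0 \<bullet> x0 = 1" "\<omega> \<bullet> \<omega> = 1" using x0 \<omega> by (auto simp: norm_eq_1)
  have x\<tau>: "x0 \<bullet> \<tau> = 0" using xx by (simp add: \<tau>_def inner_diff_right t0_def)
  have "\<tau> \<bullet> \<tau> = (1 / r0)\<^sup>2 * (1 - t0\<^sup>2)"
    using xx by (simp add: \<tau>_def inner_diff_right inner_diff_left inner_commute[of \<omega> x0] flip: t0_def) (simp add: power2_eq_square algebra_simps)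
  then have n\<tau>: "norm \<tau> = 1" using r0 t01 by (simp add: norm_eq_1 power_divide)
  have \<omega>dec: "\<omega> = t0 *\<^sub>R x0 + r0 *\<^sub>R \<tau>" using r0 by (simp add: \<tau>_def)
  obtain B where B: "orthonormal_set B" "orthonormal_set (insert \<tau> B)" "\<tau> \<notin> B" "card B = DIM('a) - 2"
    "\<forall>b\<in>B. b \<bullet> x0 = 0 \<and> b \<bullet> \<tau> = 0"
    "\<forall>d. d = (d \<bullet> x0) *\<^sub>R x0 + (d \<bullet> \<tau>) *\<^sub>R \<tau> + (\<Sum>b\<in>B. (d \<bullet> b) *\<^sub>R b)"
    by (rule orthonormal_frame[OF x0 n\<tau> x\<tau>])
  note perp = B(5)[rule_format] and dec = B(6)[rule_format]
  interpret B: orthonormal_set B by (rule B(1))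
  interpret B': orthonormal_set "insert \<tau> B" by (rule B(2))
  have cB': "card (insert \<tau> B) = DIM('a) - 1" using B n B.finite_B by simp
  define p where "p d = (\<Sum>b\<in>B. (d \<bullet> b) *\<^sub>R b)" for d :: 'a
  define \<Phi> where "\<Phi> d = p d + ((d \<bullet> \<omega>) / r0) *\<^sub>R \<tau>" for d :: 'a
  have pspan: "p d \<in> span B" for d unfolding p_def by (rule B.comb_in_span)
  have spanperp: "w \<bullet> \<tau> = 0" if "w \<in> span B" for w
    using that perp by (induction rule: span_induct_alt) (auto simp: inner_add_left)
  have pdiff: "p (x - y) = p x - p y" for x y by (simp add: p_def inner_diff_left scaleR_left_diff_distrib sum_subtractf)
  have \<Phi>diff: "\<Phi> (x - y) = \<Phi> x - \<Phi> y" for x y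
    by (simp add: \<Phi>_def pdiff inner_diff_left diff_divide_distrib scaleR_left_diff_distrib)
  have \<Phi>err: "norm (\<Phi> d - d) \<le> (1 + \<bar>\<kappa>\<bar>) * \<bar>d \<bullet> x0\<bar>" for d
  proof -
    have "(d \<bullet> \<omega>) / r0 = (d \<bullet> \<tau>) + \<kappa> * (d \<bullet> x0)"
      using r0 by (subst \<omega>dec) (simp add: inner_add_right \<kappa>_def field_simps)
    then have "\<Phi> d - d = (d \<bullet> x0) *\<^sub>R (\<kappa> *\<^sub>R \<tau> - x0)"
      using dec[of d] by (simp add: \<Phi>_def p_def algebra_simps)
    then have "norm (\<Phi> d - d) = \<bar>d \<bullet> x0\<bar> * norm (\<kappa> *\<^sub>R \<tau> - x0)" by simp
    also have "\<dots> \<le> \<bar>d \<bullet> x0\<bar> * (1 + \<bar>\<kappa>\<bar>)"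
      using norm_triangle_ineq4[of "\<kappa> *\<^sub>R \<tau>" x0] n\<tau> x0 by (intro mult_left_mono) auto
    finally show ?thesis by (simp add: mult.commute)
  qed
  \<comment> \<open>At most \<open>DIM('a) - 1\<close> factors \<open>L\<close> come from the distortion and one from the variation of the weight.\<close>
  define L where "L = root DIM('a) c"
  have L: "L > 1" "L ^ DIM('a) = c" using c by (auto simp: L_def)
  define w where "w t = (1 - t\<^sup>2) powr (-1/2)" for t :: real
  have w0: "w t0 = 1 / r0"
  proof -
    have "w t0 = (1 - t0\<^sup>2) powr (- (1/2))" by (simp add: w_def)
    also have "\<dots> = inverse ((1 - t0\<^sup>2) powr (1/2))" by (rule powr_minus)
    also have "(1 - t0\<^sup>2) powr (1/2) = r0" unfolding r0_def using t01 by (intro powr_half_sqrt) simp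
    finally show ?thesis by (simp add: inverse_eq_divide)
  qed
  have "isCont w t0" unfolding w_def using t01 by (intro continuous_intros) auto
  have wpos: "w t0 > 0" using r0 w0 by simp
  have "eventually (\<lambda>t. w t0 / L < w t \<and> w t < L * w t0 \<and> \<bar>t\<bar> < 1) (nhds t0)"
  proof (intro eventually_conj)
    have lim: "(w \<longlongrightarrow> w t0) (nhds t0)" using \<open>isCont w t0\<close> by (simp add: isCont_def tendsto_nhds_iff)
    show "eventually (\<lambda>t. w t0 / L < w t) (nhds t0)" using lim
      by (rule order_tendstoD) (use wpos L in \<open>simp add: field_simps\<close>)
    show "eventually (\<lambda>t. w t < L * w t0) (nhds t0)" using lim
      by (rule order_tendstoD) (use wpos L in simp)
    show "eventually (\<lambda>t. \<bar>t\<bar> < 1) (nhds t0)"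
    proof (rule order_tendstoD(2))
      show "((\<lambda>t. \<bar>t\<bar>) \<longlongrightarrow> \<bar>t0\<bar>) (nhds t0)" by (intro tendsto_rabs filterlim_ident)
    qed (use t0 in \<open>simp add: t0_def\<close>)
  qed
  then obtain \<delta>1 where \<delta>1: "\<delta>1 > 0" "\<And>t. \<bar>t - t0\<bar> < \<delta>1 \<Longrightarrow> w t0 / L < w t \<and> w t < L * w t0 \<and> \<bar>t\<bar> < 1"
    unfolding eventually_nhds_metric by (auto simp: dist_real_def)
  define \<eta> where "\<eta> = min (L - 1) (1 - 1 / L)"
  have \<eta>: "\<eta> > 0" "1 + \<eta> \<le> L" "1 - \<eta> \<ge> 1 / L" using L by (auto simp: \<eta>_def)
  define \<delta> where "\<delta> = min (\<delta>1 / 2) (\<eta> / (1 + \<bar>\<kappa>\<bar>))"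
  have \<delta>: "\<delta> > 0" "\<delta> < \<delta>1" "(1 + \<bar>\<kappa>\<bar>) * \<delta> \<le> \<eta>"
  proof -
    show "\<delta> > 0" "\<delta> < \<delta>1" using \<delta>1 \<eta> by (auto simp: \<delta>_def intro!: divide_pos_pos)
    have "(1 + \<bar>\<kappa>\<bar>) * \<delta> \<le> (1 + \<bar>\<kappa>\<bar>) * (\<eta> / (1 + \<bar>\<kappa>\<bar>))" by (intro mult_left_mono) (auto simp: \<delta>_def)
    then show "(1 + \<bar>\<kappa>\<bar>) * \<delta> \<le> \<eta>" by (simp add: nonzero_eq_divide_eq)
  qed
  define U where "U = sphere 0 1 \<inter> cball x0 \<delta>"
  have half: "a = 1 / 2 * (a - b) + 1 / 2 * (a - c)" if "b + c = 0" for a b c :: real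
    using that by (simp add: field_simps)
  \<comment> \<open>Since \<open>x - y\<close> is orthogonal to \<open>x + y\<close>, one may replace \<open>x0\<close> by its difference from the midpoint.\<close>
  have flat: "\<bar>(x - y) \<bullet> x0\<bar> \<le> \<delta> * norm (x - y)" if "x \<in> U" "y \<in> U" for x y
  proof -
    have "x \<bullet> x = 1" "y \<bullet> y = 1" using that by (auto simp: U_def norm_eq_1)
    then have "(x - y) \<bullet> (x + y) = 0" by (simp add: inner_diff_left inner_add_right inner_commute[of y x])
    then have "(x - y) \<bullet> x0 = (x - y) \<bullet> ((1/2) *\<^sub>R (x0 - x) + (1/2) *\<^sub>R (x0 - y))"
      unfolding inner_add_right inner_diff_right inner_scaleR_right by (rule half)
    also have "\<bar>\<dots>\<bar> \<le> norm (x - y) * norm ((1/2) *\<^sub>R (x0 - x) + (1/2) *\<^sub>R (x0 - y))"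
      by (rule Cauchy_Schwarz_ineq2)
    also have "\<dots> \<le> norm (x - y) * \<delta>"
    proof (rule mult_left_mono)
      have "norm ((1/2) *\<^sub>R (x0 - x) + (1/2) *\<^sub>R (x0 - y)) \<le> (1/2) * norm (x0 - x) + (1/2) * norm (x0 - y)"
        using norm_triangle_ineq[of "(1/2) *\<^sub>R (x0 - x)" "(1/2) *\<^sub>R (x0 - y)"] by simp
      then show "norm ((1/2) *\<^sub>R (x0 - x) + (1/2) *\<^sub>R (x0 - y)) \<le> \<delta>"
        using that by (auto simp: U_def dist_norm)
    qed simp
    finally show ?thesis by (simp add: mult.commute)
  qed
  have \<Phi>near: "norm (\<Phi> (x - y) - (x - y)) \<le> \<eta> * norm (x - y)" if "x \<in> U" "y \<in> U" for x y
  proof -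
    have "norm (\<Phi> (x - y) - (x - y)) \<le> (1 + \<bar>\<kappa>\<bar>) * (\<delta> * norm (x - y))"
      using \<Phi>err[of "x - y"] mult_left_mono[OF flat[OF that], of "1 + \<bar>\<kappa>\<bar>"] by auto
    also have "\<dots> = ((1 + \<bar>\<kappa>\<bar>) * \<delta>) * norm (x - y)" by simp
    also have "\<dots> \<le> \<eta> * norm (x - y)" using \<delta>(3) by (intro mult_right_mono) auto
    finally show ?thesis .
  qed
  have bil1: "dist (\<Phi> x) (\<Phi> y) \<le> L * dist x y" if "x \<in> U" "y \<in> U" for x y
  proof -
    have "norm (\<Phi> (x - y)) \<le> norm (x - y) + \<eta> * norm (x - y)"
      using \<Phi>near[OF that] norm_triangle_sub[of "\<Phi> (x - y)" "x - y"] by linarith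
    also have "\<dots> = (1 + \<eta>) * norm (x - y)" by (simp add: algebra_simps)
    also have "\<dots> \<le> L * norm (x - y)" using \<eta> by (intro mult_right_mono) auto
    finally show ?thesis by (simp add: dist_norm \<Phi>diff)
  qed
  have bil2: "dist x y \<le> L * dist (\<Phi> x) (\<Phi> y)" if "x \<in> U" "y \<in> U" for x y
  proof -
    have "norm (x - y) \<le> norm (\<Phi> (x - y)) + \<eta> * norm (x - y)"
      using \<Phi>near[OF that] norm_triangle_sub[of "x - y" "\<Phi> (x - y)"] by (simp add: norm_minus_commute)
    then have "(1 - \<eta>) * norm (x - y) \<le> norm (\<Phi> (x - y))" by (simp add: algebra_simps)
    then have "(1 / L) * norm (x - y) \<le> norm (\<Phi> (x - y))"
      using mult_right_mono[OF \<eta>(3) norm_ge_zero[of "x - y"]] by linarith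
    then show ?thesis using L by (simp add: dist_norm \<Phi>diff field_simps)
  qed
  have inj: "inj_on \<Phi> U"
  proof (rule inj_onI)
    fix x y assume "x \<in> U" "y \<in> U" "\<Phi> x = \<Phi> y"
    then show "x = y" using bil2[of x y] by simp
  qed
  have cU: "compact U" unfolding U_def by (intro compact_Int compact_sphere compact_cball)
  have cont: "continuous_on U \<Phi>" unfolding \<Phi>_def p_def using r0 by (intro continuous_intros) auto
  have Uw: "w t0 \<le> L * w t \<and> w t \<le> L * w t0 \<and> \<bar>t\<bar> < 1" if "x \<in> U" "x \<bullet> \<omega> = t" for x t
  proof -
    have "\<bar>t - t0\<bar> = \<bar>(x - x0) \<bullet> \<omega>\<bar>" using that by (simp add: t0_def inner_diff_left)
    also have "\<dots> \<le> norm (x - x0) * norm \<omega>" by (rule Cauchy_Schwarz_ineq2)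
    also have "\<dots> \<le> \<delta>" using that \<omega> by (auto simp: U_def dist_norm norm_minus_commute)
    finally have "w t0 / L < w t \<and> w t < L * w t0 \<and> \<bar>t\<bar> < 1" using \<delta>1 \<delta> by auto
    then show ?thesis using L by (auto simp: field_simps)
  qed
  show ?thesis
  proof (rule that[OF \<delta>(1)])
    fix E :: "'a set" assume E: "E \<in> sets borel" "E \<subseteq> sphere 0 1 \<inter> cball x0 \<delta>"
    then have EU: "E \<subseteq> U" by (simp add: U_def)
    define F where "F = \<Phi> ` E"
    have F: "F \<in> sets borel" unfolding F_def by (rule borel_image_of_compact_homeomorphism[OF cU cont inj EU E(1)])
    have Fspan: "F \<subseteq> span (insert \<tau> B)"
      unfolding F_def \<Phi>_def using pspan span_mono[of B "insert \<tau> B"]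
      by (auto intro!: span_add span_scale[OF span_base])
    define s where "s r = emeasure (span_lebesgue B) {x. x + r *\<^sub>R \<tau> \<in> F}" for r
    have s[measurable]: "s \<in> borel_measurable borel"
      unfolding s_def by (rule B.span_lebesgue_slices(1)[OF B(3,2) F])
    define h where "h t = s (t / r0)" for t
    have h: "h \<in> borel_measurable borel" unfolding h_def by measurable
    let ?H = "\<lambda>t. hausdorff_outer (DIM('a) - 2) {x\<in>E. x \<bullet> \<omega> = t}"
    \<comment> \<open>On a slice the map \<open>\<Phi>\<close> is a translate of the projection \<open>p\<close>.\<close>
    have hp: "h t = hausdorff_outer (DIM('a) - 2) (p ` {x\<in>E. x \<bullet> \<omega> = t})" for t
    proof -
      have sec: "{x. x + (t / r0) *\<^sub>R \<tau> \<in> F} \<in> sets borel"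
      proof -
        have "(\<lambda>x. x + (t / r0) *\<^sub>R \<tau>) \<in> borel \<rightarrow>\<^sub>M borel" by measurable
        from measurable_sets[OF this F] show ?thesis by (simp add: vimage_def)
      qed
      have eq: "{x. x + (t / r0) *\<^sub>R \<tau> \<in> F} \<inter> span B = p ` {x\<in>E. x \<bullet> \<omega> = t}"
      proof (intro equalityI subsetI)
        fix u assume u: "u \<in> {x. x + (t / r0) *\<^sub>R \<tau> \<in> F} \<inter> span B"
        then obtain x where x: "x \<in> E" "u + (t / r0) *\<^sub>R \<tau> = p x + ((x \<bullet> \<omega>) / r0) *\<^sub>R \<tau>"
          by (auto simp: F_def \<Phi>_def)
        from arg_cong[OF x(2), of "\<lambda>z. z \<bullet> \<tau>"] have "t / r0 = (x \<bullet> \<omega>) / r0"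
          using spanperp[OF pspan] spanperp[of u] u n\<tau> by (simp add: inner_add_left norm_eq_1)
        then have "t = x \<bullet> \<omega>" using r0 by simp
        then show "u \<in> p ` {x\<in>E. x \<bullet> \<omega> = t}" using x by auto
      next
        fix u assume "u \<in> p ` {x\<in>E. x \<bullet> \<omega> = t}"
        then show "u \<in> {x. x + (t / r0) *\<^sub>R \<tau> \<in> F} \<inter> span B"
          using pspan by (auto simp: F_def \<Phi>_def)
      qed
      have "h t = emeasure (span_lebesgue B) ({x. x + (t / r0) *\<^sub>R \<tau> \<in> F} \<inter> span B)"
        unfolding h_def s_def by (rule B.emeasure_span_lebesgue_Int_span[OF sec, symmetric])
      also have "\<dots> = hausdorff_outer (card B) ({x. x + (t / r0) *\<^sub>R \<tau> \<in> F} \<inter> span B)"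
        using sec by (intro B.hausdorff_outer_eq_span_lebesgue[symmetric]) (auto simp: closed_span borel_closed)
      finally show ?thesis by (simp only: eq B(4))
    qed
    have pslice: "dist (p x) (p y) = dist (\<Phi> x) (\<Phi> y)" if "x \<bullet> \<omega> = t" "y \<bullet> \<omega> = t" for x y t
      using that by (simp add: dist_norm \<Phi>_def)
    have Lpow: "L ^ m \<le> c" if "m \<le> DIM('a)" for m
      using power_increasing[OF that, of L] L by simp
    have hH: "h t \<le> ennreal (L ^ (DIM('a) - 2)) * ?H t" "?H t \<le> ennreal (L ^ (DIM('a) - 2)) * h t" for t
    proof -
      have b: "dist (p x) (p y) \<le> L * dist x y" "dist x y \<le> L * dist (p x) (p y)"
        if "x \<in> {x\<in>E. x \<bullet> \<omega> = t}" "y \<in> {x\<in>E. x \<bullet> \<omega> = t}" for x y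
        using that pslice[of x t y] bil1[of x y] bil2[of x y] EU by auto
      have "L > 0" using L by simp
      from hausdorff_outer_bilipschitz_image[OF this b]
      show "h t \<le> ennreal (L ^ (DIM('a) - 2)) * ?H t" "?H t \<le> ennreal (L ^ (DIM('a) - 2)) * h t"
        unfolding hp by blast+
    qed
    \<comment> \<open>Heights that do not occur in \<open>E\<close> carry no mass, so the weight need only be controlled on \<open>E\<close>.\<close>
    have zero: "h t = 0" if "{x\<in>E. x \<bullet> \<omega> = t} = {}" for t
      unfolding hp that by (simp add: hausdorff_outer_empty)
    have FE: "hausdorff_outer (DIM('a) - 1) F \<le> ennreal (L ^ (DIM('a) - 1)) * hausdorff_outer (DIM('a) - 1) E"
      "hausdorff_outer (DIM('a) - 1) E \<le> ennreal (L ^ (DIM('a) - 1)) * hausdorff_outer (DIM('a) - 1) F"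
    proof -
      have b: "dist (\<Phi> x) (\<Phi> y) \<le> L * dist x y" "dist x y \<le> L * dist (\<Phi> x) (\<Phi> y)"
        if "x \<in> E" "y \<in> E" for x y
        using that bil1[of x y] bil2[of x y] EU by auto
      have "L > 0" using L by simp
      from hausdorff_outer_bilipschitz_image[OF this b]
      show "hausdorff_outer (DIM('a) - 1) F \<le> ennreal (L ^ (DIM('a) - 1)) * hausdorff_outer (DIM('a) - 1) E"
        "hausdorff_outer (DIM('a) - 1) E \<le> ennreal (L ^ (DIM('a) - 1)) * hausdorff_outer (DIM('a) - 1) F"
        unfolding F_def by blast+
    qed
    have "hausdorff_outer (DIM('a) - 1) F = emeasure (span_lebesgue (insert \<tau> B)) F"
      using B'.hausdorff_outer_eq_span_lebesgue[OF F Fspan] cB' by simp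
    also have "\<dots> = (\<integral>\<^sup>+r. s r \<partial>lborel)"
      unfolding s_def by (rule B.span_lebesgue_slices(2)[OF B(3,2) F])
    also have "\<dots> = ennreal (1 / r0) * (\<integral>\<^sup>+t. s (0 + (1 / r0) * t) \<partial>lborel)"
      using r0 nn_integral_real_affine[OF s, of "1 / r0" 0] by simp
    also have "\<dots> = (\<integral>\<^sup>+t. ennreal (w t0) * h t \<partial>lborel)"
      using h by (simp add: h_def w0 nn_integral_cmult)
    finally have HF: "hausdorff_outer (DIM('a) - 1) F = (\<integral>\<^sup>+t. ennreal (w t0) * h t \<partial>lborel)" .
    let ?I = "\<integral>\<^sup>+t\<in>{-1<..<1}. ennreal (w t) * h t \<partial>lborel"
    have wm[measurable]: "w \<in> borel_measurable borel" unfolding w_def by measurable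
    have le1: "(\<integral>\<^sup>+t. ennreal (w t0) * h t \<partial>lborel) \<le> ennreal L * ?I"
    proof -
      have "(\<integral>\<^sup>+t. ennreal (w t0) * h t \<partial>lborel) \<le> (\<integral>\<^sup>+t. ennreal L * (ennreal (w t) * h t * indicator {-1<..<1} t) \<partial>lborel)"
      proof (rule nn_integral_mono)
        fix t :: real
        show "ennreal (w t0) * h t \<le> ennreal L * (ennreal (w t) * h t * indicator {-1<..<1} t)"
        proof (cases "{x\<in>E. x \<bullet> \<omega> = t} = {}")
          case True
          then show ?thesis by (simp add: zero)
        next
          case False
          then obtain x where "x \<in> U" "x \<bullet> \<omega> = t" using EU by auto
          from Uw[OF this] have "ennreal (w t0) \<le> ennreal L * ennreal (w t)" "t \<in> {-1<..<1}"
            using L by (auto simp: ennreal_leI simp flip: ennreal_mult')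
          then show ?thesis using mult_right_mono[of "ennreal (w t0)" "ennreal L * ennreal (w t)" "h t"] by (simp add: mult.assoc)
        qed
      qed
      also have "\<dots> = ennreal L * ?I" by (rule nn_integral_cmult) (use h wm in simp)
      finally show ?thesis .
    qed
    have le2: "?I \<le> ennreal L * (\<integral>\<^sup>+t. ennreal (w t0) * h t \<partial>lborel)"
    proof -
      have "?I \<le> (\<integral>\<^sup>+t. ennreal L * (ennreal (w t0) * h t) \<partial>lborel)"
      proof (rule nn_integral_mono)
        fix t :: real
        show "ennreal (w t) * h t * indicator {-1<..<1} t \<le> ennreal L * (ennreal (w t0) * h t)"
        proof (cases "{x\<in>E. x \<bullet> \<omega> = t} = {}")
          case True
          then show ?thesis by (simp add: zero)
        next
          case False
          then obtain x where "x \<in> U" "x \<bullet> \<omega> = t" using EU by auto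
          from Uw[OF this] have "ennreal (w t) \<le> ennreal L * ennreal (w t0)" "t \<in> {-1<..<1}"
            using L by (auto simp: ennreal_leI simp flip: ennreal_mult')
          then show ?thesis using mult_right_mono[of "ennreal (w t)" "ennreal L * ennreal (w t0)" "h t"] by (simp add: mult.assoc)
        qed
      qed
      also have "\<dots> = ennreal L * (\<integral>\<^sup>+t. ennreal (w t0) * h t \<partial>lborel)" by (rule nn_integral_cmult) (use h wm in simp)
      finally show ?thesis .
    qed
    have Ln: "ennreal (L ^ (DIM('a) - 1)) * (ennreal L * z) = ennreal c * z" for z
    proof -
      have "L ^ (DIM('a) - 1) * L = c" using L(2) n by (cases "DIM('a)") (auto simp: mult.commute)
      then show ?thesis using L by (simp flip: mult.assoc ennreal_mult')
    qed
    show "\<exists>h. slicing_witness c \<omega> E h"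
      unfolding slicing_witness_def w_def[symmetric]
    proof (intro exI[of _ h] conjI allI)
      show "h \<in> borel_measurable borel" by (rule h)
      show "h t \<le> ennreal c * ?H t" "?H t \<le> ennreal c * h t" for t
        using hH[of t] Lpow[of "DIM('a) - 2"] by (meson ennreal_leI mult_right_mono order_trans zero_le diff_le_self)+
      have "hausdorff_outer (DIM('a) - 1) E \<le> ennreal (L ^ (DIM('a) - 1)) * (ennreal L * ?I)"
        using FE(2) le1 unfolding HF by (meson mult_left_mono order_trans zero_le)
      then show "hausdorff_outer (DIM('a) - 1) E \<le> ennreal c * ?I" by (simp only: Ln)
      have "?I \<le> ennreal L * (ennreal (L ^ (DIM('a) - 1)) * hausdorff_outer (DIM('a) - 1) E)"
        using FE(1) le2 unfolding HF by (meson mult_left_mono order_trans zero_le)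
      then show "?I \<le> ennreal c * hausdorff_outer (DIM('a) - 1) E"
        by (simp only: mult.left_commute[of "ennreal L"] Ln)
    qed
  qed
qed

section \<open>The slicing formula for surface measure\<close>

lemma ennreal_le_of_le_times_gt_1:
  fixes a b :: ennreal
  assumes "\<And>c::real. c > 1 \<Longrightarrow> a \<le> ennreal c * b"
  shows "a \<le> b"
proof (cases b)
  case (real r)
  have "(\<lambda>n. ennreal ((1 + inverse (real (Suc n))) * r)) \<longlonglongrightarrow> ennreal ((1 + 0) * r)"
    by (intro tendsto_ennrealI tendsto_mult tendsto_add tendsto_const LIMSEQ_inverse_real_of_nat)
  then have "a \<le> ennreal ((1 + 0) * r)"
  proof (rule LIMSEQ_le_const)
    have "a \<le> ennreal ((1 + inverse (real (Suc n))) * r)" for n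
      using assms[of "1 + inverse (real (Suc n))"] real by (simp add: ennreal_mult'')
    then show "\<exists>N. \<forall>n\<ge>N. a \<le> ennreal ((1 + inverse (real (Suc n))) * r)" by blast
  qed
  then show ?thesis using real by simp
qed simp

text \<open>By the Lindelof property countably many of the neighbourhoods from the local comparison cover the sphere
  without the poles; disjoint pieces of \<open>E\<close> inside them are added up.\<close>

lemma sphere_slicing_sandwich:
  fixes \<omega> :: "'a::euclidean_space"
  assumes n: "DIM('a) \<ge> 2" and \<omega>: "norm \<omega> = 1" and c: "c > 1"
    and E: "E \<in> sets borel" "E \<subseteq> sphere 0 1 - {\<omega>, - \<omega>}"
  shows "\<exists>h. slicing_witness c \<omega> E h"
proof -
  let ?P = "sphere 0 1 - {\<omega>, - \<omega>}"
  have loc: "\<exists>\<delta>>0. \<forall>E. E \<in> sets borel \<longrightarrow> E \<subseteq> sphere 0 1 \<inter> cball x \<delta> \<longrightarrow> (\<exists>h. slicing_witness c \<omega> E h)" if "x \<in> ?P" for x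
  proof -
    have nx: "norm x = 1" using that by simp
    \<comment> \<open>Equality in the Cauchy-Schwarz inequality occurs only at the poles.\<close>
    have "\<bar>x \<bullet> \<omega>\<bar> \<noteq> norm x * norm \<omega>"
    proof
      assume "\<bar>x \<bullet> \<omega>\<bar> = norm x * norm \<omega>"
      then have "norm x *\<^sub>R \<omega> = norm \<omega> *\<^sub>R x \<or> norm x *\<^sub>R \<omega> = - norm \<omega> *\<^sub>R x" by (simp add: norm_cauchy_schwarz_abs_eq)
      then show False using that nx \<omega> by auto
    qed
    then have "\<bar>x \<bullet> \<omega>\<bar> < 1" using Cauchy_Schwarz_ineq2[of x \<omega>] nx \<omega> by simp
    show ?thesis
    proof (rule sphere_slicing_local[OF n \<omega> nx \<open>\<bar>x \<bullet> \<omega>\<bar> < 1\<close> c])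
      fix \<delta> :: real
      assume d: "\<delta> > 0" and "\<And>E. E \<in> sets borel \<Longrightarrow> E \<subseteq> sphere 0 1 \<inter> cball x \<delta> \<Longrightarrow> \<exists>h. slicing_witness c \<omega> E h"
      with d show ?thesis by blast
    qed
  qed
  define ball_ok where "ball_ok x \<delta> \<longleftrightarrow> \<delta> > 0 \<and> (\<forall>E. E \<in> sets borel \<longrightarrow> E \<subseteq> sphere 0 1 \<inter> cball x \<delta> \<longrightarrow> (\<exists>h. slicing_witness c \<omega> E h))" for x \<delta>
  have "\<forall>x\<in>?P. \<exists>\<delta>. ball_ok x \<delta>" using loc unfolding ball_ok_def by (intro ballI)
  then have "\<exists>\<delta>. \<forall>x\<in>?P. ball_ok x (\<delta> x)" by (rule bchoice)
  then obtain \<delta> where "\<forall>x\<in>?P. ball_ok x (\<delta> x)" by (rule exE)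
  then have \<delta>: "\<And>x. x \<in> ?P \<Longrightarrow> \<delta> x > 0"
    "\<And>x E. x \<in> ?P \<Longrightarrow> E \<in> sets borel \<Longrightarrow> E \<subseteq> sphere 0 1 \<inter> cball x (\<delta> x) \<Longrightarrow> \<exists>h. slicing_witness c \<omega> E h"
    unfolding ball_ok_def by simp_all
  let ?B = "(\<lambda>x. ball x (\<delta> x)) ` ?P"
  obtain \<B> where \<B>: "\<B> \<subseteq> ?B" "countable \<B>" "\<Union>\<B> = \<Union>?B"
  proof (rule Lindelof[of ?B])
    show "open S" if "S \<in> ?B" for S using that by auto
  qed (rule that)
  define V where "V = from_nat_into (insert {} \<B>)"
  have V: "range V = insert {} \<B>" unfolding V_def using \<B>(2) by (intro range_from_nat_into) auto
  have cov: "E \<subseteq> (\<Union>i. V i)"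
  proof
    fix x assume "x \<in> E"
    then have "x \<in> ?P" using E by blast
    then have "x \<in> \<Union>?B" using \<delta>(1)[of x] by (intro UnionI[of "ball x (\<delta> x)"]) auto
    then show "x \<in> (\<Union>i. V i)" using V \<B>(3) by auto
  qed
  define D where "D i = E \<inter> disjointed V i" for i
  have Vo: "V i \<in> sets borel" for i
  proof -
    have "V i \<in> insert {} \<B>" using V by blast
    then show ?thesis using \<B>(1) by auto
  qed
  have D: "D i \<in> sets borel" "disjoint_family D" "(\<Union>i. D i) = E" for i
  proof -
    have "disjointed V i \<in> sets borel" unfolding disjointed_def using Vo by (intro sets.Diff sets.finite_UN) auto
    then show "D i \<in> sets borel" unfolding D_def using E by auto
    show "disjoint_family D" unfolding D_def using disjoint_family_disjointed[of V] by (auto simp: disjoint_family_on_def)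
    show "(\<Union>i. D i) = E" unfolding D_def using cov UN_disjointed_eq[of V] by auto
  qed
  have "\<exists>h. slicing_witness c \<omega> (D i) h" for i
  proof (cases "V i = {}")
    case True
    then have "D i = {}" using disjointed_subset[of V i] by (auto simp: D_def)
    then show ?thesis by (intro exI[of _ "\<lambda>_. 0"]) (simp add: slicing_witness_def hausdorff_outer_empty)
  next
    case False
    then have "V i \<in> ?B" using V \<B>(1) by blast
    then obtain x where x: "x \<in> ?P" "V i = ball x (\<delta> x)" by blast
    have "D i \<subseteq> sphere 0 1 \<inter> cball x (\<delta> x)" using E(2) disjointed_subset[of V i] x(2) ball_subset_cball by (auto simp: D_def)
    from \<delta>(2)[OF x(1) D(1) this] show ?thesis .
  qed
  then have "\<exists>h. \<forall>i. slicing_witness c \<omega> (D i) (h i)" by (intro choice allI)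
  then obtain h where "\<And>i. slicing_witness c \<omega> (D i) (h i)" by blast
  note h = this[unfolded slicing_witness_def]
  have hm[measurable]: "h i \<in> borel_measurable borel" for i using h by blast
  have DS: "{x \<in> D i. x \<bullet> \<omega> = t} \<in> sets borel" for i t
  proof -
    have "{x \<in> D i. x \<bullet> \<omega> = t} = D i \<inter> {x. x \<bullet> \<omega> = t}" by auto
    moreover have "closed {x. x \<bullet> \<omega> = t}" by (intro closed_Collect_eq continuous_intros)
    ultimately show ?thesis using D(1) by auto
  qed
  have sumE: "hausdorff_outer (DIM('a) - 1) E = (\<Sum>i. hausdorff_outer (DIM('a) - 1) (D i))"
  proof -
    have "(\<Sum>i. emeasure (hausdorff_measure (DIM('a) - 1)) (D i)) = emeasure (hausdorff_measure (DIM('a) - 1)) (\<Union>i. D i)"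
      using D by (intro suminf_emeasure) auto
    then show ?thesis using D E by (simp add: emeasure_hausdorff_measure)
  qed
  have sumS: "hausdorff_outer (DIM('a) - 2) {x\<in>E. x \<bullet> \<omega> = t} = (\<Sum>i. hausdorff_outer (DIM('a) - 2) {x\<in>D i. x \<bullet> \<omega> = t})" for t
  proof -
    have "(\<Sum>i. emeasure (hausdorff_measure (DIM('a) - 2)) {x\<in>D i. x \<bullet> \<omega> = t}) = emeasure (hausdorff_measure (DIM('a) - 2)) (\<Union>i. {x\<in>D i. x \<bullet> \<omega> = t})"
    proof (rule suminf_emeasure)
      show "disjoint_family (\<lambda>i. {x\<in>D i. x \<bullet> \<omega> = t})" using D(2) by (auto simp: disjoint_family_on_def)
    qed (use DS in auto)
    moreover have "(\<Union>i. {x\<in>D i. x \<bullet> \<omega> = t}) = {x\<in>E. x \<bullet> \<omega> = t}" using D(3) by auto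
    moreover have "(\<Union>i. {x\<in>D i. x \<bullet> \<omega> = t}) \<in> sets borel" using DS by auto
    ultimately show ?thesis using DS by (simp add: emeasure_hausdorff_measure)
  qed
  have sumI: "(\<integral>\<^sup>+t\<in>{-1<..<1}. ennreal (slice_weight t) * (\<Sum>i. h i t) \<partial>lborel)
     = (\<Sum>i. \<integral>\<^sup>+t\<in>{-1<..<1}. ennreal (slice_weight t) * h i t \<partial>lborel)"
  proof -
    have "(\<integral>\<^sup>+t\<in>{-1<..<1}. ennreal (slice_weight t) * (\<Sum>i. h i t) \<partial>lborel)
      = (\<integral>\<^sup>+t. (\<Sum>i. ennreal (slice_weight t) * h i t * indicator {-1<..<1} t) \<partial>lborel)" by simp
    also have "\<dots> = (\<Sum>i. \<integral>\<^sup>+t\<in>{-1<..<1}. ennreal (slice_weight t) * h i t \<partial>lborel)"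
      by (rule nn_integral_suminf) simp
    finally show ?thesis .
  qed
  have sum_le: "(\<Sum>i. a i) \<le> ennreal c * (\<Sum>i. b i)" if "\<And>i. a i \<le> ennreal c * b i" for a b :: "nat \<Rightarrow> ennreal"
  proof -
    have "(\<Sum>i. a i) \<le> (\<Sum>i. ennreal c * b i)" using that by (intro suminf_le) auto
    then show ?thesis by simp
  qed
  show ?thesis
    unfolding slicing_witness_def
  proof (intro exI[of _ "\<lambda>t. \<Sum>i. h i t"] conjI allI)
    show "(\<lambda>t. \<Sum>i. h i t) \<in> borel_measurable borel" by measurable
    show "(\<Sum>i. h i t) \<le> ennreal c * hausdorff_outer (DIM('a) - 2) {x\<in>E. x \<bullet> \<omega> = t}" for t
      unfolding sumS using h by (intro sum_le) blast
    show "hausdorff_outer (DIM('a) - 2) {x\<in>E. x \<bullet> \<omega> = t} \<le> ennreal c * (\<Sum>i. h i t)" for t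
      unfolding sumS using h by (intro sum_le) blast
    show "hausdorff_outer (DIM('a) - 1) E \<le> ennreal c * (\<integral>\<^sup>+t\<in>{-1<..<1}. ennreal (slice_weight t) * (\<Sum>i. h i t) \<partial>lborel)"
      unfolding sumE sumI using h by (intro sum_le) blast
    show "(\<integral>\<^sup>+t\<in>{-1<..<1}. ennreal (slice_weight t) * (\<Sum>i. h i t) \<partial>lborel) \<le> ennreal c * hausdorff_outer (DIM('a) - 1) E"
      unfolding sumE sumI using h by (intro sum_le) blast
  qed
qed

text \<open>The slice measures are an infimum of measurable functions \<open>c i * h i\<close>, because \<open>h i\<close> is within a factor
  \<open>c i\<close> of them and \<open>c i\<close> tends to 1. Once they are known to be measurable, the two sides of the formula agree up to every
  factor greater than 1.\<close>

lemma sphere_slicing_off_poles: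
  fixes \<omega> :: "'a::euclidean_space"
  assumes n: "DIM('a) \<ge> 2" and \<omega>: "norm \<omega> = 1"
    and E: "E \<in> sets borel" "E \<subseteq> sphere 0 1 - {\<omega>, - \<omega>}"
  shows "(\<lambda>t. hausdorff_outer (DIM('a) - 2) {x\<in>E. x \<bullet> \<omega> = t}) \<in> borel_measurable borel" (is "?G \<in> _")
    and "hausdorff_outer (DIM('a) - 1) E
      = (\<integral>\<^sup>+t\<in>{-1<..<1}. ennreal (slice_weight t) * hausdorff_outer (DIM('a) - 2) {x\<in>E. x \<bullet> \<omega> = t} \<partial>lborel)"
proof -
  let ?I = "\<lambda>h. \<integral>\<^sup>+t\<in>{-1<..<1}. ennreal (slice_weight t) * h t \<partial>lborel"
  let ?m = "hausdorff_outer (DIM('a) - 1) E"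
  define c where "c i = 1 + inverse (real (Suc i))" for i
  have c1: "c i > 1" for i by (simp add: c_def)
  have "\<exists>h::nat \<Rightarrow> real \<Rightarrow> ennreal. \<forall>i. h i \<in> borel_measurable borel \<and> (\<forall>t. h i t \<le> ennreal (c i) * ?G t \<and> ?G t \<le> ennreal (c i) * h i t)"
    using sphere_slicing_sandwich[OF n \<omega> c1 E, unfolded slicing_witness_def] by (intro choice) blast
  then obtain h :: "nat \<Rightarrow> real \<Rightarrow> ennreal" where h: "\<And>i. h i \<in> borel_measurable borel" "\<And>i t. h i t \<le> ennreal (c i) * ?G t" "\<And>i t. ?G t \<le> ennreal (c i) * h i t"
    by blast
  have "?G t = (INF i. ennreal (c i) * h i t)" for t
  proof (rule antisym)
    show "?G t \<le> (INF i. ennreal (c i) * h i t)" using h by (intro INF_greatest)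
    show "(INF i. ennreal (c i) * h i t) \<le> ?G t"
    proof (rule ennreal_le_of_le_times_gt_1)
      fix d :: real assume d: "d > 1"
      obtain i where i: "inverse (real (Suc i)) < sqrt d - 1" using reals_Archimedean[of "sqrt d - 1"] d by auto
      then have "c i \<le> sqrt d" by (simp add: c_def)
      then have "c i * c i \<le> d" using c1[of i] d mult_mono[of "c i" "sqrt d" "c i" "sqrt d"] by simp
      then have cd: "ennreal (c i) * ennreal (c i) \<le> ennreal d" using c1[of i] by (simp add: ennreal_leI flip: ennreal_mult')
      have "(INF i. ennreal (c i) * h i t) \<le> ennreal (c i) * h i t" by (rule INF_lower) simp
      also have "\<dots> \<le> ennreal (c i) * (ennreal (c i) * ?G t)" using h by (intro mult_left_mono) auto
      also have "\<dots> \<le> ennreal d * ?G t" using cd by (simp add: mult_right_mono flip: mult.assoc)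
      finally show "(INF i. ennreal (c i) * h i t) \<le> ennreal d * ?G t" .
    qed
  qed
  then show Gm: "?G \<in> borel_measurable borel" using h(1) by (simp add: borel_measurable_INF)
  have IM: "?I h \<le> ennreal d * ?I k" if "\<And>t. h t \<le> ennreal d * k t" "k \<in> borel_measurable borel" "d \<ge> 0" for h k d
  proof -
    have "?I h \<le> (\<integral>\<^sup>+t. ennreal d * (ennreal (slice_weight t) * k t * indicator {-1<..<1} t) \<partial>lborel)"
    proof (rule nn_integral_mono)
      fix t
      have "ennreal (slice_weight t) * h t * indicator {-1<..<1} t \<le> ennreal (slice_weight t) * (ennreal d * k t) * indicator {-1<..<1} t"
        by (intro mult_right_mono mult_left_mono that(1)) auto
      then show "ennreal (slice_weight t) * h t * indicator {-1<..<1} t \<le> ennreal d * (ennreal (slice_weight t) * k t * indicator {-1<..<1} t)"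
        by (simp only: mult_ac)
    qed
    also have "\<dots> = ennreal d * ?I k" by (rule nn_integral_cmult) (use that in simp)
    finally show ?thesis .
  qed
  show "?m = ?I ?G"
  proof (rule antisym; rule ennreal_le_of_le_times_gt_1)
    fix d :: real assume d: "d > 1"
    \<comment> \<open>The factor is used twice: once against \<open>h\<close> and once against the surface measure.\<close>
    define c where "c = sqrt d"
    have c: "c > 1" "c * c = d" using d by (auto simp: c_def)
    have cc: "ennreal c * (ennreal c * z) = ennreal d * z" for z
      using c by (simp add: ennreal_mult'[symmetric] mult.assoc[symmetric])
    obtain h :: "real \<Rightarrow> ennreal" where h: "h \<in> borel_measurable borel" "\<And>t. h t \<le> ennreal c * ?G t" "\<And>t. ?G t \<le> ennreal c * h t"
      "?m \<le> ennreal c * ?I h" "?I h \<le> ennreal c * ?m"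
      using sphere_slicing_sandwich[OF n \<omega> c(1) E, unfolded slicing_witness_def] by blast
    have "?m \<le> ennreal c * (ennreal c * ?I ?G)"
      using h(4) IM[of h c ?G] h(2) Gm c by (meson less_imp_le mult_left_mono order_trans zero_le zero_le_one)
    then show "?m \<le> ennreal d * ?I ?G" by (simp only: cc)
    have "?I ?G \<le> ennreal c * (ennreal c * ?m)"
      using h(5) IM[of ?G c h] h(1,3) c by (meson less_imp_le mult_left_mono order_trans zero_le zero_le_one)
    then show "?I ?G \<le> ennreal d * ?m" by (simp only: cc)
  qed
qed

lemma sets_surface_measure: "sets (surface_measure :: 'a::euclidean_space measure) = sets (restrict_space borel (sphere 0 1))"
  unfolding surface_measure_def by (rule sets_restrict_space_cong) simp

lemma sets_slice_measure: "sets (slice_measure \<omega> t) = sets (restrict_space borel {x \<in> sphere 0 1. x \<bullet> \<omega> = t})"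
  unfolding slice_measure_def by (simp add: sets_restrict_space)

lemma closed_slice:
  fixes \<omega> :: "'a::euclidean_space"
  shows "closed {x \<in> sphere 0 (1::real). x \<bullet> \<omega> = t}"
proof -
  have "closed {x. x \<bullet> \<omega> = t}" by (intro closed_Collect_eq continuous_intros)
  moreover have "{x \<in> sphere 0 (1::real). x \<bullet> \<omega> = t} = sphere 0 1 \<inter> {x. x \<bullet> \<omega> = t}" by auto
  ultimately show ?thesis by (simp add: closed_Int)
qed

lemma nn_integral_surface_measure_indicator:
  fixes A :: "'a::euclidean_space set"
  assumes "A \<in> sets borel"
  shows "(\<integral>\<^sup>+x. indicator A x \<partial>surface_measure) = hausdorff_outer (DIM('a) - 1) (A \<inter> sphere 0 1)"
proof -
  have "(\<integral>\<^sup>+x. indicator A x \<partial>surface_measure) = (\<integral>\<^sup>+x. indicator A x * indicator (sphere 0 1) x \<partial>hausdorff_measure (DIM('a) - 1))"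
    unfolding surface_measure_def by (intro nn_integral_restrict_space) simp
  also have "\<dots> = emeasure (hausdorff_measure (DIM('a) - 1)) (A \<inter> sphere 0 1)"
    using assms by (simp add: indicator_inter_arith[symmetric])
  finally show ?thesis using assms by (simp add: emeasure_hausdorff_measure)
qed

lemma nn_integral_slice_measure:
  fixes f :: "'a::euclidean_space \<Rightarrow> ennreal"
  assumes "f \<in> borel_measurable borel"
  shows "(\<integral>\<^sup>+x. f x \<partial>slice_measure \<omega> t) = ennreal (slice_weight t) *
    (\<integral>\<^sup>+x. f x * indicator {x \<in> sphere 0 1. x \<bullet> \<omega> = t} x \<partial>hausdorff_measure (DIM('a) - 2))"
proof -
  let ?R = "restrict_space (hausdorff_measure (DIM('a) - 2)) {x \<in> sphere 0 1. x \<bullet> \<omega> = t}"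
  have f: "f \<in> borel_measurable (hausdorff_measure (DIM('a) - 2))" using assms by simp
  have "(\<integral>\<^sup>+x. f x \<partial>slice_measure \<omega> t) = ennreal (slice_weight t) * (\<integral>\<^sup>+x. f x \<partial>?R)"
    unfolding slice_measure_def using f by (intro nn_integral_scale_measure measurable_restrict_space1)
  also have "(\<integral>\<^sup>+x. f x \<partial>?R) = (\<integral>\<^sup>+x. f x * indicator {x \<in> sphere 0 1. x \<bullet> \<omega> = t} x \<partial>hausdorff_measure (DIM('a) - 2))"
    by (rule nn_integral_restrict_space) (use borel_closed[OF closed_slice[of \<omega> t]] in simp)
  finally show ?thesis .
qed

lemma nn_integral_slice_measure_indicator:
  fixes A :: "'a::euclidean_space set"
  assumes "A \<in> sets borel"
  shows "(\<integral>\<^sup>+x. indicator A x \<partial>slice_measure \<omega> t) = ennreal (slice_weight t) *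
    hausdorff_outer (DIM('a) - 2) {x \<in> A \<inter> sphere 0 1. x \<bullet> \<omega> = t}"
proof -
  have eq: "A \<inter> {x \<in> sphere 0 1. x \<bullet> \<omega> = t} = {x \<in> A \<inter> sphere 0 1. x \<bullet> \<omega> = t}" by auto
  have b: "A \<inter> {x \<in> sphere 0 1. x \<bullet> \<omega> = t} \<in> sets borel"
    using assms borel_closed[OF closed_slice[of \<omega> t]] by (rule sets.Int)
  have "(\<integral>\<^sup>+x. indicator A x \<partial>slice_measure \<omega> t) = ennreal (slice_weight t) *
      emeasure (hausdorff_measure (DIM('a) - 2)) (A \<inter> {x \<in> sphere 0 1. x \<bullet> \<omega> = t})"
    using assms b by (subst nn_integral_slice_measure) (simp_all only: indicator_inter_arith[symmetric] nn_integral_indicator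
      sets_hausdorff_measure borel_measurable_indicator)
  then show ?thesis using b by (simp only: emeasure_hausdorff_measure eq)
qed

text \<open>The poles are null sets because Hausdorff measure of positive dimension does not charge points, and they do not
  belong to slices at heights in \<open>{-1<..<1}\<close>.\<close>

lemma sphere_slicing_indicator:
  fixes \<omega> :: "'a::euclidean_space"
  assumes n: "DIM('a) \<ge> 2" and \<omega>: "norm \<omega> = 1" and A: "A \<in> sets borel"
  shows "(\<lambda>t. (\<integral>\<^sup>+x. indicator A x \<partial>slice_measure \<omega> t) * indicator {-1<..<1} t) \<in> borel_measurable borel"
    and "(\<integral>\<^sup>+x. indicator A x \<partial>surface_measure) = (\<integral>\<^sup>+t\<in>{-1<..<1}. (\<integral>\<^sup>+x. indicator A x \<partial>slice_measure \<omega> t) \<partial>lborel)"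
proof -
  define E where "E = A \<inter> sphere 0 1 - {\<omega>, - \<omega>}"
  have E: "E \<in> sets borel" "E \<subseteq> sphere 0 1 - {\<omega>, - \<omega>}" using A by (auto simp: E_def)
  have "\<omega> \<bullet> \<omega> = 1" using \<omega> by (simp add: norm_eq_1)
  then have "{x \<in> A \<inter> sphere 0 1. x \<bullet> \<omega> = t} = {x\<in>E. x \<bullet> \<omega> = t}" if "t \<in> {-1<..<1}" for t
    using that by (auto simp: E_def)
  then have eq: "(\<integral>\<^sup>+x. indicator A x \<partial>slice_measure \<omega> t) * indicator {-1<..<1} t
     = ennreal (slice_weight t) * hausdorff_outer (DIM('a) - 2) {x\<in>E. x \<bullet> \<omega> = t} * indicator {-1<..<1} t" for t
  proof (cases "t \<in> {-1<..<1}")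
    case True
    then show ?thesis using \<open>t \<in> {-1<..<1} \<Longrightarrow> {x \<in> A \<inter> sphere 0 1. x \<bullet> \<omega> = t} = {x\<in>E. x \<bullet> \<omega> = t}\<close>
      by (simp only: nn_integral_slice_measure_indicator[OF A])
  qed simp
  note S = sphere_slicing_off_poles[OF n \<omega> E]
  show "(\<lambda>t. (\<integral>\<^sup>+x. indicator A x \<partial>slice_measure \<omega> t) * indicator {-1<..<1} t) \<in> borel_measurable borel"
    unfolding eq using S(1) by simp
  have pole: "hausdorff_outer (DIM('a) - 1) {\<omega>, - \<omega>} = 0"
  proof -
    have "emeasure (hausdorff_measure (DIM('a) - 1)) ({\<omega>} \<union> {- \<omega>}) \<le> emeasure (hausdorff_measure (DIM('a) - 1)) {\<omega>} + emeasure (hausdorff_measure (DIM('a) - 1)) {- \<omega>}"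
      by (rule emeasure_subadditive) simp_all
    then show ?thesis using n by (simp add: emeasure_hausdorff_measure hausdorff_outer_singleton insert_commute)
  qed
  have "hausdorff_outer (DIM('a) - 1) (A \<inter> sphere 0 1) = hausdorff_outer (DIM('a) - 1) E"
  proof (rule antisym)
    have "emeasure (hausdorff_measure (DIM('a) - 1)) (E \<union> {\<omega>, - \<omega>}) \<le> emeasure (hausdorff_measure (DIM('a) - 1)) E + emeasure (hausdorff_measure (DIM('a) - 1)) {\<omega>, - \<omega>}"
      using E by (intro emeasure_subadditive) auto
    then have "hausdorff_outer (DIM('a) - 1) (E \<union> {\<omega>, - \<omega>}) \<le> hausdorff_outer (DIM('a) - 1) E"
      using E pole by (simp add: emeasure_hausdorff_measure)
    then show "hausdorff_outer (DIM('a) - 1) (A \<inter> sphere 0 1) \<le> hausdorff_outer (DIM('a) - 1) E"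
      by (rule order_trans[rotated]) (auto intro!: hausdorff_outer_mono simp: E_def)
  qed (auto intro!: hausdorff_outer_mono simp: E_def)
  then show "(\<integral>\<^sup>+x. indicator A x \<partial>surface_measure) = (\<integral>\<^sup>+t\<in>{-1<..<1}. (\<integral>\<^sup>+x. indicator A x \<partial>slice_measure \<omega> t) \<partial>lborel)"
    unfolding eq S(2)[symmetric] by (simp add: nn_integral_surface_measure_indicator[OF A])
qed

text \<open>Measurability in \<open>t\<close> is proved along with the formula, since the induction over \<open>f\<close> needs both.\<close>

theorem sphere_slicing:
  fixes \<omega> :: "'a::euclidean_space" and f :: "'a \<Rightarrow> ennreal"
  assumes n: "DIM('a) \<ge> 2" and \<omega>: "norm \<omega> = 1" and f: "f \<in> borel_measurable borel"
  shows "(\<lambda>t. (\<integral>\<^sup>+x. f x \<partial>slice_measure \<omega> t) * indicator {-1<..<1} t) \<in> borel_measurable borel \<and>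
    (\<integral>\<^sup>+x. f x \<partial>surface_measure) = (\<integral>\<^sup>+t\<in>{-1<..<1}. (\<integral>\<^sup>+x. f x \<partial>slice_measure \<omega> t) \<partial>lborel)"
  using f
proof (induction f rule: borel_measurable_induct)
  case (cong f g)
  then have "f = g" by auto
  then show ?case using cong by simp
next
  case (set A)
  then show ?case using sphere_slicing_indicator[OF n \<omega>, of A] by simp
next
  case (mult u c)
  have m: "u \<in> borel_measurable surface_measure" "u \<in> borel_measurable (slice_measure \<omega> t)" for t
    using mult(2) by (auto simp: measurable_cong_sets[OF sets_surface_measure refl] measurable_cong_sets[OF sets_slice_measure refl] measurable_restrict_space1)
  have IH[measurable]: "(\<lambda>t. (\<integral>\<^sup>+x. u x \<partial>slice_measure \<omega> t) * indicator {-1<..<1} t) \<in> borel_measurable borel"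
    using mult by blast
  have "(\<lambda>t. c * ((\<integral>\<^sup>+x. u x \<partial>slice_measure \<omega> t) * indicator {-1<..<1} t)) \<in> borel_measurable borel"
    by measurable
  then show ?case using mult m by (simp add: nn_integral_cmult mult.assoc)
next
  case (add u v)
  have m: "u \<in> borel_measurable surface_measure" "u \<in> borel_measurable (slice_measure \<omega> t)"
     "v \<in> borel_measurable surface_measure" "v \<in> borel_measurable (slice_measure \<omega> t)" for t
    using add(1,3) by (auto simp: measurable_cong_sets[OF sets_surface_measure refl] measurable_cong_sets[OF sets_slice_measure refl] measurable_restrict_space1)
  have IH[measurable]: "(\<lambda>t. (\<integral>\<^sup>+x. u x \<partial>slice_measure \<omega> t) * indicator {-1<..<1} t) \<in> borel_measurable borel"
    "(\<lambda>t. (\<integral>\<^sup>+x. v x \<partial>slice_measure \<omega> t) * indicator {-1<..<1} t) \<in> borel_measurable borel"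
    using add by blast+
  have "(\<lambda>t. (\<integral>\<^sup>+x. v x \<partial>slice_measure \<omega> t) * indicator {-1<..<1} t +
     (\<integral>\<^sup>+x. u x \<partial>slice_measure \<omega> t) * indicator {-1<..<1} t) \<in> borel_measurable borel"
    by measurable
  then show ?case using add m by (simp add: nn_integral_add distrib_right)
next
  case (seq U)
  have inc: "incseq U" and fU: "f = (SUP i. U i)"
    and IH: "\<And>i. (\<lambda>t. (\<integral>\<^sup>+x. U i x \<partial>slice_measure \<omega> t) * indicator {-1<..<1} t) \<in> borel_measurable borel"
      "\<And>i. (\<integral>\<^sup>+x. U i x \<partial>surface_measure) = (\<integral>\<^sup>+t\<in>{-1<..<1}. (\<integral>\<^sup>+x. U i x \<partial>slice_measure \<omega> t) \<partial>lborel)"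
    using seq by blast+
  have m: "U i \<in> borel_measurable surface_measure" "U i \<in> borel_measurable (slice_measure \<omega> t)" for i t
    using seq(1) by (auto simp: measurable_cong_sets[OF sets_surface_measure refl] measurable_cong_sets[OF sets_slice_measure refl] measurable_restrict_space1)
  have fx: "f x = (SUP i. U i x)" for x unfolding fU by (simp add: image_image)
  have s: "(\<integral>\<^sup>+x. f x \<partial>slice_measure \<omega> t) * indicator {-1<..<1} t
    = (SUP i. (\<integral>\<^sup>+x. U i x \<partial>slice_measure \<omega> t) * indicator {-1<..<1} t)" for t
    unfolding fx using m inc by (simp add: nn_integral_monotone_convergence_SUP SUP_mult_right_ennreal)
  have "(\<integral>\<^sup>+x. f x \<partial>surface_measure) = (SUP i. \<integral>\<^sup>+x. U i x \<partial>surface_measure)"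
    unfolding fx using m inc by (simp add: nn_integral_monotone_convergence_SUP)
  also have "\<dots> = (SUP i. \<integral>\<^sup>+t\<in>{-1<..<1}. (\<integral>\<^sup>+x. U i x \<partial>slice_measure \<omega> t) \<partial>lborel)"
    by (simp only: IH(2))
  also have "\<dots> = (\<integral>\<^sup>+t. (SUP i. (\<integral>\<^sup>+x. U i x \<partial>slice_measure \<omega> t) * indicator {-1<..<1} t) \<partial>lborel)"
  proof (rule nn_integral_monotone_convergence_SUP[symmetric])
    show "incseq (\<lambda>i t. (\<integral>\<^sup>+x. U i x \<partial>slice_measure \<omega> t) * indicator {-1<..<1} t)"
      using inc by (auto simp: incseq_def le_fun_def intro!: mult_right_mono nn_integral_mono)
  qed (use IH(1) in simp)
  finally have "(\<integral>\<^sup>+x. f x \<partial>surface_measure) = \<dots>" .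
  moreover have "(\<lambda>t. SUP i. (\<integral>\<^sup>+x. U i x \<partial>slice_measure \<omega> t) * indicator {-1<..<1} t) \<in> borel_measurable borel"
    using IH(1) by (intro borel_measurable_SUP) auto
  ultimately show ?case unfolding fU[symmetric] s by blast
qed

section \<open>Gaussian regularisation of the Fourier transform on the line\<close>

definition line_fourier :: "(real \<Rightarrow> complex) \<Rightarrow> real \<Rightarrow> complex" where
  "line_fourier G s = (\<integral>t. exp (\<i> * complex_of_real (s * t)) * G t \<partial>lborel)"

lemma norm_exp_i_real [simp]: "cmod (exp (\<i> * complex_of_real x)) = 1"
  by (simp add: norm_exp_eq_Re)

lemma norm_exp_i_real_mult [simp]: "cmod (exp (\<i> * (complex_of_real x * complex_of_real y))) = 1"
  using norm_exp_i_real[of "x * y"] by simp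

lemma integrable_exp_i_mult:
  assumes "integrable lborel (G :: real \<Rightarrow> complex)"
  shows "integrable lborel (\<lambda>t. iexp (s * t) * G t)"
  by (rule Bochner_Integration.integrable_bound[OF assms]) (use assms in \<open>auto simp: norm_mult borel_measurable_integrable\<close>)

text \<open>Fubini's theorem for a bounded kernel between two integrable functions; for the Fourier kernel
  this is the multiplication formula.\<close>

lemma integral_bounded_kernel_swap:
  fixes e :: "real \<Rightarrow> real \<Rightarrow> complex"
  assumes e: "(\<lambda>(s, t). e s t) \<in> borel_measurable (borel \<Otimes>\<^sub>M borel)" "\<And>s t. cmod (e s t) \<le> 1"
    and F: "integrable lborel F" and V: "integrable lborel V"
  shows "(\<integral>s. (\<integral>t. e s t * F t \<partial>lborel) * V s \<partial>lborel) = (\<integral>t. F t * (\<integral>s. e s t * V s \<partial>lborel) \<partial>lborel)"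
    and "integrable lborel (\<lambda>s. (\<integral>t. e s t * F t \<partial>lborel) * V s)"
proof -
  have [measurable]: "F \<in> borel_measurable borel" "V \<in> borel_measurable borel"
    using F V by (auto dest: borel_measurable_integrable)
  have em[measurable]: "(\<lambda>x. e (fst x) (snd x)) \<in> borel_measurable (borel \<Otimes>\<^sub>M borel)" using e(1) by (simp add: split_beta')
  have g: "integrable (lborel \<Otimes>\<^sub>M lborel) (\<lambda>x. F (snd x) * V (fst x))"
  proof (rule lborel_pair.Fubini_integrable)
    show "integrable lborel (\<lambda>x. \<integral>y. norm (F (snd (x, y)) * V (fst (x, y))) \<partial>lborel)"
      using V by (simp add: norm_mult)
    show "AE x in lborel. integrable lborel (\<lambda>y. F (snd (x, y)) * V (fst (x, y)))" using F by simp
  qed measurable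
  have f: "integrable (lborel \<Otimes>\<^sub>M lborel) (\<lambda>x. e (fst x) (snd x) * F (snd x) * V (fst x))"
  proof (rule Bochner_Integration.integrable_bound[OF g])
    show "(\<lambda>x. e (fst x) (snd x) * F (snd x) * V (fst x)) \<in> borel_measurable (lborel \<Otimes>\<^sub>M lborel)" by measurable
    show "AE x in lborel \<Otimes>\<^sub>M lborel. norm (e (fst x) (snd x) * F (snd x) * V (fst x)) \<le> norm (F (snd x) * V (fst x))"
      using e(2) by (auto simp: norm_mult mult.assoc intro!: mult_left_le_one_le)
  qed
  have "integrable lborel (\<lambda>s. \<integral>t. e s t * F t * V s \<partial>lborel)"
    using lborel_pair.integrable_fst'[OF f] by simp
  then show "integrable lborel (\<lambda>s. (\<integral>t. e s t * F t \<partial>lborel) * V s)" by simp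
  have "(\<integral>s. (\<integral>t. e s t * F t \<partial>lborel) * V s \<partial>lborel) = (\<integral>s. (\<integral>t. e s t * F t * V s \<partial>lborel) \<partial>lborel)" by simp
  also have "\<dots> = (\<integral>t. (\<integral>s. e s t * F t * V s \<partial>lborel) \<partial>lborel)"
    using f by (intro lborel_pair.Fubini_integral[symmetric]) (simp add: split_beta')
  also have "\<dots> = (\<integral>t. F t * (\<integral>s. e s t * V s \<partial>lborel) \<partial>lborel)"
    by (intro Bochner_Integration.integral_cong) (simp_all flip: integral_mult_right_zero add: mult_ac)
  finally show "(\<integral>s. (\<integral>t. e s t * F t \<partial>lborel) * V s \<partial>lborel) = (\<integral>t. F t * (\<integral>s. e s t * V s \<partial>lborel) \<partial>lborel)" .
qed

lemma cnj_borel_measurable [measurable]: "cnj \<in> borel_measurable borel"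
  by (intro borel_measurable_continuous_onI continuous_intros)

definition gauss :: "real \<Rightarrow> real \<Rightarrow> real" where "gauss \<sigma> s = exp (- (\<sigma> * s)\<^sup>2 / 2)"

lemma gauss_eq_std_normal: "gauss \<sigma> s = sqrt (2 * pi) * std_normal_density (\<sigma> * s)"
  by (simp add: gauss_def std_normal_density_def)

lemma integrable_gauss: "\<sigma> > 0 \<Longrightarrow> integrable lborel (gauss \<sigma>)"
  using lborel_integrable_real_affine[of std_normal_density \<sigma> 0] unfolding gauss_eq_std_normal[abs_def] by simp

text \<open>A rescaling of the characteristic function of the standard normal distribution.\<close>

lemma gauss_fourier:
  assumes \<sigma>: "\<sigma> > 0"
  shows "(\<integral>s. iexp (s * x) * complex_of_real (gauss \<sigma> s) \<partial>lborel) = complex_of_real (2 * pi * normal_density 0 \<sigma> x)"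
proof -
  let ?t = "x / \<sigma>"
  have "complex_of_real (exp (- (?t\<^sup>2) / 2)) = (CLINT u|std_normal_distribution. iexp (?t * u))"
    using fun_cong[OF char_std_normal_distribution, of ?t] by (simp add: char_def)
  also have "\<dots> = (\<integral>u. std_normal_density u *\<^sub>R iexp (?t * u) \<partial>lborel)"
    by (intro integral_density) auto
  also have "\<dots> = \<bar>\<sigma>\<bar> *\<^sub>R (\<integral>s. std_normal_density (0 + \<sigma> * s) *\<^sub>R iexp (?t * (0 + \<sigma> * s)) \<partial>lborel)"
    using \<sigma> by (intro lborel_integral_real_affine) simp
  also have "(\<integral>s. std_normal_density (0 + \<sigma> * s) *\<^sub>R iexp (?t * (0 + \<sigma> * s)) \<partial>lborel) =
     (\<integral>s. complex_of_real (1 / sqrt (2 * pi)) * (iexp (s * x) * complex_of_real (gauss \<sigma> s)) \<partial>lborel)"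
  proof (intro Bochner_Integration.integral_cong refl)
    fix s
    have "std_normal_density (0 + \<sigma> * s) = 1 / sqrt (2 * pi) * gauss \<sigma> s" by (simp add: gauss_eq_std_normal)
    moreover have "?t * (0 + \<sigma> * s) = s * x" using \<sigma> by simp
    ultimately show "std_normal_density (0 + \<sigma> * s) *\<^sub>R iexp (?t * (0 + \<sigma> * s)) =
      complex_of_real (1 / sqrt (2 * pi)) * (iexp (s * x) * complex_of_real (gauss \<sigma> s))"
      by (simp only: scaleR_conv_of_real of_real_mult mult_ac)
  qed
  also have "\<dots> = complex_of_real (1 / sqrt (2 * pi)) * (\<integral>s. iexp (s * x) * complex_of_real (gauss \<sigma> s) \<partial>lborel)"
    by (rule integral_mult_right_zero)
  finally have *: "complex_of_real (exp (- (?t\<^sup>2) / 2)) = complex_of_real (\<sigma> / sqrt (2 * pi)) * (\<integral>s. iexp (s * x) * complex_of_real (gauss \<sigma> s) \<partial>lborel)"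
    using \<sigma> by (simp add: scaleR_conv_of_real)
  have "complex_of_real (2 * pi * normal_density 0 \<sigma> x) = complex_of_real (sqrt (2 * pi) / \<sigma>) * complex_of_real (exp (- (?t\<^sup>2) / 2))"
  proof -
    define q where "q = sqrt (2 * pi)"
    have q: "q > 0" "2 * pi = q * q" by (auto simp: q_def)
    have "normal_density 0 \<sigma> x = 1 / (q * \<sigma>) * exp (- (?t\<^sup>2) / 2)"
      using \<sigma> by (simp add: q_def normal_density_def real_sqrt_mult power_divide mult.commute)
    then have "2 * pi * normal_density 0 \<sigma> x = (q * q) * (1 / (q * \<sigma>) * exp (- (?t\<^sup>2) / 2))" using q(2) by simp
    also have "\<dots> = q / \<sigma> * exp (- (?t\<^sup>2) / 2)" using q(1) by simp
    also have "\<dots> = sqrt (2 * pi) / \<sigma> * exp (- (?t\<^sup>2) / 2)" by (simp only: q_def)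
    finally show ?thesis by simp
  qed
  also have "\<dots> = complex_of_real (sqrt (2 * pi) / \<sigma>) * complex_of_real (\<sigma> / sqrt (2 * pi)) * (\<integral>s. iexp (s * x) * complex_of_real (gauss \<sigma> s) \<partial>lborel)"
    by (simp only: * mult.assoc)
  also have "complex_of_real (sqrt (2 * pi) / \<sigma>) * complex_of_real (\<sigma> / sqrt (2 * pi)) = 1"
    using \<sigma> by (simp flip: of_real_mult of_real_divide)
  finally show ?thesis by simp
qed

lemma line_fourier_measurable [measurable]:
  assumes [measurable]: "G \<in> borel_measurable borel"
  shows "line_fourier G \<in> borel_measurable borel"
  unfolding line_fourier_def by measurable

lemma norm_line_fourier_le:
  assumes "integrable lborel G"
  shows "cmod (line_fourier G s) \<le> (\<integral>t. cmod (G t) \<partial>lborel)"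
proof -
  have "cmod (line_fourier G s) \<le> (\<integral>t. cmod (iexp (s * t) * G t) \<partial>lborel)"
    unfolding line_fourier_def by (rule integral_norm_bound)
  then show ?thesis by (simp add: norm_mult)
qed

text \<open>The Gaussian weight makes the pairing of two Fourier transforms absolutely convergent. Swapping integrals
  twice leaves the Fourier transform of the weight, a multiple of a narrow normal density.\<close>

lemma line_fourier_regularized_inner:
  assumes G: "integrable lborel G" and H: "integrable lborel H" and \<sigma>: "\<sigma> > 0"
  shows "(\<integral>s. line_fourier G s * (cnj (line_fourier H s) * complex_of_real (gauss \<sigma> s)) \<partial>lborel)
     = 2 * pi * (\<integral>t. G t * (\<integral>u. cnj (H u) * complex_of_real (normal_density t \<sigma> u) \<partial>lborel) \<partial>lborel)"
    and "integrable lborel (\<lambda>s. line_fourier G s * (cnj (line_fourier H s) * complex_of_real (gauss \<sigma> s)))"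
proof -
  have [measurable]: "G \<in> borel_measurable borel" "H \<in> borel_measurable borel" "gauss \<sigma> \<in> borel_measurable borel"
    using G H integrable_gauss[OF \<sigma>] by (auto dest: borel_measurable_integrable)
  have W: "integrable lborel (\<lambda>s. complex_of_real (gauss \<sigma> s))" using integrable_gauss[OF \<sigma>] by simp
  have V: "integrable lborel (\<lambda>s. cnj (line_fourier H s) * complex_of_real (gauss \<sigma> s))"
  proof (rule Bochner_Integration.integrable_bound)
    show "integrable lborel (\<lambda>s. (\<integral>t. cmod (H t) \<partial>lborel) * gauss \<sigma> s)" using integrable_gauss[OF \<sigma>] by simp
    show "AE s in lborel. norm (cnj (line_fourier H s) * complex_of_real (gauss \<sigma> s)) \<le> norm ((\<integral>t. cmod (H t) \<partial>lborel) * gauss \<sigma> s)"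
      using norm_line_fourier_le[OF H] by (auto simp: norm_mult gauss_def abs_mult intro!: AE_I2 mult_right_mono order_trans[OF _ abs_ge_self])
    show "(\<lambda>s. cnj (line_fourier H s) * complex_of_real (gauss \<sigma> s)) \<in> borel_measurable lborel" by simp
  qed
  note sw = integral_bounded_kernel_swap[of "\<lambda>s t. iexp (s * t)", OF _ _ G V]
  show "integrable lborel (\<lambda>s. line_fourier G s * (cnj (line_fourier H s) * complex_of_real (gauss \<sigma> s)))"
    unfolding line_fourier_def[of G] by (rule sw(2)) simp_all
  have inner: "(\<integral>s. iexp (s * t) * (cnj (line_fourier H s) * complex_of_real (gauss \<sigma> s)) \<partial>lborel)
    = 2 * pi * (\<integral>u. cnj (H u) * complex_of_real (normal_density t \<sigma> u) \<partial>lborel)" for t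
  proof -
    have cH: "integrable lborel (\<lambda>u. cnj (H u))" using H by simp
    have cl: "cnj (line_fourier H s) = (\<integral>u. exp (- (\<i> * complex_of_real (s * u))) * cnj (H u) \<partial>lborel)" for s
    proof -
      have "cnj (line_fourier H s) = (\<integral>u. cnj (iexp (s * u) * H u) \<partial>lborel)"
        unfolding line_fourier_def by (rule Bochner_Integration.integral_cnj[symmetric])
      then show ?thesis by (simp add: exp_cnj)
    qed
    have "(\<integral>s. iexp (s * t) * (cnj (line_fourier H s) * complex_of_real (gauss \<sigma> s)) \<partial>lborel)
      = (\<integral>s. (\<integral>u. exp (- (\<i> * complex_of_real (s * u))) * cnj (H u) \<partial>lborel) * (iexp (s * t) * complex_of_real (gauss \<sigma> s)) \<partial>lborel)"
      unfolding cl by (simp add: mult_ac)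
    also have "\<dots> = (\<integral>u. cnj (H u) * (\<integral>s. exp (- (\<i> * complex_of_real (s * u))) * (iexp (s * t) * complex_of_real (gauss \<sigma> s)) \<partial>lborel) \<partial>lborel)"
      using cH integrable_exp_i_mult[OF W, of t]
      by (intro integral_bounded_kernel_swap(1)) (simp_all add: mult.commute norm_exp_eq_Re)
    also have "\<dots> = (\<integral>u. cnj (H u) * (2 * pi * complex_of_real (normal_density t \<sigma> u)) \<partial>lborel)"
    proof (intro Bochner_Integration.integral_cong refl arg_cong2[where f="(*)"])
      fix u
      have "(\<integral>s. exp (- (\<i> * complex_of_real (s * u))) * (iexp (s * t) * complex_of_real (gauss \<sigma> s)) \<partial>lborel)
        = (\<integral>s. iexp (s * (t - u)) * complex_of_real (gauss \<sigma> s) \<partial>lborel)"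
        by (intro Bochner_Integration.integral_cong refl) (simp add: right_diff_distrib exp_diff exp_minus field_simps)
      also have "\<dots> = complex_of_real (2 * pi * normal_density 0 \<sigma> (t - u))" by (rule gauss_fourier[OF \<sigma>])
      also have "normal_density 0 \<sigma> (t - u) = normal_density t \<sigma> u"
        by (simp add: normal_density_def power2_commute)
      finally show "(\<integral>s. exp (- (\<i> * complex_of_real (s * u))) * (iexp (s * t) * complex_of_real (gauss \<sigma> s)) \<partial>lborel)
        = 2 * pi * complex_of_real (normal_density t \<sigma> u)" by simp
    qed
    also have "\<dots> = (\<integral>u. (2 * pi) * (cnj (H u) * complex_of_real (normal_density t \<sigma> u)) \<partial>lborel)" by (simp add: mult_ac)
    also have "\<dots> = 2 * pi * (\<integral>u. cnj (H u) * complex_of_real (normal_density t \<sigma> u) \<partial>lborel)" by (rule integral_mult_right_zero)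
    finally show ?thesis .
  qed
  have "(\<integral>s. line_fourier G s * (cnj (line_fourier H s) * complex_of_real (gauss \<sigma> s)) \<partial>lborel)
    = (\<integral>t. G t * (2 * pi * (\<integral>u. cnj (H u) * complex_of_real (normal_density t \<sigma> u) \<partial>lborel)) \<partial>lborel)"
    unfolding line_fourier_def[of G] inner[symmetric] by (rule sw(1)) simp_all
  also have "\<dots> = (\<integral>t. (2 * pi) * (G t * (\<integral>u. cnj (H u) * complex_of_real (normal_density t \<sigma> u) \<partial>lborel)) \<partial>lborel)"
    by (simp add: mult_ac)
  also have "\<dots> = 2 * pi * (\<integral>t. G t * (\<integral>u. cnj (H u) * complex_of_real (normal_density t \<sigma> u) \<partial>lborel) \<partial>lborel)"
    by (rule integral_mult_right_zero)
  finally show "(\<integral>s. line_fourier G s * (cnj (line_fourier H s) * complex_of_real (gauss \<sigma> s)) \<partial>lborel)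
     = 2 * pi * (\<integral>t. G t * (\<integral>u. cnj (H u) * complex_of_real (normal_density t \<sigma> u) \<partial>lborel) \<partial>lborel)" .
qed


lemma gauss_tendsto: "(\<lambda>n. gauss (inverse (real (Suc n))) s) \<longlonglongrightarrow> 1"
proof -
  have "(\<lambda>n. exp (- (inverse (real (Suc n)) * s)\<^sup>2 / 2)) \<longlonglongrightarrow> exp (- (0 * s)\<^sup>2 / 2)"
    by (intro tendsto_exp tendsto_divide tendsto_minus tendsto_power tendsto_mult LIMSEQ_inverse_real_of_nat tendsto_const) simp
  then show ?thesis by (simp add: gauss_def)
qed

lemma gauss_le_1: "gauss \<sigma> s \<le> 1" and gauss_nonneg: "0 \<le> gauss \<sigma> s"
  by (auto simp: gauss_def)

lemma gauss_incseq: "gauss (inverse (real (Suc n))) s \<le> gauss (inverse (real (Suc (Suc n)))) s"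
proof -
  have "inverse (real (Suc (Suc n))) * \<bar>s\<bar> \<le> inverse (real (Suc n)) * \<bar>s\<bar>"
    by (intro mult_right_mono le_imp_inverse_le) auto
  then have "(inverse (real (Suc (Suc n))) * \<bar>s\<bar>)\<^sup>2 \<le> (inverse (real (Suc n)) * \<bar>s\<bar>)\<^sup>2"
    by (intro power_mono) auto
  then show ?thesis by (simp add: gauss_def power_mult_distrib)
qed

lemma nn_integral_normal_density: "\<sigma> > 0 \<Longrightarrow> (\<integral>\<^sup>+u. ennreal (normal_density t \<sigma> u) \<partial>lborel) = 1"
  by (subst nn_integral_eq_integral) auto

abbreviation L2_square :: "(real \<Rightarrow> complex) \<Rightarrow> ennreal" where
  "L2_square G \<equiv> \<integral>\<^sup>+t. ennreal ((cmod (G t))\<^sup>2) \<partial>lborel"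

text \<open>Schur's test for the normal density as a kernel: it is symmetric with total mass 1, so bounding
  the product of the two values of \<open>H\<close> by the mean of their squares reduces the double integral
  to the square norm of \<open>H\<close>. This holds in $[0,\infty]$.\<close>

lemma line_fourier_bessel_regularized:
  assumes H: "integrable lborel H" and \<sigma>: "\<sigma> > 0"
  shows "(\<integral>\<^sup>+s. ennreal ((cmod (line_fourier H s))\<^sup>2 * gauss \<sigma> s) \<partial>lborel) \<le> ennreal (2 * pi) * L2_square H"
proof -
  have [measurable]: "H \<in> borel_measurable borel" "gauss \<sigma> \<in> borel_measurable borel"
    using H integrable_gauss[OF \<sigma>] by (auto dest: borel_measurable_integrable)
  let ?\<phi> = "\<lambda>t u. normal_density t \<sigma> u"
  have sym: "?\<phi> t u = ?\<phi> u t" for t u by (simp add: normal_density_def power2_commute)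
  have [measurable]: "(\<lambda>x. ?\<phi> (fst x) (snd x)) \<in> borel_measurable (borel \<Otimes>\<^sub>M borel)"
    "(\<lambda>x. ?\<phi> (snd x) (fst x)) \<in> borel_measurable (borel \<Otimes>\<^sub>M borel)" unfolding normal_density_def by measurable
  let ?J = "\<lambda>t. \<integral>u. cnj (H u) * complex_of_real (?\<phi> t u) \<partial>lborel"
  note id = line_fourier_regularized_inner[OF H H \<sigma>]
  have eq: "line_fourier H s * (cnj (line_fourier H s) * complex_of_real (gauss \<sigma> s)) = complex_of_real ((cmod (line_fourier H s))\<^sup>2 * gauss \<sigma> s)" for s
    by (simp only: of_real_mult complex_norm_square mult.assoc)
  have int: "integrable lborel (\<lambda>s. (cmod (line_fourier H s))\<^sup>2 * gauss \<sigma> s)"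
    using id(2) unfolding eq complex_of_real_integrable_eq .
  have "(\<integral>\<^sup>+s. ennreal ((cmod (line_fourier H s))\<^sup>2 * gauss \<sigma> s) \<partial>lborel) = ennreal (\<integral>s. (cmod (line_fourier H s))\<^sup>2 * gauss \<sigma> s \<partial>lborel)"
    by (rule nn_integral_eq_integral[OF int]) (simp add: gauss_nonneg)
  also have "(\<integral>s. (cmod (line_fourier H s))\<^sup>2 * gauss \<sigma> s \<partial>lborel) = cmod (\<integral>s. complex_of_real ((cmod (line_fourier H s))\<^sup>2 * gauss \<sigma> s) \<partial>lborel)"
    by (subst integral_complex_of_real) (simp add: gauss_nonneg Bochner_Integration.integral_nonneg)
  also have "\<dots> = 2 * pi * cmod (\<integral>t. H t * ?J t \<partial>lborel)"
    using id(1) unfolding eq by (simp add: norm_mult)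
  also have "ennreal \<dots> = ennreal (2 * pi) * ennreal (cmod (\<integral>t. H t * ?J t \<partial>lborel))" by (simp add: ennreal_mult)
  also have "\<dots> \<le> ennreal (2 * pi) * L2_square H"
  proof (rule mult_left_mono)
    have nb: "ennreal (norm (\<integral>x. f x \<partial>lborel)) \<le> (\<integral>\<^sup>+x. ennreal (norm (f x)) \<partial>lborel)" for f :: "real \<Rightarrow> complex"
      by (cases "integrable lborel f") (auto simp: integral_norm_bound_ennreal not_integrable_integral_eq)
    have "ennreal (cmod (\<integral>t. H t * ?J t \<partial>lborel)) \<le> (\<integral>\<^sup>+t. ennreal (cmod (H t * ?J t)) \<partial>lborel)" by (rule nb)
    also have "\<dots> \<le> (\<integral>\<^sup>+t. ennreal (cmod (H t)) * (\<integral>\<^sup>+u. ennreal (cmod (H u) * ?\<phi> t u) \<partial>lborel) \<partial>lborel)"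
    proof (rule nn_integral_mono)
      fix t
      have "ennreal (cmod (?J t)) \<le> (\<integral>\<^sup>+u. ennreal (cmod (cnj (H u) * complex_of_real (?\<phi> t u))) \<partial>lborel)" by (rule nb)
      also have "\<dots> = (\<integral>\<^sup>+u. ennreal (cmod (H u) * ?\<phi> t u) \<partial>lborel)" by (simp add: norm_mult)
      finally show "ennreal (cmod (H t * ?J t)) \<le> ennreal (cmod (H t)) * (\<integral>\<^sup>+u. ennreal (cmod (H u) * ?\<phi> t u) \<partial>lborel)"
        by (simp add: norm_mult ennreal_mult mult_left_mono)
    qed
    also have "\<dots> = (\<integral>\<^sup>+t. \<integral>\<^sup>+u. ennreal (cmod (H t) * (cmod (H u) * ?\<phi> t u)) \<partial>lborel \<partial>lborel)"
      by (simp add: nn_integral_cmult[symmetric] ennreal_mult[symmetric])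
    also have "\<dots> \<le> (\<integral>\<^sup>+t. \<integral>\<^sup>+u. ennreal (1/2) * ennreal ((cmod (H t))\<^sup>2) * ennreal (?\<phi> t u) + ennreal (1/2) * ennreal ((cmod (H u))\<^sup>2) * ennreal (?\<phi> t u) \<partial>lborel \<partial>lborel)"
    proof (intro nn_integral_mono)
      fix t u
      have half: "ennreal (1/2 * a\<^sup>2 * ?\<phi> b c) = ennreal (1/2) * ennreal (a\<^sup>2) * ennreal (?\<phi> b c)" for a b c
      proof -
        have "ennreal (1/2 * a\<^sup>2 * ?\<phi> b c) = ennreal (1/2 * a\<^sup>2) * ennreal (?\<phi> b c)" by (rule ennreal_mult) auto
        also have "ennreal (1/2 * a\<^sup>2) = ennreal (1/2) * ennreal (a\<^sup>2)" by (rule ennreal_mult) auto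
        finally show ?thesis .
      qed
      have "cmod (H t) * cmod (H u) \<le> 1/2 * (cmod (H t))\<^sup>2 + 1/2 * (cmod (H u))\<^sup>2"
        using sum_squares_bound[of "cmod (H t)" "cmod (H u)"] by simp
      then have "cmod (H t) * cmod (H u) * ?\<phi> t u \<le> (1/2 * (cmod (H t))\<^sup>2 + 1/2 * (cmod (H u))\<^sup>2) * ?\<phi> t u"
        by (rule mult_right_mono) simp
      then have "cmod (H t) * (cmod (H u) * ?\<phi> t u) \<le> 1/2 * (cmod (H t))\<^sup>2 * ?\<phi> t u + 1/2 * (cmod (H u))\<^sup>2 * ?\<phi> t u"
        by (simp only: mult.assoc distrib_right)
      then have "ennreal (cmod (H t) * (cmod (H u) * ?\<phi> t u)) \<le> ennreal (1/2 * (cmod (H t))\<^sup>2 * ?\<phi> t u + 1/2 * (cmod (H u))\<^sup>2 * ?\<phi> t u)"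
        by (rule ennreal_leI)
      also have "\<dots> = ennreal (1/2) * ennreal ((cmod (H t))\<^sup>2) * ennreal (?\<phi> t u) + ennreal (1/2) * ennreal ((cmod (H u))\<^sup>2) * ennreal (?\<phi> t u)"
        by (subst ennreal_plus) (simp_all only: half, simp_all)
      finally show "ennreal (cmod (H t) * (cmod (H u) * ?\<phi> t u)) \<le> ennreal (1/2) * ennreal ((cmod (H t))\<^sup>2) * ennreal (?\<phi> t u) + ennreal (1/2) * ennreal ((cmod (H u))\<^sup>2) * ennreal (?\<phi> t u)" .
    qed
    also have "\<dots> = (\<integral>\<^sup>+t. \<integral>\<^sup>+u. ennreal (1/2) * ennreal ((cmod (H t))\<^sup>2) * ennreal (?\<phi> t u) \<partial>lborel \<partial>lborel)
      + (\<integral>\<^sup>+t. \<integral>\<^sup>+u. ennreal (1/2) * ennreal ((cmod (H u))\<^sup>2) * ennreal (?\<phi> t u) \<partial>lborel \<partial>lborel)"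
      by (subst nn_integral_add, simp, simp) (intro nn_integral_add; measurable)
    also have "(\<integral>\<^sup>+t. \<integral>\<^sup>+u. ennreal (1/2) * ennreal ((cmod (H u))\<^sup>2) * ennreal (?\<phi> t u) \<partial>lborel \<partial>lborel)
      = (\<integral>\<^sup>+u. \<integral>\<^sup>+t. ennreal (1/2) * ennreal ((cmod (H u))\<^sup>2) * ennreal (?\<phi> t u) \<partial>lborel \<partial>lborel)"
      by (rule lborel_pair.Fubini') measurable
    also have "\<dots> = (\<integral>\<^sup>+u. \<integral>\<^sup>+t. ennreal (1/2) * ennreal ((cmod (H u))\<^sup>2) * ennreal (?\<phi> u t) \<partial>lborel \<partial>lborel)"
      by (subst sym) (rule refl)
    also have "(\<integral>\<^sup>+t. \<integral>\<^sup>+u. ennreal (1/2) * ennreal ((cmod (H t))\<^sup>2) * ennreal (?\<phi> t u) \<partial>lborel \<partial>lborel)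
      = ennreal (1/2) * L2_square H"
      using \<sigma> by (simp add: nn_integral_cmult nn_integral_normal_density)
    also have "ennreal (1/2) * x + ennreal (1/2) * x = x" for x
    proof -
      have "ennreal (1/2) + ennreal (1/2) = ennreal (1/2 + 1/2)" by (rule ennreal_plus[symmetric]) auto
      also have "\<dots> = 1" by simp
      finally show ?thesis by (simp only: distrib_right[symmetric] mult_1)
    qed
    finally show "ennreal (cmod (\<integral>t. H t * ?J t \<partial>lborel)) \<le> L2_square H" .
  qed simp
  finally show ?thesis .
qed

lemma line_fourier_bessel:
  assumes H: "integrable lborel H"
  shows "L2_square (line_fourier H) \<le> ennreal (2 * pi) * L2_square H"
proof (rule LIMSEQ_le_const2)
  have [measurable]: "H \<in> borel_measurable borel" using H by (auto dest: borel_measurable_integrable)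
  have [measurable]: "gauss \<sigma> \<in> borel_measurable borel" for \<sigma> unfolding gauss_def by measurable
  show "(\<lambda>n. \<integral>\<^sup>+s. ennreal ((cmod (line_fourier H s))\<^sup>2 * gauss (inverse (real (Suc n))) s) \<partial>lborel)
      \<longlonglongrightarrow> L2_square (line_fourier H)"
  proof (rule nn_integral_LIMSEQ)
    show "incseq (\<lambda>n s. ennreal ((cmod (line_fourier H s))\<^sup>2 * gauss (inverse (real (Suc n))) s))"
      by (intro incseq_SucI le_funI ennreal_leI mult_left_mono gauss_incseq) simp
    show "(\<lambda>n. ennreal ((cmod (line_fourier H s))\<^sup>2 * gauss (inverse (real (Suc n))) s)) \<longlonglongrightarrow> ennreal ((cmod (line_fourier H s))\<^sup>2)" for s
      using tendsto_ennrealI[OF tendsto_mult[OF tendsto_const gauss_tendsto, of "(cmod (line_fourier H s))\<^sup>2" s]] by simp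
  qed measurable
  show "\<exists>N. \<forall>n\<ge>N. (\<integral>\<^sup>+s. ennreal ((cmod (line_fourier H s))\<^sup>2 * gauss (inverse (real (Suc n))) s) \<partial>lborel)
      \<le> ennreal (2 * pi) * L2_square H"
    using line_fourier_bessel_regularized[OF H] by auto
qed


text \<open>Substituting \<open>u = t + \<sigma> * z\<close> turns the narrow density into a fixed one, and the values of \<open>h\<close> converge
  pointwise under a common bound.\<close>

lemma normal_mean_tendsto:
  fixes h :: "real \<Rightarrow> complex"
  assumes h: "continuous_on UNIV h" and N: "\<And>t. cmod (h t) \<le> N"
  shows "(\<lambda>n. \<integral>u. h u * complex_of_real (normal_density t (inverse (real (Suc n))) u) \<partial>lborel) \<longlonglongrightarrow> h t"
    and "\<sigma> > 0 \<Longrightarrow> cmod (\<integral>u. h u * complex_of_real (normal_density t \<sigma> u) \<partial>lborel) \<le> N"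
proof -
  have [measurable]: "h \<in> borel_measurable borel" using h by (rule borel_measurable_continuous_onI)
  have eq: "(\<integral>u. h u * complex_of_real (normal_density t \<sigma> u) \<partial>lborel) = (\<integral>z. h (t + \<sigma> * z) * complex_of_real (std_normal_density z) \<partial>lborel)"
    if "\<sigma> > 0" for \<sigma>
  proof -
    have "(\<integral>u. h u * complex_of_real (normal_density t \<sigma> u) \<partial>lborel) = \<bar>\<sigma>\<bar> *\<^sub>R (\<integral>z. h (t + \<sigma> * z) * complex_of_real (normal_density t \<sigma> (t + \<sigma> * z)) \<partial>lborel)"
      using that by (intro lborel_integral_real_affine) simp
    also have "\<dots> = (\<integral>z. \<sigma> *\<^sub>R (h (t + \<sigma> * z) * complex_of_real (normal_density t \<sigma> (t + \<sigma> * z))) \<partial>lborel)"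
      using that by simp
    also have "\<dots> = (\<integral>z. h (t + \<sigma> * z) * complex_of_real (std_normal_density z) \<partial>lborel)"
    proof (intro Bochner_Integration.integral_cong refl)
      fix z
      have "\<sigma> * normal_density t \<sigma> (t + \<sigma> * z) = std_normal_density z"
        using that by (simp add: normal_density_def real_sqrt_mult power_mult_distrib)
      then show "\<sigma> *\<^sub>R (h (t + \<sigma> * z) * complex_of_real (normal_density t \<sigma> (t + \<sigma> * z))) = h (t + \<sigma> * z) * complex_of_real (std_normal_density z)"
        by (simp add: scaleR_conv_of_real mult.left_commute flip: of_real_mult)
    qed
    finally show ?thesis .
  qed
  have dom: "AE z in lborel. norm (h (t + \<sigma> * z) * complex_of_real (std_normal_density z)) \<le> N * std_normal_density z" for \<sigma>
    using N by (auto simp: norm_mult intro!: mult_right_mono)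
  show "(\<lambda>n. \<integral>u. h u * complex_of_real (normal_density t (inverse (real (Suc n))) u) \<partial>lborel) \<longlonglongrightarrow> h t"
  proof -
    have "(\<lambda>n. \<integral>z. h (t + inverse (real (Suc n)) * z) * complex_of_real (std_normal_density z) \<partial>lborel)
       \<longlonglongrightarrow> (\<integral>z. h t * complex_of_real (std_normal_density z) \<partial>lborel)"
    proof (rule integral_dominated_convergence[where w="\<lambda>z. N * std_normal_density z"])
      show "AE z in lborel. (\<lambda>n. h (t + inverse (real (Suc n)) * z) * complex_of_real (std_normal_density z)) \<longlonglongrightarrow> h t * complex_of_real (std_normal_density z)"
      proof (rule AE_I2)
        fix z :: real
        have "(\<lambda>n. t + inverse (real (Suc n)) * z) \<longlonglongrightarrow> t + 0 * z"
          by (intro tendsto_add tendsto_const tendsto_mult LIMSEQ_inverse_real_of_nat)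
        then have "(\<lambda>n. t + inverse (real (Suc n)) * z) \<longlonglongrightarrow> t" by simp
        moreover have "isCont h t" using h by (simp add: continuous_on_eq_continuous_at)
        ultimately have "(\<lambda>n. h (t + inverse (real (Suc n)) * z)) \<longlonglongrightarrow> h t" by (rule isCont_tendsto_compose[rotated])
        then show "(\<lambda>n. h (t + inverse (real (Suc n)) * z) * complex_of_real (std_normal_density z)) \<longlonglongrightarrow> h t * complex_of_real (std_normal_density z)"
          by (intro tendsto_mult tendsto_const)
      qed
    qed (use dom in simp_all)
    moreover have "(\<integral>z. h t * complex_of_real (std_normal_density z) \<partial>lborel) = h t * complex_of_real (\<integral>z. std_normal_density z \<partial>lborel)"
      by (subst integral_mult_right_zero) (simp only: integral_complex_of_real)
    ultimately show ?thesis by (simp add: eq)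
  qed
  assume \<sigma>: "\<sigma> > 0"
  have "cmod (\<integral>z. h (t + \<sigma> * z) * complex_of_real (std_normal_density z) \<partial>lborel) \<le> (\<integral>z. N * std_normal_density z \<partial>lborel)"
  proof (rule Bochner_Integration.integral_norm_bound_integral)
    show "integrable lborel (\<lambda>z. h (t + \<sigma> * z) * complex_of_real (std_normal_density z))"
    proof (rule Bochner_Integration.integrable_bound[of _ "\<lambda>z. N * std_normal_density z"])
      show "AE z in lborel. norm (h (t + \<sigma> * z) * complex_of_real (std_normal_density z)) \<le> norm (N * std_normal_density z)"
        using dom[of \<sigma>] by eventually_elim (auto intro: order_trans[OF _ abs_ge_self])
    qed simp_all
    show "norm (h (t + \<sigma> * z) * complex_of_real (std_normal_density z)) \<le> N * std_normal_density z" for z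
      using N by (auto simp: norm_mult intro!: mult_right_mono)
  qed simp
  then show "cmod (\<integral>u. h u * complex_of_real (normal_density t \<sigma> u) \<partial>lborel) \<le> N" by (simp add: eq[OF \<sigma>])
qed

text \<open>Cauchy-Schwarz on the Fourier side, combined with the Bessel inequality for \<open>h\<close>. Continuity of \<open>h\<close> is
  what allows the regularised pairing to converge to the pairing of \<open>G\<close> with \<open>h\<close> when
  \<open>G\<close> is merely integrable.\<close>

lemma line_fourier_pairing_bound:
  assumes G: "integrable lborel G" and h: "integrable lborel h" "continuous_on UNIV h" "\<And>t. cmod (h t) \<le> N"
  shows "ennreal (2 * pi) * ennreal ((cmod (\<integral>t. G t * cnj (h t) \<partial>lborel))\<^sup>2)
    \<le> L2_square (line_fourier G) * L2_square h"
proof -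
  have [measurable]: "G \<in> borel_measurable borel" "h \<in> borel_measurable borel"
    using G h by (auto dest: borel_measurable_integrable)
  let ?I = "L2_square (line_fourier G)" and ?h2 = "L2_square h"
  define \<sigma> where "\<sigma> n = inverse (real (Suc n))" for n
  define J where "J n t = (\<integral>u. cnj (h u) * complex_of_real (normal_density t (\<sigma> n) u) \<partial>lborel)" for n t
  have \<sigma>: "\<sigma> n > 0" for n by (simp add: \<sigma>_def)
  have ch: "continuous_on UNIV (\<lambda>t. cnj (h t))" "\<And>t. cmod (cnj (h t)) \<le> N" using h by (auto intro: continuous_intros)
  have [measurable]: "(\<lambda>x. normal_density (fst x) (\<sigma> n) (snd x)) \<in> borel_measurable (borel \<Otimes>\<^sub>M borel)" for n unfolding normal_density_def by measurable
  have [measurable]: "J n \<in> borel_measurable borel" for n unfolding J_def by measurable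
  have lim: "(\<lambda>n. \<integral>t. G t * J n t \<partial>lborel) \<longlonglongrightarrow> (\<integral>t. G t * cnj (h t) \<partial>lborel)"
  proof (rule integral_dominated_convergence[where w="\<lambda>t. N * cmod (G t)"])
    show "AE t in lborel. (\<lambda>n. G t * J n t) \<longlonglongrightarrow> G t * cnj (h t)"
      unfolding J_def \<sigma>_def by (intro AE_I2 tendsto_mult tendsto_const normal_mean_tendsto(1)[OF ch])
    show "AE t in lborel. norm (G t * J n t) \<le> N * cmod (G t)" for n
      using normal_mean_tendsto(2)[OF ch \<sigma>] unfolding J_def
      by (intro AE_I2) (simp add: norm_mult mult.commute[of N] mult_left_mono)
  qed (use G in simp_all)
  have bd: "ennreal ((cmod (2 * pi * (\<integral>t. G t * J n t \<partial>lborel)))\<^sup>2) \<le> ?I * (ennreal (2 * pi) * ?h2)" for n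
  proof -
    note id = line_fourier_regularized_inner[OF G h(1) \<sigma>[of n]]
    have "ennreal (cmod (2 * pi * (\<integral>t. G t * J n t \<partial>lborel))) = ennreal (cmod (\<integral>s. line_fourier G s * (cnj (line_fourier h s) * complex_of_real (gauss (\<sigma> n) s)) \<partial>lborel))"
      unfolding id(1) J_def by simp
    also have "\<dots> \<le> (\<integral>\<^sup>+s. ennreal (cmod (line_fourier G s * (cnj (line_fourier h s) * complex_of_real (gauss (\<sigma> n) s)))) \<partial>lborel)"
      by (rule integral_norm_bound_ennreal[OF id(2)])
    also have "\<dots> \<le> (\<integral>\<^sup>+s. ennreal (cmod (line_fourier G s)) * ennreal (cmod (line_fourier h s)) \<partial>lborel)"
    proof (rule nn_integral_mono)
      fix s
      have "cmod (line_fourier G s * (cnj (line_fourier h s) * complex_of_real (gauss (\<sigma> n) s))) \<le> cmod (line_fourier G s) * cmod (line_fourier h s)"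
        using mult_left_le[OF gauss_le_1[of "\<sigma> n" s], of "cmod (line_fourier h s)"] gauss_nonneg[of "\<sigma> n" s]
        by (simp add: norm_mult mult_left_mono)
      then show "ennreal (cmod (line_fourier G s * (cnj (line_fourier h s) * complex_of_real (gauss (\<sigma> n) s)))) \<le> ennreal (cmod (line_fourier G s)) * ennreal (cmod (line_fourier h s))"
        by (simp add: ennreal_leI flip: ennreal_mult)
    qed
    finally have "(ennreal (cmod (2 * pi * (\<integral>t. G t * J n t \<partial>lborel))))\<^sup>2 \<le> (\<integral>\<^sup>+s. ennreal (cmod (line_fourier G s)) * ennreal (cmod (line_fourier h s)) \<partial>lborel)\<^sup>2"
      by (rule power_mono) simp
    also have "\<dots> \<le> (\<integral>\<^sup>+s. (ennreal (cmod (line_fourier G s)))\<^sup>2 \<partial>lborel) * (\<integral>\<^sup>+s. (ennreal (cmod (line_fourier h s)))\<^sup>2 \<partial>lborel)"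
      by (rule Cauchy_Schwarz_nn_integral) measurable
    also have "\<dots> = ?I * L2_square (line_fourier h)" by (simp add: ennreal_power)
    also have "\<dots> \<le> ?I * (ennreal (2 * pi) * ?h2)" by (intro mult_left_mono line_fourier_bessel h(1)) simp
    finally show ?thesis by (simp add: ennreal_power)
  qed
  have "ennreal ((cmod (2 * pi * (\<integral>t. G t * cnj (h t) \<partial>lborel)))\<^sup>2) \<le> ?I * (ennreal (2 * pi) * ?h2)"
  proof (rule LIMSEQ_le_const2)
    show "(\<lambda>n. ennreal ((cmod (2 * pi * (\<integral>t. G t * J n t \<partial>lborel)))\<^sup>2)) \<longlonglongrightarrow> ennreal ((cmod (2 * pi * (\<integral>t. G t * cnj (h t) \<partial>lborel)))\<^sup>2)"
      by (intro tendsto_ennrealI tendsto_power tendsto_norm tendsto_mult tendsto_const lim)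
  qed (use bd in blast)
  also have "ennreal ((cmod (2 * pi * (\<integral>t. G t * cnj (h t) \<partial>lborel)))\<^sup>2) = ennreal (2 * pi) * (ennreal (2 * pi) * ennreal ((cmod (\<integral>t. G t * cnj (h t) \<partial>lborel))\<^sup>2))"
    by (simp add: norm_mult power_mult_distrib power2_eq_square mult.assoc flip: ennreal_mult)
  finally have "ennreal (2 * pi) * (ennreal (2 * pi) * ennreal ((cmod (\<integral>t. G t * cnj (h t) \<partial>lborel))\<^sup>2)) \<le> ennreal (2 * pi) * (?I * ?h2)"
    by (simp only: mult_ac)
  then have "ennreal (1 / (2 * pi)) * (ennreal (2 * pi) * (ennreal (2 * pi) * ennreal ((cmod (\<integral>t. G t * cnj (h t) \<partial>lborel))\<^sup>2))) \<le> ennreal (1 / (2 * pi)) * (ennreal (2 * pi) * (?I * ?h2))"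
    by (rule mult_left_mono) simp
  moreover have "ennreal (1 / (2 * pi)) * (ennreal (2 * pi) * z) = z" for z
    by (simp add: mult.assoc[symmetric] ennreal_mult[symmetric])
  ultimately show ?thesis by simp
qed

section \<open>Plancherel for integrable functions on the line\<close>

text \<open>A measurable function is an almost everywhere limit of continuous ones; clamping their values and multiplying by a
  cutoff restores the bound and a bounded support.\<close>

lemma bounded_approximation_by_continuous:
  fixes F :: "real \<Rightarrow> complex"
  assumes F: "F \<in> borel_measurable borel" and N: "N \<ge> 0" "\<And>t. cmod (F t) \<le> N" "\<And>t. \<bar>t\<bar> > N \<Longrightarrow> F t = 0"
  obtains h where "\<And>n::nat. continuous_on UNIV (h n)" "\<And>n t. cmod (h n t) \<le> (N + 1) * indicator {-(N+1)..N+1} t"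
    "AE t in lborel. (\<lambda>n. h n t) \<longlonglongrightarrow> F t"
proof -
  have "F \<in> borel_measurable lebesgue" using F by (simp add: measurable_completion)
  then have "F measurable_on UNIV" by (intro lebesgue_measurable_imp_measurable_on) auto
  then obtain Z g where g: "negligible Z" "\<And>n. continuous_on UNIV (g n)" "\<And>x. x \<notin> Z \<Longrightarrow> (\<lambda>n. g n x) \<longlonglongrightarrow> F x"
    unfolding measurable_on_def by auto
  define clamp where "clamp z = z /\<^sub>R max 1 (cmod z / (N + 1))" for z
  define cut where "cut t = max 0 (min 1 (N + 1 - \<bar>t\<bar>))" for t :: real
  define h where "h n t = cut t *\<^sub>R clamp (g n t)" for n t
  have clc: "continuous_on UNIV clamp" unfolding clamp_def using N by (intro continuous_intros) (auto simp: max_def)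
  have clb: "cmod (clamp z) \<le> N + 1" for z
  proof -
    define m where "m = max 1 (cmod z / (N + 1))"
    have m: "m \<ge> 1" "cmod z / (N + 1) \<le> m" by (auto simp: m_def)
    have "clamp z = z /\<^sub>R m" unfolding clamp_def m_def by (rule refl)
    then have "cmod (clamp z) = cmod z / m" using m(1) by (simp add: divide_inverse mult.commute)
    also have "\<dots> \<le> N + 1" using m N by (simp add: divide_le_eq mult.commute)
    finally show ?thesis .
  qed
  have cli: "clamp z = z" if "cmod z \<le> N" for z
    using that N by (simp add: clamp_def max_def divide_le_eq)
  show ?thesis
  proof
    show "continuous_on UNIV (h n)" for n
    proof -
      have "continuous_on UNIV (\<lambda>t. clamp (g n t))" using continuous_on_compose2[of UNIV clamp UNIV "g n"] clc g(2)[of n] by blast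
      moreover have "continuous_on UNIV cut" unfolding cut_def by (intro continuous_intros)
      ultimately show ?thesis unfolding h_def by (intro continuous_on_scaleR)
    qed
    show "cmod (h n t) \<le> (N + 1) * indicator {-(N+1)..N+1} t" for n t
    proof (cases "t \<in> {-(N+1)..N+1}")
      case True
      have "cut t * cmod (clamp (g n t)) \<le> 1 * (N + 1)"
        using clb N by (intro mult_mono) (auto simp: cut_def)
      then show ?thesis using True by (simp add: h_def cut_def)
    next
      case False
      then have "cut t = 0" by (auto simp: cut_def)
      then show ?thesis using N by (simp add: h_def)
    qed
    have "AE t in lebesgue. t \<notin> Z" using g(1) by (simp add: AE_not_in negligible_iff_null_sets)
    then have "AE t in lborel. t \<notin> Z" by (simp add: AE_completion_iff)
    then show "AE t in lborel. (\<lambda>n. h n t) \<longlonglongrightarrow> F t"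
    proof eventually_elim
      case (elim t)
      have "isCont clamp (F t)" using clc by (simp add: continuous_on_eq_continuous_at)
      then have "(\<lambda>n. clamp (g n t)) \<longlonglongrightarrow> clamp (F t)" using g(3)[OF elim] by (rule isCont_tendsto_compose)
      then have "(\<lambda>n. h n t) \<longlonglongrightarrow> cut t *\<^sub>R clamp (F t)" unfolding h_def by (intro tendsto_scaleR tendsto_const)
      moreover have "cut t *\<^sub>R clamp (F t) = F t"
        using N(3)[of t] cli[OF N(2)[of t]] by (cases "\<bar>t\<bar> > N") (auto simp: cut_def)
      ultimately show ?case by simp
    qed
  qed
qed

text \<open>The truncation \<open>F\<close> is tested against \<open>G\<close> itself: \<open>G t * cnj (F t)\<close> is the square of the modulus of
  \<open>F t\<close>, so the pairing bound reads \<open>2 * pi * A\<^sup>2 \<le> i * A\<close> where \<open>A\<close> is the finite square norm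
  of \<open>F\<close> and \<open>i\<close> that of the Fourier transform.\<close>

lemma line_fourier_truncated_bound:
  assumes G: "integrable lborel G" and N: "N \<ge> 0"
  defines "F \<equiv> \<lambda>t. if cmod (G t) \<le> N \<and> \<bar>t\<bar> \<le> N then G t else 0"
  shows "ennreal (2 * pi) * L2_square F \<le> L2_square (line_fourier G)" (is "_ \<le> ?I")
proof (cases ?I)
  case (real i)
  have [measurable]: "G \<in> borel_measurable borel" using G by (auto dest: borel_measurable_integrable)
  have Fm[measurable]: "F \<in> borel_measurable borel" unfolding F_def by measurable
  have FN: "cmod (F t) \<le> N" "\<bar>t\<bar> > N \<Longrightarrow> F t = 0" for t using N by (auto simp: F_def)
  obtain h where h: "\<And>n::nat. continuous_on UNIV (h n)" "\<And>n t. cmod (h n t) \<le> (N + 1) * indicator {-(N+1)..N+1} t"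
    "AE t in lborel. (\<lambda>n. h n t) \<longlonglongrightarrow> F t"
    using bounded_approximation_by_continuous[OF Fm N FN] by blast
  have [measurable]: "h n \<in> borel_measurable borel" for n using h(1) by (rule borel_measurable_continuous_onI)
  have hN: "cmod (h n t) \<le> N + 1" for n t using h(2)[of n t] N by (cases "t \<in> {-(N+1)..N+1}") auto
  have box: "integrable lborel (\<lambda>t. c * indicator {-(N+1)..N+1} t :: real)" for c
    by (intro integrable_mult_right integrable_real_indicator) (simp_all add: emeasure_lborel_Icc_eq)
  have hi: "integrable lborel (h n)" for n
  proof (rule Bochner_Integration.integrable_bound[OF box[of "N + 1"]])
    show "AE t in lborel. norm (h n t) \<le> norm ((N + 1) * indicator {-(N+1)..N+1} t)"
      using order_trans[OF h(2) abs_ge_self] by auto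
  qed simp
  have h2le: "(cmod (h n t))\<^sup>2 \<le> (N + 1)\<^sup>2 * indicator {-(N+1)..N+1} t" for n t
    using power_mono[OF h(2)[of n t] norm_ge_zero, of 2] by (cases "t \<in> {-(N+1)..N+1}") auto
  have h2i: "integrable lborel (\<lambda>t. (cmod (h n t))\<^sup>2)" for n
  proof (rule Bochner_Integration.integrable_bound[OF box[of "(N + 1)\<^sup>2"]])
    show "AE t in lborel. norm ((cmod (h n t))\<^sup>2) \<le> norm ((N + 1)\<^sup>2 * indicator {-(N+1)..N+1} t)"
      using order_trans[OF h2le abs_ge_self] by auto
  qed simp
  define A where "A = (\<integral>t. (cmod (F t))\<^sup>2 \<partial>lborel)"
  have A0: "A \<ge> 0" by (simp add: A_def)
  have F2i: "integrable lborel (\<lambda>t. (cmod (F t))\<^sup>2)"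
  proof (rule Bochner_Integration.integrable_bound[OF box[of "(N + 1)\<^sup>2"]])
    have "(cmod (F t))\<^sup>2 \<le> (N + 1)\<^sup>2 * indicator {-(N+1)..N+1} t" for t
    proof (cases "t \<in> {-(N+1)..N+1}")
      case True
      then show ?thesis using FN(1)[of t] power_mono[of "cmod (F t)" "N + 1" 2] by simp
    next
      case False
      then have "F t = 0" by (intro FN(2)) auto
      then show ?thesis by simp
    qed
    from order_trans[OF this abs_ge_self]
    show "AE t in lborel. norm ((cmod (F t))\<^sup>2) \<le> norm ((N + 1)\<^sup>2 * indicator {-(N+1)..N+1} t)" by auto
  qed simp
  have lim1: "(\<lambda>n. \<integral>t. G t * cnj (h n t) \<partial>lborel) \<longlonglongrightarrow> (\<integral>t. G t * cnj (F t) \<partial>lborel)"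
  proof (rule integral_dominated_convergence[where w="\<lambda>t. (N + 1) * cmod (G t)"])
    show "AE t in lborel. (\<lambda>n. G t * cnj (h n t)) \<longlonglongrightarrow> G t * cnj (F t)"
      using h(3) by eventually_elim (intro tendsto_mult tendsto_const tendsto_cnj)
    show "AE t in lborel. norm (G t * cnj (h n t)) \<le> (N + 1) * cmod (G t)" for n
      using hN by (intro AE_I2) (simp add: norm_mult mult.commute[of "N + 1"] mult_left_mono)
  qed (use G in simp_all)
  have "(\<integral>t. G t * cnj (F t) \<partial>lborel) = (\<integral>t. complex_of_real ((cmod (F t))\<^sup>2) \<partial>lborel)"
  proof (intro Bochner_Integration.integral_cong refl)
    fix t
    have "G t * cnj (F t) = F t * cnj (F t)" by (simp add: F_def)
    then show "G t * cnj (F t) = complex_of_real ((cmod (F t))\<^sup>2)" by (simp only: complex_norm_square)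
  qed
  also have "\<dots> = complex_of_real A" unfolding A_def by (rule integral_complex_of_real)
  finally have "(\<lambda>n. \<integral>t. G t * cnj (h n t) \<partial>lborel) \<longlonglongrightarrow> complex_of_real A" using lim1 by simp
  then have lim1': "(\<lambda>n. 2 * pi * (cmod (\<integral>t. G t * cnj (h n t) \<partial>lborel))\<^sup>2) \<longlonglongrightarrow> 2 * pi * (cmod (complex_of_real A))\<^sup>2"
    by (intro tendsto_mult tendsto_const tendsto_power tendsto_norm)
  have lim2: "(\<lambda>n. i * (\<integral>t. (cmod (h n t))\<^sup>2 \<partial>lborel)) \<longlonglongrightarrow> i * A"
    unfolding A_def
  proof (intro tendsto_mult tendsto_const integral_dominated_convergence[where w="\<lambda>t. (N + 1)\<^sup>2 * indicator {-(N+1)..N+1} t"])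
    show "AE t in lborel. (\<lambda>n. (cmod (h n t))\<^sup>2) \<longlonglongrightarrow> (cmod (F t))\<^sup>2"
      using h(3) by eventually_elim (intro tendsto_power tendsto_norm)
    show "AE t in lborel. norm ((cmod (h n t))\<^sup>2) \<le> (N + 1)\<^sup>2 * indicator {-(N+1)..N+1} t" for n using h2le by simp
  qed (use box in simp_all)
  have "2 * pi * (cmod (\<integral>t. G t * cnj (h n t) \<partial>lborel))\<^sup>2 \<le> i * (\<integral>t. (cmod (h n t))\<^sup>2 \<partial>lborel)" for n
  proof -
    have h2: "L2_square (h n) = ennreal (\<integral>t. (cmod (h n t))\<^sup>2 \<partial>lborel)"
      by (rule nn_integral_eq_integral[OF h2i]) simp
    from line_fourier_pairing_bound[OF G hi h(1) hN, of n]
    have "ennreal (2 * pi) * ennreal ((cmod (\<integral>t. G t * cnj (h n t) \<partial>lborel))\<^sup>2) \<le> ennreal i * ennreal (\<integral>t. (cmod (h n t))\<^sup>2 \<partial>lborel)"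
      by (simp only: h2 real(2))
    then have "ennreal (2 * pi * (cmod (\<integral>t. G t * cnj (h n t) \<partial>lborel))\<^sup>2) \<le> ennreal (i * (\<integral>t. (cmod (h n t))\<^sup>2 \<partial>lborel))"
      using real(1) by (simp add: ennreal_mult)
    then show ?thesis using real(1) by (subst (asm) ennreal_le_iff) (auto intro!: mult_nonneg_nonneg Bochner_Integration.integral_nonneg)
  qed
  then have "2 * pi * (cmod (complex_of_real A))\<^sup>2 \<le> i * A"
    by (intro LIMSEQ_le[OF lim1' lim2]) auto
  then have le: "(2 * pi * A) * A \<le> i * A" using A0 by (simp add: power2_eq_square mult.assoc)
  have "2 * pi * A \<le> i"
  proof (cases "A = 0")
    case True
    then show ?thesis using real(1) by simp
  next
    case False
    then show ?thesis using le A0 mult_le_cancel_right[of "2 * pi * A" A i] by auto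
  qed
  moreover have "L2_square F = ennreal A"
    unfolding A_def by (rule nn_integral_eq_integral[OF F2i]) simp
  ultimately show ?thesis using real A0 by (simp add: ennreal_leI flip: ennreal_mult)
qed simp

text \<open>One inequality is the Bessel inequality; the other follows from the bound for truncations of \<open>G\<close> by monotone
  convergence. Both sides may be infinite.\<close>

theorem plancherel_L1:
  assumes G: "integrable lborel G"
  shows "L2_square (line_fourier G) = ennreal (2 * pi) * L2_square G"
proof (rule antisym[OF line_fourier_bessel[OF G]])
  have [measurable]: "G \<in> borel_measurable borel" using G by (auto dest: borel_measurable_integrable)
  define F where "F N t = (if cmod (G t) \<le> real N \<and> \<bar>t\<bar> \<le> real N then G t else 0)" for N :: nat and t
  have [measurable]: "F N \<in> borel_measurable borel" for N unfolding F_def by measurable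
  show "ennreal (2 * pi) * L2_square G \<le> L2_square (line_fourier G)"
  proof (rule LIMSEQ_le_const2)
    have "(\<lambda>N. \<integral>\<^sup>+t. ennreal ((cmod (F N t))\<^sup>2) \<partial>lborel) \<longlonglongrightarrow> L2_square G"
    proof (rule nn_integral_LIMSEQ)
      show "incseq (\<lambda>N t. ennreal ((cmod (F N t))\<^sup>2))"
        by (intro incseq_SucI le_funI ennreal_leI power_mono) (auto simp: F_def)
      show "(\<lambda>N. ennreal ((cmod (F N t))\<^sup>2)) \<longlonglongrightarrow> ennreal ((cmod (G t))\<^sup>2)" for t
      proof (rule tendsto_eventually)
        obtain M :: nat where M: "max (cmod (G t)) \<bar>t\<bar> \<le> real M" using real_arch_simple by blast
        show "\<forall>\<^sub>F N in sequentially. ennreal ((cmod (F N t))\<^sup>2) = ennreal ((cmod (G t))\<^sup>2)"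
          using eventually_ge_at_top[of M]
        proof eventually_elim
          case (elim N)
          then have "real M \<le> real N" by simp
          then show ?case using M by (simp add: F_def)
        qed
      qed
    qed measurable
    then show "(\<lambda>N. ennreal (2 * pi) * L2_square (F N)) \<longlonglongrightarrow> ennreal (2 * pi) * L2_square G"
      by (intro ennreal_tendsto_cmult) simp_all
    show "\<exists>N. \<forall>n\<ge>N. ennreal (2 * pi) * L2_square (F n) \<le> L2_square (line_fourier G)"
      unfolding F_def using line_fourier_truncated_bound[OF G] by auto
  qed
qed

section \<open>The X-ray transform identity\<close>

lemma borel_measurable_surface_measure: "f \<in> borel_measurable borel \<Longrightarrow> f \<in> borel_measurable surface_measure"
  by (simp add: measurable_cong_sets[OF sets_surface_measure refl] measurable_restrict_space1)

lemma borel_measurable_slice_measure: "f \<in> borel_measurable borel \<Longrightarrow> f \<in> borel_measurable (slice_measure \<omega> t)"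
  by (simp add: measurable_cong_sets[OF sets_slice_measure refl] measurable_restrict_space1)

lemma space_surface_measure: "space (surface_measure :: 'a::euclidean_space measure) = sphere 0 1"
  using sets_eq_imp_space_eq[OF sets_surface_measure] by (simp add: space_restrict_space)

lemma space_slice_measure: "space (slice_measure \<omega> t) = {x \<in> sphere 0 1. x \<bullet> \<omega> = t}"
  using sets_eq_imp_space_eq[OF sets_slice_measure] by (simp add: space_restrict_space)

text \<open>The slicing formula for the positive and negative parts. For heights at which a part has infinite integral
  the Bochner integral is 0 by convention, which the case distinction in the proof takes into account to obtain
  measurability of \<open>R\<close>.\<close>

lemma sphere_slicing_real_integral:
  fixes \<omega> :: "'a::euclidean_space" and f :: "'a \<Rightarrow> real"
  assumes n: "DIM('a) \<ge> 2" and \<omega>: "norm \<omega> = 1" and f: "f \<in> borel_measurable borel" and int: "integrable surface_measure f"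
  defines "R \<equiv> \<lambda>t. indicator {-1<..<1} t * (\<integral>x. f x \<partial>slice_measure \<omega> t)"
  shows "integrable lborel R" "(\<integral>t. R t \<partial>lborel) = (\<integral>x. f x \<partial>surface_measure)"
    "AE t in lborel. t \<in> {-1<..<1} \<longrightarrow> integrable (slice_measure \<omega> t) f"
proof -
  define P where "P t = (\<integral>\<^sup>+x. ennreal (f x) \<partial>slice_measure \<omega> t) * indicator {-1<..<1} t" for t
  define Q where "Q t = (\<integral>\<^sup>+x. ennreal (- f x) \<partial>slice_measure \<omega> t) * indicator {-1<..<1} t" for t
  have P: "P \<in> borel_measurable borel" "(\<integral>\<^sup>+x. ennreal (f x) \<partial>surface_measure) = (\<integral>\<^sup>+t. P t \<partial>lborel)"
    using sphere_slicing[OF n \<omega>, of "\<lambda>x. ennreal (f x)"] f unfolding P_def by auto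
  have Q: "Q \<in> borel_measurable borel" "(\<integral>\<^sup>+x. ennreal (- f x) \<partial>surface_measure) = (\<integral>\<^sup>+t. Q t \<partial>lborel)"
    using sphere_slicing[OF n \<omega>, of "\<lambda>x. ennreal (- f x)"] f unfolding Q_def by auto
  note [measurable] = P(1) Q(1)
  have fin: "(\<integral>\<^sup>+t. P t \<partial>lborel) < \<infinity>" "(\<integral>\<^sup>+t. Q t \<partial>lborel) < \<infinity>"
    using int unfolding P(2)[symmetric] Q(2)[symmetric] real_integrable_def by (auto simp: less_top)
  have AEfin: "AE t in lborel. P t < \<infinity>" "AE t in lborel. Q t < \<infinity>"
    using nn_integral_PInf_AE[of P lborel] nn_integral_PInf_AE[of Q lborel] fin by (auto simp: less_top)
  have sl: "integrable (slice_measure \<omega> t) f" "R t = enn2real (P t) - enn2real (Q t)"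
    if "t \<in> {-1<..<1}" "P t < \<infinity>" "Q t < \<infinity>" for t
  proof -
    show 1: "integrable (slice_measure \<omega> t) f"
      using that f unfolding real_integrable_def P_def Q_def by (auto simp: borel_measurable_slice_measure less_top)
    show "R t = enn2real (P t) - enn2real (Q t)"
      using that real_lebesgue_integral_def[OF 1] by (simp add: R_def P_def Q_def)
  qed
  show "AE t in lborel. t \<in> {-1<..<1} \<longrightarrow> integrable (slice_measure \<omega> t) f"
    using AEfin by eventually_elim (use sl in blast)
  define R' where "R' t = enn2real (P t) - enn2real (Q t)" for t
  have e: "integrable lborel (\<lambda>t. enn2real (P t))" "(\<integral>t. enn2real (P t) \<partial>lborel) = enn2real (\<integral>\<^sup>+x. ennreal (f x) \<partial>surface_measure)"
    "integrable lborel (\<lambda>t. enn2real (Q t))" "(\<integral>t. enn2real (Q t) \<partial>lborel) = enn2real (\<integral>\<^sup>+x. ennreal (- f x) \<partial>surface_measure)"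
  proof -
    have 1: "(\<integral>\<^sup>+t. ennreal (enn2real (P t)) \<partial>lborel) = (\<integral>\<^sup>+t. P t \<partial>lborel)"
    proof (rule nn_integral_cong_AE)
      show "AE t in lborel. ennreal (enn2real (P t)) = P t" using AEfin(1) by eventually_elim simp
    qed
    have 2: "(\<integral>\<^sup>+t. ennreal (enn2real (Q t)) \<partial>lborel) = (\<integral>\<^sup>+t. Q t \<partial>lborel)"
    proof (rule nn_integral_cong_AE)
      show "AE t in lborel. ennreal (enn2real (Q t)) = Q t" using AEfin(2) by eventually_elim simp
    qed
    show "integrable lborel (\<lambda>t. enn2real (P t))" "integrable lborel (\<lambda>t. enn2real (Q t))"
      using fin 1 2 by (auto intro!: integrableI_bounded)
    show "(\<integral>t. enn2real (P t) \<partial>lborel) = enn2real (\<integral>\<^sup>+x. ennreal (f x) \<partial>surface_measure)"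
      "(\<integral>t. enn2real (Q t) \<partial>lborel) = enn2real (\<integral>\<^sup>+x. ennreal (- f x) \<partial>surface_measure)"
      using 1 2 P(2) Q(2) by (simp_all add: integral_eq_nn_integral)
  qed
  have Req: "R t = (if P t < \<infinity> \<and> Q t < \<infinity> then R' t else 0)" for t
  proof (cases "t \<in> {-1<..<1}")
    case True
    show ?thesis
    proof (cases "P t < \<infinity> \<and> Q t < \<infinity>")
      case True
      then have "R t = R' t" unfolding R'_def using \<open>t \<in> {-1<..<1}\<close> by (intro sl(2)) blast+
      then show ?thesis using True by simp
    next
      case False
      then have "\<not> integrable (slice_measure \<omega> t) f"
        using True unfolding real_integrable_def P_def Q_def by (auto simp: less_top)
      then have "R t = 0" by (simp add: R_def not_integrable_integral_eq)
      then show ?thesis using False by auto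
    qed
  next
    case False
    then show ?thesis by (simp add: R_def R'_def P_def Q_def)
  qed
  have Rm: "R \<in> borel_measurable borel" unfolding Req[abs_def] R'_def by measurable
  have AER: "AE t in lborel. R t = R' t" using AEfin by eventually_elim (simp add: Req)
  have R'm: "R' \<in> borel_measurable borel" unfolding R'_def by measurable
  have "integrable lborel R'" unfolding R'_def using e by simp
  then show "integrable lborel R" using integrable_cong_AE[OF _ _ AER] Rm R'm by simp
  have "(\<integral>t. R t \<partial>lborel) = (\<integral>t. R' t \<partial>lborel)" using AER Rm R'm by (intro integral_cong_AE) auto
  also have "\<dots> = (\<integral>x. f x \<partial>surface_measure)" unfolding R'_def using e real_lebesgue_integral_def[OF int] by simp
  finally show "(\<integral>t. R t \<partial>lborel) = (\<integral>x. f x \<partial>surface_measure)" .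
qed

text \<open>A function \<open>G\<close> that agrees with the slice integrals only almost everywhere is enough for the
  application: at exceptional heights, where the real or the imaginary part of \<open>f\<close> is not integrable, the
  complex integral and its parts follow different default values.\<close>

lemma sphere_slicing_complex_integral:
  fixes \<omega> :: "'a::euclidean_space" and f :: "'a \<Rightarrow> complex"
  assumes n: "DIM('a) \<ge> 2" and \<omega>: "norm \<omega> = 1" and int: "integrable surface_measure f"
  obtains G where "integrable lborel G" "AE t in lborel. G t = indicator {-1<..<1} t *\<^sub>R (\<integral>x. f x \<partial>slice_measure \<omega> t)"
    "(\<integral>x. f x \<partial>surface_measure) = (\<integral>t. G t \<partial>lborel)"
proof -
  \<comment> \<open>A Borel function on the whole space is needed to apply the slicing formula.\<close>
  define f' where "f' x = indicator (sphere 0 1) x *\<^sub>R f x" for x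
  have f'm: "f' \<in> borel_measurable borel"
  proof -
    have "f \<in> borel_measurable (restrict_space borel (sphere 0 1))"
      using borel_measurable_integrable[OF int] by (simp add: measurable_cong_sets[OF sets_surface_measure refl])
    then show ?thesis unfolding f'_def by (subst (asm) borel_measurable_restrict_space_iff) auto
  qed
  have f'eq: "f' x = f x" if "norm x = 1" for x using that by (simp add: f'_def)
  have int': "integrable surface_measure f'"
    using int by (rule Bochner_Integration.integrable_cong[THEN iffD1, rotated -1]) (auto simp: space_surface_measure f'eq)
  have s1: "(\<integral>x. f' x \<partial>surface_measure) = (\<integral>x. f x \<partial>surface_measure)"
    by (intro Bochner_Integration.integral_cong) (auto simp: space_surface_measure f'eq)
  have s2: "(\<integral>x. f' x \<partial>slice_measure \<omega> t) = (\<integral>x. f x \<partial>slice_measure \<omega> t)" for t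
    by (intro Bochner_Integration.integral_cong) (auto simp: space_slice_measure f'eq)
  have m: "(\<lambda>x. Re (f' x)) \<in> borel_measurable borel" "(\<lambda>x. Im (f' x)) \<in> borel_measurable borel" using f'm by auto
  have i: "integrable surface_measure (\<lambda>x. Re (f' x))" "integrable surface_measure (\<lambda>x. Im (f' x))" using int' by auto
  define R where "R t = indicator {-1<..<1} t * (\<integral>x. Re (f' x) \<partial>slice_measure \<omega> t)" for t
  define I where "I t = indicator {-1<..<1} t * (\<integral>x. Im (f' x) \<partial>slice_measure \<omega> t)" for t
  note Rf = sphere_slicing_real_integral[OF n \<omega> m(1) i(1), folded R_def]
  note If = sphere_slicing_real_integral[OF n \<omega> m(2) i(2), folded I_def]
  define G where "G t = complex_of_real (R t) + \<i> * complex_of_real (I t)" for t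
  have split: "(\<integral>x. f' x \<partial>M) = complex_of_real (\<integral>x. Re (f' x) \<partial>M) + \<i> * complex_of_real (\<integral>x. Im (f' x) \<partial>M)"
    if "integrable M f'" for M
    using that by (simp add: complex_eq_iff)
  show ?thesis
  proof
    show Gi: "integrable lborel G" unfolding G_def using Rf(1) If(1) by simp
    show "AE t in lborel. G t = indicator {-1<..<1} t *\<^sub>R (\<integral>x. f x \<partial>slice_measure \<omega> t)"
      using Rf(3) If(3)
    proof eventually_elim
      case (elim t)
      show ?case
      proof (cases "t \<in> {-1<..<1}")
        case True
        then have "integrable (slice_measure \<omega> t) (\<lambda>x. complex_of_real (Re (f' x)) + \<i> * complex_of_real (Im (f' x)))"
          using elim by simp
        then have "integrable (slice_measure \<omega> t) f'" by (simp flip: complex_eq)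
        from split[OF this] show ?thesis using True by (simp add: G_def R_def I_def s2)
      next
        case False
        then show ?thesis by (simp add: G_def R_def I_def)
      qed
    qed
    have "(\<integral>t. G t \<partial>lborel) = complex_of_real (\<integral>t. R t \<partial>lborel) + \<i> * complex_of_real (\<integral>t. I t \<partial>lborel)"
      unfolding G_def using Rf(1) If(1) by simp
    then show "(\<integral>x. f x \<partial>surface_measure) = (\<integral>t. G t \<partial>lborel)"
      using split[OF int'] Rf(2) If(2) s1 by simp
  qed
qed

text \<open>On each slice \<open>\<omega> \<bullet> \<xi>\<close> is the constant \<open>t\<close>, so moving along \<open>\<omega>\<close> multiplies the slice integrals by
  \<open>iexp (s * t)\<close>: the Fourier transform restricted to the line is the Fourier transform of \<open>G\<close>.\<close>

lemma xray_fourier_surface_measure: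
  fixes \<omega> v :: "'a::euclidean_space" and g :: "'a \<Rightarrow> complex"
  assumes n: "DIM('a) \<ge> 2" and \<omega>: "norm \<omega> = 1" and g: "integrable surface_measure g"
  shows "xray (\<lambda>x. ennreal ((cmod (fourier_measure surface_measure g x))\<^sup>2)) \<omega> v
    = ennreal (2 * pi) * (\<integral>\<^sup>+t\<in>{-1<..<1}. ennreal ((cmod (fourier_measure (slice_measure \<omega> t) g v))\<^sup>2) \<partial>lborel)"
proof -
  have em: "(\<lambda>\<xi>. iexp (x \<bullet> \<xi>)) \<in> borel_measurable surface_measure" for x :: 'a
    by (intro borel_measurable_surface_measure) measurable
  have gi: "integrable surface_measure (\<lambda>\<xi>. iexp (x \<bullet> \<xi>) * g \<xi>)" for x
    by (rule Bochner_Integration.integrable_bound[OF g])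
      (use em borel_measurable_integrable[OF g] in \<open>auto simp: norm_mult\<close>)
  obtain G where G: "integrable lborel G"
    "AE t in lborel. G t = indicator {-1<..<1} t *\<^sub>R fourier_measure (slice_measure \<omega> t) g v"
  proof (rule sphere_slicing_complex_integral[OF n \<omega> gi[of v]])
    fix G :: "real \<Rightarrow> complex"
    assume "integrable lborel G"
      "AE t in lborel. G t = indicator {-1<..<1} t *\<^sub>R (\<integral>\<xi>. iexp (v \<bullet> \<xi>) * g \<xi> \<partial>slice_measure \<omega> t)"
    then show thesis unfolding fourier_measure_def[symmetric] by (rule that)
  qed
  have Gm: "G \<in> borel_measurable lborel" using G(1) by (rule borel_measurable_integrable)
  have line: "fourier_measure surface_measure g (v + s *\<^sub>R \<omega>) = line_fourier G s" for s
  proof -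
    obtain Gs where Gs: "integrable lborel Gs"
      "AE t in lborel. Gs t = indicator {-1<..<1} t *\<^sub>R fourier_measure (slice_measure \<omega> t) g (v + s *\<^sub>R \<omega>)"
      "fourier_measure surface_measure g (v + s *\<^sub>R \<omega>) = (\<integral>t. Gs t \<partial>lborel)"
    proof (rule sphere_slicing_complex_integral[OF n \<omega> gi[of "v + s *\<^sub>R \<omega>"]])
      fix Gs :: "real \<Rightarrow> complex"
      assume "integrable lborel Gs"
        "AE t in lborel. Gs t = indicator {-1<..<1} t *\<^sub>R
          (\<integral>\<xi>. iexp ((v + s *\<^sub>R \<omega>) \<bullet> \<xi>) * g \<xi> \<partial>slice_measure \<omega> t)"
        "(\<integral>\<xi>. iexp ((v + s *\<^sub>R \<omega>) \<bullet> \<xi>) * g \<xi> \<partial>surface_measure) = (\<integral>t. Gs t \<partial>lborel)"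
      then show thesis unfolding fourier_measure_def[symmetric] by (rule that)
    qed
    have sl: "fourier_measure (slice_measure \<omega> t) g (v + s *\<^sub>R \<omega>) = iexp (s * t) * fourier_measure (slice_measure \<omega> t) g v" for t
    proof -
      have "fourier_measure (slice_measure \<omega> t) g (v + s *\<^sub>R \<omega>) = (\<integral>\<xi>. iexp (s * t) * (iexp (v \<bullet> \<xi>) * g \<xi>) \<partial>slice_measure \<omega> t)"
        unfolding fourier_measure_def
      proof (intro Bochner_Integration.integral_cong refl)
        fix \<xi> assume "\<xi> \<in> space (slice_measure \<omega> t)"
        then have "\<omega> \<bullet> \<xi> = t" by (simp add: space_slice_measure inner_commute)
        then show "iexp ((v + s *\<^sub>R \<omega>) \<bullet> \<xi>) * g \<xi> = iexp (s * t) * (iexp (v \<bullet> \<xi>) * g \<xi>)"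
          by (simp add: inner_add_left distrib_left exp_add mult_ac)
      qed
      then show ?thesis unfolding fourier_measure_def by simp
    qed
    have "(\<integral>t. Gs t \<partial>lborel) = (\<integral>t. iexp (s * t) * G t \<partial>lborel)"
    proof (rule integral_cong_AE)
      show "Gs \<in> borel_measurable lborel" using Gs(1) by (rule borel_measurable_integrable)
      show "(\<lambda>t. iexp (s * t) * G t) \<in> borel_measurable lborel" using Gm by measurable
      show "AE t in lborel. Gs t = iexp (s * t) * G t"
        using Gs(2) G(2) by eventually_elim (simp add: sl)
    qed
    then show ?thesis using Gs(3) by (simp add: line_fourier_def)
  qed
  have "xray (\<lambda>x. ennreal ((cmod (fourier_measure surface_measure g x))\<^sup>2)) \<omega> v = (\<integral>\<^sup>+s. ennreal ((cmod (line_fourier G s))\<^sup>2) \<partial>lborel)"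
    unfolding xray_def line ..
  also have "\<dots> = ennreal (2 * pi) * (\<integral>\<^sup>+t. ennreal ((cmod (G t))\<^sup>2) \<partial>lborel)" by (rule plancherel_L1[OF G(1)])
  also have "(\<integral>\<^sup>+t. ennreal ((cmod (G t))\<^sup>2) \<partial>lborel) = (\<integral>\<^sup>+t\<in>{-1<..<1}. ennreal ((cmod (fourier_measure (slice_measure \<omega> t) g v))\<^sup>2) \<partial>lborel)"
  proof (rule nn_integral_cong_AE)
    show "AE t in lborel. ennreal ((cmod (G t))\<^sup>2) = ennreal ((cmod (fourier_measure (slice_measure \<omega> t) g v))\<^sup>2) * indicator {-1<..<1} t"
      using G(2) by eventually_elim (simp add: indicator_def)
  qed
  finally show ?thesis .
qed

lemma ennreal_sqrt_squared: "(ennreal_sqrt x)\<^sup>2 = x"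
proof (cases x)
  case (real r)
  then show ?thesis by (simp add: ennreal_sqrt_def ennreal_power)
next
  case top
  then show ?thesis by (simp add: ennreal_sqrt_def power2_eq_square)
qed

text \<open>Up to null sets \<open>g\<close> is a constant sign times its modulus.\<close>

lemma single_signed_cmod_fourier:
  fixes g :: "'a::euclidean_space \<Rightarrow> complex"
  assumes g: "integrable surface_measure g" and s: "single_signed g"
  shows "cmod (fourier_measure surface_measure g x) = cmod (fourier_measure surface_measure (\<lambda>\<xi>. complex_of_real (cmod (g \<xi>))) x)"
proof -
  have [measurable]: "g \<in> borel_measurable surface_measure" using g by (rule borel_measurable_integrable)
  have [measurable]: "(\<lambda>\<xi>. iexp (x \<bullet> \<xi>)) \<in> borel_measurable surface_measure"
    by (intro borel_measurable_surface_measure) measurable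
  have key: "cmod (fourier_measure surface_measure g x) = cmod (fourier_measure surface_measure (\<lambda>\<xi>. complex_of_real (cmod (g \<xi>))) x)"
    if "AE \<xi> in surface_measure. g \<xi> = c * complex_of_real (cmod (g \<xi>))" "cmod c = 1" for c
  proof -
    have "fourier_measure surface_measure g x = (\<integral>\<xi>. c * (iexp (x \<bullet> \<xi>) * complex_of_real (cmod (g \<xi>))) \<partial>surface_measure)"
      unfolding fourier_measure_def
    proof (rule integral_cong_AE)
      show "AE \<xi> in surface_measure. iexp (x \<bullet> \<xi>) * g \<xi> = c * (iexp (x \<bullet> \<xi>) * complex_of_real (cmod (g \<xi>)))"
        using that(1) by eventually_elim (simp add: mult.left_commute)
    qed measurable
    then show ?thesis using that(2) by (simp add: fourier_measure_def norm_mult)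
  qed
  from s show ?thesis unfolding single_signed_def
  proof
    assume *: "AE \<xi> in surface_measure. g \<xi> \<in> \<real> \<and> Re (g \<xi>) \<ge> 0"
    have "AE \<xi> in surface_measure. g \<xi> = 1 * complex_of_real (cmod (g \<xi>))"
      using * by eventually_elim (auto elim!: Reals_cases)
    then show ?thesis by (rule key) simp
  next
    assume *: "AE \<xi> in surface_measure. g \<xi> \<in> \<real> \<and> Re (g \<xi>) \<le> 0"
    have "AE \<xi> in surface_measure. g \<xi> = -1 * complex_of_real (cmod (g \<xi>))"
      using * by eventually_elim (auto elim!: Reals_cases)
    then show ?thesis by (rule key) simp
  qed
qed

theorem theorem1p5:
  fixes g :: "'a::euclidean_space \<Rightarrow> complex" and \<omega> :: 'a
  assumes "DIM('a) \<ge> 2"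
    and "integrable surface_measure g"
    and "\<omega> \<in> sphere 0 1"
  shows "(\<forall>v \<in> orthogonal_comp (span {\<omega>}).
            xray (\<lambda>x. ennreal ((cmod (fourier_measure surface_measure g x))\<^sup>2)) \<omega> v
            = ennreal (2 * pi) *
              (\<integral>\<^sup>+t\<in>{-1<..<1}. ennreal ((cmod (fourier_measure (slice_measure \<omega> t) g v))\<^sup>2) \<partial>lborel))
       \<and> (SUP v \<in> orthogonal_comp (span {\<omega>}).
            xray (\<lambda>x. ennreal ((cmod (fourier_measure surface_measure g x))\<^sup>2)) \<omega> v)
          \<le> xray0 (\<lambda>x. ennreal ((cmod (fourier_measure surface_measure
                (\<lambda>\<xi>. complex_of_real (cmod (g \<xi>))) x))\<^sup>2)) \<omega>
       \<and> xray0 (\<lambda>x. ennreal ((cmod (fourier_measure surface_measure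
                (\<lambda>\<xi>. complex_of_real (cmod (g \<xi>))) x))\<^sup>2)) \<omega>
          = ennreal (2 * pi) * (slice_square (\<lambda>\<xi>. cmod (g \<xi>)) \<omega>)\<^sup>2
       \<and> (single_signed g \<longrightarrow>
          (SUP v \<in> orthogonal_comp (span {\<omega>}).
            xray (\<lambda>x. ennreal ((cmod (fourier_measure surface_measure g x))\<^sup>2)) \<omega> v)
          = xray0 (\<lambda>x. ennreal ((cmod (fourier_measure surface_measure
                (\<lambda>\<xi>. complex_of_real (cmod (g \<xi>))) x))\<^sup>2)) \<omega>)"
proof -
  have \<omega>: "norm \<omega> = 1" using assms(3) by simp
  let ?a = "\<lambda>\<xi>. complex_of_real (cmod (g \<xi>))"
  let ?X = "\<lambda>v. xray (\<lambda>x. ennreal ((cmod (fourier_measure surface_measure g x))\<^sup>2)) \<omega> v"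
  let ?Y = "xray0 (\<lambda>x. ennreal ((cmod (fourier_measure surface_measure ?a x))\<^sup>2)) \<omega>"
  have a: "integrable surface_measure ?a" using assms(2) by simp
  note id = xray_fourier_surface_measure[OF assms(1) \<omega> assms(2)]
  have mean: "fourier_measure (slice_measure \<omega> t) ?a 0 = complex_of_real (slice_mean t (\<lambda>\<xi>. cmod (g \<xi>)) \<omega>)" for t
    by (simp add: fourier_measure_def slice_mean_def)
  have "?Y = xray (\<lambda>x. ennreal ((cmod (fourier_measure surface_measure ?a x))\<^sup>2)) \<omega> 0"
    by (simp add: xray0_def xray_def)
  also have "\<dots> = ennreal (2 * pi) * (\<integral>\<^sup>+t\<in>{-1<..<1}. ennreal ((slice_mean t (\<lambda>\<xi>. cmod (g \<xi>)) \<omega>)\<^sup>2) \<partial>lborel)"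
    unfolding xray_fourier_surface_measure[OF assms(1) \<omega> a] mean by simp
  finally have X0: "?Y = ennreal (2 * pi) * (\<integral>\<^sup>+t\<in>{-1<..<1}. ennreal ((slice_mean t (\<lambda>\<xi>. cmod (g \<xi>)) \<omega>)\<^sup>2) \<partial>lborel)" .
  have le: "?X v \<le> ?Y" for v
    unfolding id X0
  proof (intro mult_left_mono nn_integral_mono mult_right_mono ennreal_leI power_mono)
    fix t
    have "cmod (fourier_measure (slice_measure \<omega> t) g v) \<le> (\<integral>\<xi>. cmod (iexp (v \<bullet> \<xi>) * g \<xi>) \<partial>slice_measure \<omega> t)"
      unfolding fourier_measure_def by (rule integral_norm_bound)
    then show "cmod (fourier_measure (slice_measure \<omega> t) g v) \<le> slice_mean t (\<lambda>\<xi>. cmod (g \<xi>)) \<omega>"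
      by (simp add: norm_mult slice_mean_def)
  qed simp_all
  have sup: "(SUP v \<in> orthogonal_comp (span {\<omega>}). ?X v) \<le> ?Y" using le by (rule SUP_least)
  have eq: "(SUP v \<in> orthogonal_comp (span {\<omega>}). ?X v) = ?Y" if "single_signed g"
  proof (rule antisym[OF sup])
    have "?Y = ?X 0" unfolding xray0_def xray_def single_signed_cmod_fourier[OF assms(2) that] by simp
    also have "\<dots> \<le> (SUP v \<in> orthogonal_comp (span {\<omega>}). ?X v)"
      by (rule SUP_upper) (simp add: orthogonal_comp_def orthogonal_def)
    finally show "?Y \<le> (SUP v \<in> orthogonal_comp (span {\<omega>}). ?X v)" .
  qed
  show ?thesis
    using id sup eq unfolding X0 slice_square_def ennreal_sqrt_squared by blast
qed

end
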